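(* Let $\alpha\in\mathopen]0,1[$, $q\in\mathbb{D}^+_n(\mathbb{R})$, $\eta\in\mathbb{R}^n$, $k\in\mathbb{C}$. Let $\Omega$ be a bounded open connected subset of $\mathbb{R}^n$ of class $C^{1,\alpha}$ such that $\mathbb{R}^n\setminus\overline{\Omega}$ is connected. Let $p\in Q$ and let $\epsilon_0\in\mathopen]0,+\infty[$ be such that $p+\epsilon\overline{\Omega}\subseteq Q$ for all $\epsilon\in\mathopen]-\epsilon_0,\epsilon_0[$. Let $V$ be a bounded open subset of $\mathbb{R}^n$ such that $\overline{V}\cap(p+q\mathbb{Z}^n)=\emptyset$. Let $\epsilon_V\in\mathopen]0,\epsilon_0[$ be such that $\overline{V}\subseteq\mathbb{S}_q^-[\Omega_{p,\epsilon}]$ for all $\epsilon\in\mathopen]-\epsilon_V,\epsilon_V[$. Let $M$ be the map from $\mathopen]-\epsilon_V,\epsilon_V[$ to $\mathcal{L}(C^{0,\alpha}(\partial\Omega),C^2(\overline{V}))$ defined by $$M[\epsilon](\theta)(x):=\int_{\partial\Omega}G^{k}_{q,\eta}(x-p-\epsilon s)\theta(s)\,d\sigma_s\qquad\forall x\in\overline{V},$$ for all $\theta\in C^{0,\alpha}(\partial\Omega)$ and $\epsilon\in\mathopen]-\epsilon_V,\epsilon_V[$. Then $M$ is real analytic and $$\mathcal{S}^{k,-}_{q,\eta}[\partial\Omega_{p,\epsilon},\theta((\cdot-p)/\epsilon)](x)=\epsilon^{n-1}M[\epsilon](\theta)(x)\qquad\forall x\in\overline{V},$$ for all $\theta\in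 C^{0,\alpha}(\partial\Omega)$ and $\epsilon\in\mathopen]0,\epsilon_V[$.
   Context: Let $n\in\mathbb{N}$, $n\ge 2$. $\mathbb{D}^+_n(\mathbb{R})$ is the set of $n\times n$ real diagonal matrices with positive diagonal entries. For $q\in\mathbb{D}^+_n(\mathbb{R})$ with diagonal entries $q_{11},\dots,q_{nn}$, let $Q:=\prod_{j=1}^n\mathopen]0,q_{jj}[$ and $|Q|_n$ its $n$-dimensional measure. Functions are complex-valued; $C^{m,\alpha}$ are the usual Schauder spaces; $C^2(\overline V)$ is the Banach space of $C^2$ functions in $V$ whose derivatives up to order two extend continuously to $\overline V$; $\mathcal{L}(X,Y)$ is the Banach space of bounded linear operators from $X$ to $Y$. $\Omega_{p,\epsilon}:=p+\epsilon\Omega$ for $\epsilon\in\mathbb{R}$. For $D\subseteq\mathbb{R}^n$: $\mathbb{S}_q[D]:=\bigcup_{z\in\mathbb{Z}^n}(qz+D)$ and $\mathbb{S}^-_q[D]:=\mathbb{R}^n\setminus\overline{\mathbb{S}_q[D]}$. $Z_{q,\eta}(k):=\{z\in\mathbb{Z}^n:k^2=|2\pi q^{-1}z+\eta|^2\}$ and $$G^{k}_{q,\eta}:=\sum_{z\in\mathbb{Z}^n\setminus Z_{q,\eta}(k)}\frac{1}{|Q|_n(k^2-|2\pi q^{-1}z+\eta|^2)}e^{ix\cdot(2\pi q^{-1}z+\eta)}$$ (series converging in $\mathcal{S}'(\mathbb{R}^n)$), a locally integrable function, real analytic on $\mathbb{R}^n\setminus q\mathbb{Z}^n$. For a bounded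 open set $D$ of class $C^{1,\alpha}$ with $\overline D\subseteq Q$ and a density $\mu$ on $\partial D$, $\mathcal{S}^{k}_{q,\eta}[\partial D,\mu](x):=\int_{\partial D}G^{k}_{q,\eta}(x-y)\mu(y)\,d\sigma_y$ for $x\in\mathbb{R}^n$, and $\mathcal{S}^{k,-}_{q,\eta}[\partial D,\mu]$ is its restriction to $\overline{\mathbb{S}^-_q[D]}$. *)

theory Defs
  imports "HOL-Analysis.Analysis"
begin

section \<open>Partial derivatives and spaces of differentiable functions\<close>

text \<open>A list of directions stands for an iterated partial derivative. All notions below require
  the functions to be differentiable enough for \<^term>\<open>frechet_derivative\<close> to be meaningful on the
  open set considered.\<close>

fun iter_partial :: "'n list \<Rightarrow> (real ^ 'n \<Rightarrow> 'b::real_normed_vector) \<Rightarrow> real ^ 'n \<Rightarrow> 'b" where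
  "iter_partial [] f = f"
| "iter_partial (i # is) f = (\<lambda>x. frechet_derivative (iter_partial is f) (at x) (axis i 1))"

definition C_k_on :: "nat \<Rightarrow> (real ^ 'n) set \<Rightarrow> (real ^ 'n \<Rightarrow> 'b::real_normed_vector) \<Rightarrow> bool" where
  "C_k_on m U f \<longleftrightarrow>
     (\<forall>is. length is < m \<longrightarrow> (\<forall>x\<in>U. iter_partial is f differentiable (at x))) \<and>
     (\<forall>is. length is \<le> m \<longrightarrow> continuous_on U (iter_partial is f))"

definition holder_on :: "real \<Rightarrow> 'a::metric_space set \<Rightarrow> ('a \<Rightarrow> 'b::real_normed_vector) \<Rightarrow> bool" where
  "holder_on \<alpha> S f \<longleftrightarrow> (\<exists>C. \<forall>x\<in>S. \<forall>y\<in>S. norm (f x - f y) \<le> C * dist x y powr \<alpha>)"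

text \<open>On an open set \<open>U\<close>, the derivatives of order \<open>m\<close> are locally Hoelder continuous, that is,
  Hoelder continuous on the compact subsets of \<open>U\<close> (as in Gilbarg--Trudinger).\<close>

definition C_k_alpha_on :: "nat \<Rightarrow> real \<Rightarrow> (real ^ 'n) set \<Rightarrow> (real ^ 'n \<Rightarrow> 'b::real_normed_vector) \<Rightarrow> bool" where
  "C_k_alpha_on m \<alpha> U f \<longleftrightarrow> C_k_on m U f \<and>
     (\<forall>is K. length is = m \<longrightarrow> compact K \<longrightarrow> K \<subseteq> U \<longrightarrow> holder_on \<alpha> K (iter_partial is f))"

text \<open>Boundary regularity by local straightening (Gilbarg--Trudinger, Section 6.2). The half space is
  taken with respect to an arbitrary coordinate \<open>i\<close>, since the index type has no distinguished
  last element.\<close>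

definition of_class_C_k_alpha :: "nat \<Rightarrow> real \<Rightarrow> (real ^ 'n) set \<Rightarrow> bool" where
  "of_class_C_k_alpha m \<alpha> D \<longleftrightarrow>
     (\<forall>x0\<in>frontier D. \<exists>r>0. \<exists>(\<psi> :: real ^ 'n \<Rightarrow> real ^ 'n) i.
        inj_on \<psi> (ball x0 r) \<and> open (\<psi> ` ball x0 r) \<and>
        \<psi> ` (ball x0 r \<inter> D) \<subseteq> {y. y $ i > 0} \<and>
        \<psi> ` (ball x0 r \<inter> frontier D) \<subseteq> {y. y $ i = 0} \<and>
        C_k_alpha_on m \<alpha> (ball x0 r) \<psi> \<and>
        C_k_alpha_on m \<alpha> (\<psi> ` ball x0 r) (inv_into (ball x0 r) \<psi>))"

text \<open>Real analytic functions of several variables: locally the sum of an (absolutely) convergent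
  power series, indexed by the multi-indices \<open>\<beta> :: 'n \<Rightarrow> nat\<close>.\<close>

definition real_analytic_fun_on :: "(real ^ 'n) set \<Rightarrow> (real ^ 'n \<Rightarrow> complex) \<Rightarrow> bool" where
  "real_analytic_fun_on U f \<longleftrightarrow>
     (\<forall>x0\<in>U. \<exists>r>0. \<exists>a :: ('n \<Rightarrow> nat) \<Rightarrow> complex. \<forall>x\<in>ball x0 r.
        ((\<lambda>\<beta>. a \<beta> * of_real (\<Prod>i\<in>UNIV. (x $ i - x0 $ i) ^ \<beta> i)) has_sum f x) UNIV)"

definition schwartz :: "(real ^ 'n \<Rightarrow> complex) set" where
  "schwartz = {\<phi>. (\<forall>m. C_k_on m UNIV \<phi>) \<and>
     (\<forall>is m. bounded (range (\<lambda>x. of_real ((1 + norm x) ^ m) * iter_partial is \<phi> x)))}"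


section \<open>Normed function spaces and real analytic operator-valued maps\<close>

text \<open>A space of complex functions on the set \<open>pts\<close>, with elements \<open>fns\<close> and norm \<open>nrm\<close>. The
  functions are represented by total functions whose values outside \<open>pts\<close> are irrelevant;
  accordingly \<open>nrm f\<close> depends only on the restriction of \<open>f\<close> to \<open>pts\<close>.\<close>

record 'a fspace =
  pts :: "'a set"
  fns :: "('a \<Rightarrow> complex) set"
  nrm :: "('a \<Rightarrow> complex) \<Rightarrow> real"

text \<open>The inserted 0 only matters for the empty set.\<close>

definition sup_norm :: "'a set \<Rightarrow> ('a \<Rightarrow> complex) \<Rightarrow> real" where
  "sup_norm S f = Sup (insert 0 ((\<lambda>x. norm (f x)) ` S))"

definition holder_seminorm :: "real \<Rightarrow> 'a::metric_space set \<Rightarrow> ('a \<Rightarrow> complex) \<Rightarrow> real" where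
  "holder_seminorm \<alpha> S f =
     Sup (insert 0 {norm (f x - f y) / dist x y powr \<alpha> | x y. x \<in> S \<and> y \<in> S \<and> x \<noteq> y})"

text \<open>The space $C^{0,\alpha}(K)$ for compact \<open>K\<close>.\<close>

definition holder_space :: "real \<Rightarrow> 'a::metric_space set \<Rightarrow> 'a fspace" where
  "holder_space \<alpha> K = \<lparr>pts = K, fns = {f. holder_on \<alpha> K f},
     nrm = (\<lambda>f. sup_norm K f + holder_seminorm \<alpha> K f)\<rparr>"

text \<open>The space $C^m(\overline{V})$ for bounded open \<open>V\<close>. The supremum over \<open>V\<close> of a derivative equals
  the supremum over the closure of its continuous extension.\<close>

definition C_closure_space :: "nat \<Rightarrow> (real ^ 'n) set \<Rightarrow> (real ^ 'n) fspace" where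
  "C_closure_space m V = \<lparr>pts = closure V,
     fns = {f. C_k_on m V f \<and> continuous_on (closure V) f \<and>
               (\<forall>is. length is \<le> m \<longrightarrow>
                  (\<exists>g. continuous_on (closure V) g \<and> (\<forall>x\<in>V. g x = iter_partial is f x)))},
     nrm = (\<lambda>f. \<Sum>is | length is \<le> m. sup_norm V (iter_partial is f))\<rparr>"

definition bounded_ops :: "'a fspace \<Rightarrow> 'b fspace \<Rightarrow> (('a \<Rightarrow> complex) \<Rightarrow> ('b \<Rightarrow> complex)) set" where
  "bounded_ops X Y = {T.
     (\<forall>f\<in>fns X. T f \<in> fns Y) \<and>
     (\<forall>f\<in>fns X. \<forall>g\<in>fns X. \<forall>x\<in>pts Y. T (\<lambda>s. f s + g s) x = T f x + T g x) \<and>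
     (\<forall>c. \<forall>f\<in>fns X. \<forall>x\<in>pts Y. T (\<lambda>s. c * f s) x = c * T f x) \<and>
     (\<exists>C. \<forall>f\<in>fns X. nrm Y (T f) \<le> C * nrm X f)}"

definition op_norm :: "'a fspace \<Rightarrow> 'b fspace \<Rightarrow> (('a \<Rightarrow> complex) \<Rightarrow> ('b \<Rightarrow> complex)) \<Rightarrow> real" where
  "op_norm X Y T = Sup {nrm Y (T f) | f. f \<in> fns X \<and> nrm X f \<le> 1}"

text \<open>\<open>M\<close> maps the open interval \<open>I\<close> into the bounded operators and is locally the sum of a power
  series with bounded operators as coefficients, converging in operator norm.\<close>

definition real_analytic_op_map ::
  "real set \<Rightarrow> 'a fspace \<Rightarrow> 'b fspace \<Rightarrow> (real \<Rightarrow> ('a \<Rightarrow> complex) \<Rightarrow> ('b \<Rightarrow> complex)) \<Rightarrow> bool" where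
  "real_analytic_op_map I X Y M \<longleftrightarrow>
     (\<forall>t\<in>I. M t \<in> bounded_ops X Y) \<and>
     (\<forall>t0\<in>I. \<exists>r>0. \<exists>A. (\<forall>j::nat. A j \<in> bounded_ops X Y) \<and>
        (\<forall>t\<in>I. \<bar>t - t0\<bar> < r \<longrightarrow>
          (\<lambda>N. op_norm X Y (\<lambda>f x. M t f x - (\<Sum>j<N. of_real ((t - t0) ^ j) * A j f x)))
            \<longlonglongrightarrow> 0))"


section \<open>Surface measure\<close>

text \<open>The surface measure on hypersurfaces is the Hausdorff measure of dimension \<open>CARD('n) - 1\<close> in
  \<open>real ^ 'n\<close>, normalised so as to agree with Lebesgue measure on hyperplanes.
  The outer measure is countably additive on the Borel sets by Caratheodory's criterion. It is
  used for \<open>CARD('n) \<ge> 2\<close> only, so that the empty set contributes 0 to the coverings.\<close>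

definition hausdorff_outer :: "nat \<Rightarrow> 'a::metric_space set \<Rightarrow> ennreal" where
  "hausdorff_outer s A =
     (SUP \<delta>\<in>{0<..}. INF C\<in>{C :: nat \<Rightarrow> 'a set. A \<subseteq> (\<Union>j. C j) \<and> (\<forall>j. bounded (C j) \<and> diameter (C j) \<le> \<delta>)}.
        (\<Sum>j. ennreal (unit_ball_vol (real s) * (diameter (C j) / 2) ^ s)))"

definition surface_measure :: "(real ^ 'n) measure" where
  "surface_measure = measure_of UNIV (sets borel) (hausdorff_outer (CARD('n) - 1))"


section \<open>Periodic sets and the quasi-periodic Green function\<close>

definition pos_diag :: "(real ^ 'n ^ 'n) set" where
  "pos_diag = {q. \<forall>i j. if i = j then q $ i $ j > 0 else q $ i $ j = 0}"

definition cell :: "real ^ 'n ^ 'n \<Rightarrow> (real ^ 'n) set" where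
  "cell q = {x. \<forall>j. 0 < x $ j \<and> x $ j < q $ j $ j}"

definition int_vec :: "int ^ 'n \<Rightarrow> real ^ 'n" where
  "int_vec z = (\<chi> i. real_of_int (z $ i))"

definition periodic_lattice :: "real ^ 'n ^ 'n \<Rightarrow> (real ^ 'n) set" where
  "periodic_lattice q = range (\<lambda>z. q *v int_vec z)"

definition scaled_set :: "real ^ 'n \<Rightarrow> real \<Rightarrow> (real ^ 'n) set \<Rightarrow> (real ^ 'n) set" where
  "scaled_set p \<epsilon> \<Omega> = (\<lambda>x. p + \<epsilon> *\<^sub>R x) ` \<Omega>"

definition S_per :: "real ^ 'n ^ 'n \<Rightarrow> (real ^ 'n) set \<Rightarrow> (real ^ 'n) set" where
  "S_per q D = (\<Union>z. (\<lambda>x. q *v int_vec z + x) ` D)"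

definition S_per_minus :: "real ^ 'n ^ 'n \<Rightarrow> (real ^ 'n) set \<Rightarrow> (real ^ 'n) set" where
  "S_per_minus q D = UNIV - closure (S_per q D)"

definition freq :: "real ^ 'n ^ 'n \<Rightarrow> real ^ 'n \<Rightarrow> int ^ 'n \<Rightarrow> real ^ 'n" where
  "freq q \<eta> z = (2 * pi) *\<^sub>R (matrix_inv q *v int_vec z) + \<eta>"

definition Z_res :: "real ^ 'n ^ 'n \<Rightarrow> real ^ 'n \<Rightarrow> complex \<Rightarrow> (int ^ 'n) set" where
  "Z_res q \<eta> k = {z. k\<^sup>2 = of_real ((norm (freq q \<eta> z))\<^sup>2)}"

definition green_term :: "real ^ 'n ^ 'n \<Rightarrow> real ^ 'n \<Rightarrow> complex \<Rightarrow> int ^ 'n \<Rightarrow> real ^ 'n \<Rightarrow> complex" where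
  "green_term q \<eta> k z x =
     1 / (of_real (measure lborel (cell q)) * (k\<^sup>2 - of_real ((norm (freq q \<eta> z))\<^sup>2)))
       * exp (\<i> * of_real (x \<bullet> freq q \<eta> z))"

text \<open>\<open>g\<close> is a locally integrable function, real analytic off the lattice, and the tempered
  distribution it defines is the sum of the series in the space of tempered distributions.\<close>

definition is_green_function :: "real ^ 'n ^ 'n \<Rightarrow> real ^ 'n \<Rightarrow> complex \<Rightarrow> (real ^ 'n \<Rightarrow> complex) \<Rightarrow> bool" where
  "is_green_function q \<eta> k g \<longleftrightarrow>
     (\<forall>K. compact K \<longrightarrow> set_integrable lborel K g) \<and>
     real_analytic_fun_on (UNIV - periodic_lattice q) g \<and>
     (\<forall>\<phi>\<in>schwartz. integrable lborel (\<lambda>x. g x * \<phi> x) \<and>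
        ((\<lambda>z. LINT x|lborel. green_term q \<eta> k z x * \<phi> x) has_sum (LINT x|lborel. g x * \<phi> x))
          (UNIV - Z_res q \<eta> k))"

text \<open>The function is determined by the distribution at every point off the lattice; its values on
  the lattice, a null set both for Lebesgue and for surface measure, are left unspecified.\<close>

definition green_function :: "real ^ 'n ^ 'n \<Rightarrow> real ^ 'n \<Rightarrow> complex \<Rightarrow> real ^ 'n \<Rightarrow> complex" where
  "green_function q \<eta> k = (SOME g. is_green_function q \<eta> k g)"

definition single_layer ::
  "real ^ 'n ^ 'n \<Rightarrow> real ^ 'n \<Rightarrow> complex \<Rightarrow> (real ^ 'n) set \<Rightarrow> (real ^ 'n \<Rightarrow> complex) \<Rightarrow> real ^ 'n \<Rightarrow> complex" where
  "single_layer q \<eta> k D \<mu> x =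
     (LINT y:frontier D|surface_measure. green_function q \<eta> k (x - y) * \<mu> y)"

definition single_layer_minus ::
  "real ^ 'n ^ 'n \<Rightarrow> real ^ 'n \<Rightarrow> complex \<Rightarrow> (real ^ 'n) set \<Rightarrow> (real ^ 'n \<Rightarrow> complex) \<Rightarrow> real ^ 'n \<Rightarrow> complex" where
  "single_layer_minus q \<eta> k D \<mu> = restrict (single_layer q \<eta> k D \<mu>) (closure (S_per_minus q D))"

end

theory Submission
  imports Defs "HOL-Probability.Probability"
begin

text \<open>The Green function is obtained by Ewald's method. With $\lambda = |\xi|^2 - k^2$ one has
  $1/\lambda = e^{-\lambda}/\lambda + \int_0^1 e^{-\lambda t}\,dt$. The first term gives a Fourier series with Gaussian
  coefficients, hence an entire function. By Poisson summation the second gives the time integral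
  of a lattice sum of Gaussians, which is locally integrable and real analytic off the lattice;
  the Poisson formula itself follows from the uniqueness of Fourier coefficients.

  Only the analyticity of the Green function matters for the potential. A real analytic \<open>g\<close> obeys
  $|\partial^\beta g| \le B\,(|\beta|/\delta)^{|\beta|}$ on compact sets, so the Taylor remainders in $\epsilon$ of
  $g(x - p - \epsilon s)$ and of its derivatives in $x$ decay geometrically, uniformly in $x$ and $s$. Integrating over the
  boundary, which has finite surface measure, gives the power series in the operator norm. The
  second claim is the scaling of the surface measure.\<close>

section \<open>Sums, integrals and a summable weight\<close>

text \<open>\<open>green_function\<close> is a choice, so no property of it is available before some
  function with \<open>is_green_function\<close> has been built; Ewald's construction serves this
  existence. The obstacle is the size of the coefficients: they decay like |\<xi>|^(-2), which is
  not summable over a lattice of dimension two or more, so the series by itself yields no values and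
  no regularity. Splitting the time integral at 1 moves the slow decay to small times, where the
  lattice sum of Gaussians is tiny away from the lattice. A weight that is a product of functions of
  one variable dominates, up to constants, Gaussians, indicators of compact sets, Schwartz functions
  and their Fourier transforms alike; its sums and integrals reduce to dimension one. The expansion
  in \<epsilon> goes through bounds on all derivatives and not through the local power series
  themselves: those have centres and radii depending on the point, whereas the operator norm asks
  for one rate for all \<open>x\<close> and \<open>s\<close>. The factor m^m in these bounds is what
  the m! of Taylor's formula can absorb.\<close>

lemma abs_summable_prod_fun:
  fixes f :: "'n::finite \<Rightarrow> 'b \<Rightarrow> 'c::{real_normed_field,banach}"
  assumes "\<And>i. f i abs_summable_on UNIV"
  shows "(\<lambda>g. \<Prod>i\<in>UNIV. f i (g i)) abs_summable_on UNIV"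
    and "((\<lambda>g. \<Prod>i\<in>UNIV. f i (g i)) has_sum (\<Prod>i\<in>UNIV. infsum (f i) UNIV)) UNIV"
proof -
  show 1: "(\<lambda>g. \<Prod>i\<in>UNIV. f i (g i)) abs_summable_on UNIV"
  proof (rule nonneg_bdd_above_summable_on)
    show "bdd_above (sum (\<lambda>g. norm (\<Prod>i\<in>UNIV. f i (g i))) ` {F. F \<subseteq> UNIV \<and> finite F})"
    proof (rule bdd_aboveI2)
      fix F :: "('n \<Rightarrow> 'b) set" assume "F \<in> {F. F \<subseteq> UNIV \<and> finite F}"
      then have F: "finite F" by simp
      define B where "B i = (\<lambda>g. g i) ` F" for i
      \<comment> \<open>Enlarging \<open>F\<close> to the box of its coordinate projections makes
        the sum factor.\<close>
      have "(\<Sum>g\<in>F. norm (\<Prod>i\<in>UNIV. f i (g i))) \<le> (\<Sum>g\<in>PiE UNIV B. norm (\<Prod>i\<in>UNIV. f i (g i)))"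
        by (rule sum_mono2) (auto simp: B_def F intro!: finite_PiE)
      also have "\<dots> = (\<Prod>i\<in>UNIV. \<Sum>b\<in>B i. norm (f i b))"
        using F by (subst prod_sum_PiE) (auto simp: B_def prod_norm)
      also have "\<dots> \<le> (\<Prod>i\<in>UNIV. infsum (\<lambda>b. norm (f i b)) UNIV)"
        using F by (intro prod_mono conjI sum_nonneg norm_ge_zero finite_sum_le_infsum assms)
          (auto simp: B_def)
      finally show "(\<Sum>g\<in>F. norm (\<Prod>i\<in>UNIV. f i (g i))) \<le> (\<Prod>i\<in>UNIV. infsum (\<lambda>b. norm (f i b)) UNIV)" .
    qed
  qed auto
  have "infsum (\<lambda>g. \<Prod>i\<in>UNIV. f i (g i)) (PiE UNIV (\<lambda>_. UNIV)) = (\<Prod>i\<in>UNIV. infsum (f i) UNIV)"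
    by (rule infsum_prod_PiE_abs) (auto intro: assms)
  then show "((\<lambda>g. \<Prod>i\<in>UNIV. f i (g i)) has_sum (\<Prod>i\<in>UNIV. infsum (f i) UNIV)) UNIV"
    using has_sum_infsum[OF abs_summable_summable[OF 1]] by (simp add: PiE_UNIV_domain)
qed

lemma bij_vec_nth: "bij (vec_nth :: 'b ^ 'n \<Rightarrow> _)"
  by (rule bij_betw_byWitness[where f' = vec_lambda]) auto

lemma abs_summable_prod_vec:
  fixes f :: "'n::finite \<Rightarrow> 'b \<Rightarrow> 'c::{real_normed_field,banach}"
  assumes "\<And>i. f i abs_summable_on UNIV"
  shows "(\<lambda>z::'b^'n. \<Prod>i\<in>UNIV. f i (z $ i)) abs_summable_on UNIV"
    and "((\<lambda>z::'b^'n. \<Prod>i\<in>UNIV. f i (z $ i)) has_sum (\<Prod>i\<in>UNIV. infsum (f i) UNIV)) UNIV"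
  using abs_summable_prod_fun[of f, OF assms] bij_vec_nth[where 'b='b and 'n='n]
  by (simp_all add: summable_on_reindex_bij_betw[OF bij_vec_nth, of "\<lambda>g. norm (\<Prod>i\<in>UNIV. f i (g i))"]
      has_sum_reindex_bij_betw[OF bij_vec_nth, of "\<lambda>g. \<Prod>i\<in>UNIV. f i (g i)"])

text \<open>Turns unordered sums into integrals for counting measure, so that Fubini's theorem can
  exchange them with other integrals. The second equation is unconditional because both sides are 0
  for a family that is not summable.\<close>

lemma infsum_complex_conv:
  fixes g :: "'i \<Rightarrow> complex"
  shows "(\<lambda>i. norm (g i)) summable_on UNIV \<longleftrightarrow> integrable (count_space UNIV) g"
    and "infsum g UNIV = integral\<^sup>L (count_space UNIV) g"
proof -
  show 1: "(\<lambda>i. norm (g i)) summable_on UNIV \<longleftrightarrow> integrable (count_space UNIV) g"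
    using abs_summable_equivalent[of g UNIV] by (auto simp: Infinite_Set_Sum.abs_summable_on_def)
  show "infsum g UNIV = integral\<^sup>L (count_space UNIV) g"
  proof (cases "integrable (count_space UNIV) g")
    case True
    then show ?thesis using infsetsum_infsum[of g UNIV]
      by (auto simp: Infinite_Set_Sum.abs_summable_on_def infsetsum_def)
  next
    case False
    then have "\<not> g summable_on UNIV"
      using 1 summable_on_iff_abs_summable_on_complex by blast
    with False show ?thesis by (simp add: infsum_not_exists not_integrable_integral_eq)
  qed
qed

lemma measurable_pair_count_space:
  fixes f :: "'i::countable \<Rightarrow> 'a \<Rightarrow> 'b::topological_space"
  assumes [measurable]: "\<And>i. f i \<in> borel_measurable M"
  shows "(\<lambda>(x, i). f i x) \<in> borel_measurable (M \<Otimes>\<^sub>M count_space UNIV)"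
  using measurable_compose_countable'[where f = "\<lambda>i p. f i (fst p)" and g = snd and I = UNIV and M = "M \<Otimes>\<^sub>M count_space UNIV" and N = borel]
  by (simp add: case_prod_beta')

lemma borel_measurable_infsum:
  fixes f :: "'i::countable \<Rightarrow> 'a \<Rightarrow> complex"
  assumes [measurable]: "\<And>i. f i \<in> borel_measurable M"
  shows "(\<lambda>x. \<Sum>\<^sub>\<infinity>i. f i x) \<in> borel_measurable M"
proof -
  interpret C: sigma_finite_measure "count_space (UNIV :: 'i set)"
    by (rule sigma_finite_measure_count_space)
  have "(\<lambda>(x, i). f i x) \<in> borel_measurable (M \<Otimes>\<^sub>M count_space UNIV)"
    by (rule measurable_pair_count_space) measurable
  then show ?thesis unfolding infsum_complex_conv by (rule C.borel_measurable_lebesgue_integral)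
qed

text \<open>Fubini and Tonelli on the product of \<open>M\<close> with counting measure, which is
  sigma-finite because the index type is countable.\<close>

lemma integral_has_sum:
  fixes f :: "'i::countable \<Rightarrow> 'a \<Rightarrow> complex"
  assumes M: "sigma_finite_measure M"
    and meas [measurable]: "\<And>i. f i \<in> borel_measurable M"
    and fin: "(\<integral>\<^sup>+x. (\<integral>\<^sup>+i. ennreal (norm (f i x)) \<partial>count_space UNIV) \<partial>M) < \<infinity>"
  shows "integrable M (\<lambda>x. \<Sum>\<^sub>\<infinity>i. f i x)"
    and "(\<lambda>i. norm (integral\<^sup>L M (f i))) summable_on UNIV" and "\<And>i. integrable M (f i)"
    and "((\<lambda>i. integral\<^sup>L M (f i)) has_sum (integral\<^sup>L M (\<lambda>x. \<Sum>\<^sub>\<infinity>i. f i x))) UNIV"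
proof -
  interpret sigma_finite_measure M by fact
  interpret C: sigma_finite_measure "count_space (UNIV :: 'i set)"
    by (rule sigma_finite_measure_count_space)
  interpret P: pair_sigma_finite M "count_space (UNIV :: 'i set)" ..
  have m [measurable]: "(\<lambda>(x, i). f i x) \<in> borel_measurable (M \<Otimes>\<^sub>M count_space UNIV)"
    by (rule measurable_pair_count_space) measurable
  have int: "integrable (M \<Otimes>\<^sub>M count_space UNIV) (case_prod (\<lambda>x i. f i x))"
    unfolding integrable_iff_bounded
    using fin by (auto simp: C.nn_integral_fst[symmetric])
  have i1: "integrable M (\<lambda>x. integral\<^sup>L (count_space UNIV) (\<lambda>i. f i x))"
    using P.integrable_fst'[OF int] by simp
  show i2: "integrable M (\<lambda>x. \<Sum>\<^sub>\<infinity>i. f i x)"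
    using i1 by (simp add: infsum_complex_conv)
  show 3: "(\<lambda>i. norm (integral\<^sup>L M (f i))) summable_on UNIV"
    using P.integrable_snd[of "\<lambda>x i. f i x"] int infsum_complex_conv(1)[of "\<lambda>i. integral\<^sup>L M (f i)"] by simp
  show "integrable M (f i)" for i
    using P.AE_integrable_snd[of "\<lambda>x i. f i x"] int by (simp add: AE_count_space)
  have "integral\<^sup>L M (\<lambda>x. \<Sum>\<^sub>\<infinity>i. f i x) = integral\<^sup>L M (\<lambda>x. integral\<^sup>L (count_space UNIV) (\<lambda>i. f i x))"
    by (simp add: infsum_complex_conv)
  also have "\<dots> = integral\<^sup>L (count_space UNIV) (\<lambda>i. integral\<^sup>L M (f i))"
    using P.Fubini_integral[of "\<lambda>x i. f i x"] int by simp
  also have "\<dots> = infsum (\<lambda>i. integral\<^sup>L M (f i)) UNIV"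
    by (simp add: infsum_complex_conv)
  finally show "((\<lambda>i. integral\<^sup>L M (f i)) has_sum (integral\<^sup>L M (\<lambda>x. \<Sum>\<^sub>\<infinity>i. f i x))) UNIV"
    using abs_summable_summable[OF 3] by (metis has_sum_infsum)
qed

lemma nn_integral_count_space_infsum:
  fixes g :: "'i \<Rightarrow> real"
  assumes "g summable_on UNIV" "\<And>i. g i \<ge> 0"
  shows "(\<integral>\<^sup>+i. ennreal (g i) \<partial>count_space UNIV) = ennreal (infsum g UNIV)"
proof -
  have "(\<lambda>i. norm (g i)) summable_on UNIV" using assms by simp
  then have "Infinite_Set_Sum.abs_summable_on g UNIV" by (simp only: abs_summable_equivalent)
  then show ?thesis using assms by (simp add: nn_integral_conv_infsetsum infsetsum_infsum)
qed

text \<open>One integrable majorant \<open>B\<close> for the sum of the norms bounds the iterated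
  integral required by \<open>integral_has_sum\<close>. Nearly every exchange of sum and integral
  below has this form.\<close>

lemma integral_has_sum_dominated:
  fixes f :: "'i::countable \<Rightarrow> 'a \<Rightarrow> complex"
  assumes M: "sigma_finite_measure M"
    and meas [measurable]: "\<And>i. f i \<in> borel_measurable M"
    and sum: "\<And>x. x \<in> space M \<Longrightarrow> (\<lambda>i. norm (f i x)) summable_on UNIV"
    and le: "\<And>x. x \<in> space M \<Longrightarrow> (\<Sum>\<^sub>\<infinity>i. norm (f i x)) \<le> B x" and B: "integrable M B"
  shows "integrable M (\<lambda>x. \<Sum>\<^sub>\<infinity>i. f i x)" and "\<And>i. integrable M (f i)"
    and "(\<lambda>i. norm (integral\<^sup>L M (f i))) summable_on UNIV"
    and "((\<lambda>i. integral\<^sup>L M (f i)) has_sum (integral\<^sup>L M (\<lambda>x. \<Sum>\<^sub>\<infinity>i. f i x))) UNIV"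
proof -
  have "(\<integral>\<^sup>+x. (\<integral>\<^sup>+i. ennreal (norm (f i x)) \<partial>count_space UNIV) \<partial>M) \<le> (\<integral>\<^sup>+x. ennreal (norm (B x)) \<partial>M)"
  proof (rule nn_integral_mono)
    fix x assume x: "x \<in> space M"
    show "(\<integral>\<^sup>+i. ennreal (norm (f i x)) \<partial>count_space UNIV) \<le> ennreal (norm (B x))"
      unfolding nn_integral_count_space_infsum[OF sum[OF x] norm_ge_zero]
      using le[OF x] by (intro ennreal_leI) auto
  qed
  also have "\<dots> < \<infinity>" using B unfolding integrable_iff_bounded by blast
  finally have fin: "(\<integral>\<^sup>+x. (\<integral>\<^sup>+i. ennreal (norm (f i x)) \<partial>count_space UNIV) \<partial>M) < \<infinity>" .
  note * = integral_has_sum[OF M meas fin]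
  show "integrable M (\<lambda>x. \<Sum>\<^sub>\<infinity>i. f i x)" "\<And>i. integrable M (f i)"
    "(\<lambda>i. norm (integral\<^sup>L M (f i))) summable_on UNIV"
    "((\<lambda>i. integral\<^sup>L M (f i)) has_sum (integral\<^sup>L M (\<lambda>x. \<Sum>\<^sub>\<infinity>i. f i x))) UNIV"
    using * by auto
qed

lemma continuous_on_infsum:
  fixes f :: "'i \<Rightarrow> 'a::topological_space \<Rightarrow> 'c::banach"
  assumes le: "\<And>i x. x \<in> S \<Longrightarrow> norm (f i x) \<le> B i" and B: "B summable_on UNIV"
    and cont: "\<And>i. continuous_on S (f i)"
  shows "continuous_on S (\<lambda>x. \<Sum>\<^sub>\<infinity>i. f i x)"
  by (rule uniform_limit_theorem[OF _ Weierstrass_m_test_general[where X = UNIV and M = B]])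
    (auto intro!: always_eventually continuous_on_sum cont le B)

text \<open>Replaces the counting of lattice points: finiteness of a set of frequencies or of
  lattice points will follow from the summability of a function that is bounded below on it.\<close>

lemma finite_superlevel_of_summable:
  fixes g :: "'i \<Rightarrow> real"
  assumes g: "g summable_on UNIV" "\<And>i. g i \<ge> 0" and c: "c > 0"
  shows "finite {i. g i \<ge> c}"
proof (rule ccontr)
  assume inf: "infinite {i. g i \<ge> c}"
  obtain n :: nat where n: "infsum g UNIV / c < n" using reals_Archimedean2 by blast
  obtain F where F: "finite F" "card F = n" "F \<subseteq> {i. g i \<ge> c}"
    using infinite_arbitrarily_large[OF inf] by blast
  have "real n * c = (\<Sum>i\<in>F. c)" using F by simp
  also have "\<dots> \<le> sum g F" using F by (intro sum_mono) auto
  also have "\<dots> \<le> infsum g UNIV" by (rule finite_sum_le_infsum[OF g(1) F(1)]) (auto simp: g)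
  finally show False using n c by (simp add: field_simps)
qed

text \<open>Its product form reduces lattice sums and integrals to one coordinate, where decay of
  order two suffices for both.\<close>

definition wt :: "real ^ 'n \<Rightarrow> real" where
  "wt x = (\<Prod>i\<in>UNIV. 1 / (1 + (x $ i)\<^sup>2))"

lemma one_plus_sq_pos: "0 < 1 + (a::real)\<^sup>2"
  by (simp add: add_pos_nonneg)

lemma summable_int_inverse_square: "(\<lambda>m::int. 1 / (1 + (real_of_int m)\<^sup>2)) summable_on UNIV"
proof -
  have s: "(\<lambda>m::nat. 1 / (1 + (real m)\<^sup>2)) summable_on UNIV"
  proof (rule norm_summable_imp_summable_on, rule summable_comparison_test[OF _ inverse_power_summable[of 2]])
    show "\<exists>N. \<forall>n\<ge>N. norm (norm (1 / (1 + (real n)\<^sup>2))) \<le> inverse ((real n) ^ 2)"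
      by (intro exI[of _ 1]) (auto simp: divide_simps one_plus_sq_pos)
  qed simp
  have 1: "(\<lambda>m::int. 1 / (1 + (real_of_int m)\<^sup>2)) summable_on (range int)"
    by (subst summable_on_reindex) (use s in \<open>auto simp: o_def\<close>)
  have 2: "(\<lambda>m::int. 1 / (1 + (real_of_int m)\<^sup>2)) summable_on (range (\<lambda>n. - int n))"
    by (subst summable_on_reindex) (use s in \<open>auto simp: o_def inj_on_def\<close>)
  have "m \<in> range int \<union> range (\<lambda>n. - int n)" for m :: int
    by (cases m rule: int_cases2) auto
  then have "UNIV = range int \<union> range (\<lambda>n. - int n)" by blast
  then show ?thesis using summable_on_union[OF 1 2] by simp
qed

text \<open>With u = y + d m one has (d m)^2 \<le> 2 u^2 + 2 y^2, because the difference is (2 y + d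
  m)^2. Dividing by d^2 and comparing with 1 + u^2 gives the constant.\<close>

lemma shifted_inverse_square_le:
  fixes d y R :: real and m :: int
  assumes "d > 0" "\<bar>y\<bar> \<le> R"
  shows "1 / (1 + (y + d * real_of_int m)\<^sup>2) \<le> (1 + 2 * R\<^sup>2 / d\<^sup>2 + 2 / d\<^sup>2) / (1 + (real_of_int m)\<^sup>2)"
proof -
  define u where "u = y + d * real_of_int m"
  define K where "K = 1 + 2 * R\<^sup>2 / d\<^sup>2 + 2 / d\<^sup>2"
  have "(d * real_of_int m)\<^sup>2 \<le> 2 * u\<^sup>2 + 2 * y\<^sup>2"
    using zero_le_square[of "2 * y + d * real_of_int m"] unfolding u_def
    by (simp add: power2_eq_square algebra_simps)
  also have "y\<^sup>2 \<le> R\<^sup>2" using assms by (simp add: abs_le_square_iff[symmetric])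
  finally have "d\<^sup>2 * (real_of_int m)\<^sup>2 \<le> 2 * u\<^sup>2 + 2 * R\<^sup>2" by (simp add: power_mult_distrib)
  then have *: "(real_of_int m)\<^sup>2 \<le> 2 / d\<^sup>2 * u\<^sup>2 + 2 * R\<^sup>2 / d\<^sup>2"
    using assms by (simp add: field_simps)
  have "K * (1 + u\<^sup>2) = 1 + 2 * R\<^sup>2 / d\<^sup>2 + 2 / d\<^sup>2 + u\<^sup>2 + 2 * R\<^sup>2 / d\<^sup>2 * u\<^sup>2 + 2 / d\<^sup>2 * u\<^sup>2"
    unfolding K_def by (simp add: algebra_simps add_divide_distrib)
  moreover have "0 \<le> 2 / d\<^sup>2" "0 \<le> u\<^sup>2" "0 \<le> 2 * R\<^sup>2 / d\<^sup>2 * u\<^sup>2" by auto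
  ultimately have "1 + (real_of_int m)\<^sup>2 \<le> K * (1 + u\<^sup>2)" using * by linarith
  then show ?thesis unfolding u_def[symmetric] K_def[symmetric]
    using one_plus_sq_pos[of u] one_plus_sq_pos[of "real_of_int m"] by (simp add: field_simps)
qed

text \<open>The sum over all integers is periodic in \<open>y\<close> with period \<open>d\<close>,
  so the comparison for |y| \<le> d is already uniform.\<close>

lemma shifted_inverse_square_sum:
  fixes d :: real
  assumes "d > 0"
  obtains C where "C > 0"
    "\<And>y. (\<lambda>m::int. 1 / (1 + (y + d * real_of_int m)\<^sup>2)) summable_on UNIV"
    "\<And>y. (\<Sum>\<^sub>\<infinity>m::int. 1 / (1 + (y + d * real_of_int m)\<^sup>2)) \<le> C"
proof -
  define K where "K = 1 + 2 * d\<^sup>2 / d\<^sup>2 + 2 / d\<^sup>2"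
  define C where "C = (\<Sum>\<^sub>\<infinity>m::int. K * (1 / (1 + (real_of_int m)\<^sup>2)))"
  have sK: "(\<lambda>m::int. K * (1 / (1 + (real_of_int m)\<^sup>2))) summable_on UNIV"
    by (intro summable_on_cmult_right summable_int_inverse_square)
  have le: "1 / (1 + (y + d * real_of_int m)\<^sup>2) \<le> K * (1 / (1 + (real_of_int m)\<^sup>2))"
    if "\<bar>y\<bar> \<le> d" for y and m :: int
    unfolding K_def using shifted_inverse_square_le[OF assms that] by simp
  have sm: "(\<lambda>m::int. 1 / (1 + (y + d * real_of_int m)\<^sup>2)) summable_on UNIV \<and>
    (\<Sum>\<^sub>\<infinity>m::int. 1 / (1 + (y + d * real_of_int m)\<^sup>2)) \<le> C" if y: "\<bar>y\<bar> \<le> d" for y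
  proof -
    have s: "(\<lambda>m::int. 1 / (1 + (y + d * real_of_int m)\<^sup>2)) summable_on UNIV"
      by (rule summable_on_comparison_test[OF sK]) (use le[OF y] in auto)
    then show ?thesis unfolding C_def by (intro conjI infsum_mono s sK le[OF y])
  qed
  have sm': "(\<lambda>m::int. 1 / (1 + (y + d * real_of_int m)\<^sup>2)) summable_on UNIV \<and>
    (\<Sum>\<^sub>\<infinity>m::int. 1 / (1 + (y + d * real_of_int m)\<^sup>2)) \<le> C" for y
  proof -
    define l where "l = \<lfloor>y / d\<rfloor>"
    define y' where "y' = y - d * real_of_int l"
    have "\<bar>y'\<bar> \<le> d"
    proof -
      have "real_of_int l \<le> y / d" "y / d < real_of_int l + 1" unfolding l_def by linarith+
      then show ?thesis using assms unfolding y'_def by (simp add: field_simps)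
    qed
    note s = sm[OF this]
    have bij: "bij_betw (\<lambda>m::int. m + l) UNIV UNIV"
      by (rule bij_betw_byWitness[where f' = "\<lambda>m. m - l"]) auto
    have "(\<lambda>m::int. 1 / (1 + (y' + d * real_of_int (m + l))\<^sup>2)) = (\<lambda>m. 1 / (1 + (y + d * real_of_int m)\<^sup>2))"
      unfolding y'_def by (simp add: algebra_simps)
    then show ?thesis
      using s summable_on_reindex_bij_betw[OF bij, of "\<lambda>m. 1 / (1 + (y' + d * real_of_int m)\<^sup>2)"]
        infsum_reindex_bij_betw[OF bij, of "\<lambda>m. 1 / (1 + (y' + d * real_of_int m)\<^sup>2)"]
      by simp
  qed
  \<comment> \<open>Only C \<ge> 0 is evident, hence the bound \<open>C + 1\<close> below.\<close>
  have "0 \<le> (\<Sum>\<^sub>\<infinity>m::int. 1 / (1 + (0 + d * real_of_int m)\<^sup>2))"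
    by (intro infsum_nonneg) (simp add: one_plus_sq_pos less_imp_le)
  also have "\<dots> \<le> C" using sm'[of 0] by blast
  finally have "0 < C + 1" by simp
  then show ?thesis
  proof (rule that)
    fix y
    show "(\<Sum>\<^sub>\<infinity>m::int. 1 / (1 + (y + d * real_of_int m)\<^sup>2)) \<le> C + 1"
      using sm'[of y] by linarith
  qed (use sm' in blast)
qed

text \<open>Uniformity in the shift \<open>y\<close> is the point: it bounds the periodised weight,
  onto which lattice sums of heat kernels will be unfolded.\<close>

lemma wt_lattice_sum:
  fixes d :: "'n::finite \<Rightarrow> real"
  assumes "\<And>i. d i > 0"
  obtains C where "C > 0"
    "\<And>y. (\<lambda>m::int^'n. wt (\<chi> i. y $ i + d i * real_of_int (m $ i))) summable_on UNIV"
    "\<And>y. (\<Sum>\<^sub>\<infinity>m::int^'n. wt (\<chi> i. y $ i + d i * real_of_int (m $ i))) \<le> C"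
proof -
  have "\<exists>C. \<forall>i. C i > 0 \<and> (\<forall>y. (\<lambda>m::int. 1 / (1 + (y + d i * real_of_int m)\<^sup>2)) summable_on UNIV
    \<and> (\<Sum>\<^sub>\<infinity>m::int. 1 / (1 + (y + d i * real_of_int m)\<^sup>2)) \<le> C i)"
    by (rule choice) (metis assms shifted_inverse_square_sum)
  then obtain C where C: "\<And>i. C i > 0"
    "\<And>i y. (\<lambda>m::int. 1 / (1 + (y + d i * real_of_int m)\<^sup>2)) summable_on UNIV"
    "\<And>i y. (\<Sum>\<^sub>\<infinity>m::int. 1 / (1 + (y + d i * real_of_int m)\<^sup>2)) \<le> C i" by blast
  have s: "(\<lambda>m. norm (1 / (1 + (y $ i + d i * real_of_int m)\<^sup>2))) summable_on UNIV" for i and y :: "real^'n"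
    using C(2)[of "y $ i" i] by (simp add: add_nonneg_nonneg)
  have p: "((\<lambda>z::int^'n. \<Prod>i\<in>UNIV. 1 / (1 + (y $ i + d i * real_of_int (z $ i))\<^sup>2)) has_sum
      (\<Prod>i\<in>UNIV. \<Sum>\<^sub>\<infinity>m::int. 1 / (1 + (y $ i + d i * real_of_int m)\<^sup>2))) UNIV" for y :: "real^'n"
    by (rule abs_summable_prod_vec(2)) (rule s)
  show ?thesis
  proof
    show "(\<Prod>i\<in>UNIV. C i) > 0" by (simp add: C prod_pos)
    fix y :: "real ^ 'n"
    show "(\<lambda>m::int^'n. wt (\<chi> i. y $ i + d i * real_of_int (m $ i))) summable_on UNIV"
      using p[of y] by (auto simp: wt_def intro: has_sum_imp_summable)
    have "(\<Sum>\<^sub>\<infinity>m::int^'n. wt (\<chi> i. y $ i + d i * real_of_int (m $ i))) =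
        (\<Prod>i\<in>UNIV. (\<Sum>\<^sub>\<infinity>m::int. 1 / (1 + (y $ i + d i * real_of_int m)\<^sup>2)))"
      using p[of y] by (simp add: wt_def infsumI)
    also have "\<dots> \<le> (\<Prod>i\<in>UNIV. C i)"
      by (intro prod_mono conjI C infsum_nonneg) (auto intro: add_nonneg_nonneg)
    finally show "(\<Sum>\<^sub>\<infinity>m::int^'n. wt (\<chi> i. y $ i + d i * real_of_int (m $ i))) \<le> (\<Prod>i\<in>UNIV. C i)" .
  qed
qed

lemma wt_pos: "wt x > 0" and wt_le_1: "wt x \<le> 1"
  unfolding wt_def using one_plus_sq_pos by (auto intro!: prod_pos prod_le_1 simp: divide_simps dest: less_imp_neq[THEN not_sym] less_not_sym)

lemma wt_measurable [measurable]: "wt \<in> borel_measurable borel"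
  unfolding wt_def by measurable

section \<open>Poisson summation for the Gaussian\<close>

text \<open>A linear factor in \<open>e 1 x\<close> shifts the frequency by 1 and by -1, and a
  product of polynomials multiplies twice; hence the vanishing is carried for all frequencies
  \<open>n\<close> at once and for an arbitrary \<open>v\<close>.\<close>

lemma trig_polynomial_orthogonal:
  fixes h v :: "real \<Rightarrow> complex" and e :: "int \<Rightarrow> real \<Rightarrow> complex"
  assumes d: "d > 0" and e_def: "\<And>n x. e n x = cis (2 * pi * of_int n * x / d)"
    and h: "continuous_on {0..d} h" and g: "real_polynomial_function g"
    and v: "continuous_on {0..d} v" "\<And>n. integral {0..d} (\<lambda>x. h x * v x * e n x) = 0"
  shows "continuous_on {0..d} (\<lambda>x. of_real (g (e 1 x)) * v x) \<and>
    (\<forall>n. integral {0..d} (\<lambda>x. h x * (of_real (g (e 1 x)) * v x) * e n x) = 0)"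
  using g v
proof (induction arbitrary: v rule: real_polynomial_function.induct)
  have ce: "continuous_on {0..d} (e n)" for n
    unfolding e_def cis_conv_exp by (intro continuous_intros) (use d in auto)
  have e_mult: "e m x * e n x = e (m + n) x" for m n x
    unfolding e_def cis_mult by (simp add: algebra_simps add_divide_distrib)
  have int: "(\<lambda>x. h x * v x * e n x) integrable_on {0..d}" if "continuous_on {0..d} v" for v n
    by (intro integrable_continuous_real continuous_intros h that ce)
  {
    case (linear f)
    \<comment> \<open>A real linear function of \<open>w\<close> is
      \<open>c1 * w + c2 * cnj w\<close>, and on the unit circle conjugation inverts the
      character.\<close>
    define a b where "a = f 1" and "b = f \<i>"
    define c1 where "c1 = (of_real a - \<i> * of_real b) / 2"
    define c2 where "c2 = (of_real a + \<i> * of_real b) / 2"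
    have f: "complex_of_real (f (e 1 x)) = c1 * e 1 x + c2 * e (-1) x" for x
    proof -
      define w where "w = e 1 x"
      have w: "w = Re w *\<^sub>R 1 + Im w *\<^sub>R \<i>"
        by (simp add: complex_eq_iff)
      interpret f: bounded_linear f by fact
      have "f w = Re w * a + Im w * b"
        by (subst w) (simp only: f.add f.scaleR a_def b_def real_scaleR_def)
      moreover have "e (-1) x = cnj w" unfolding e_def w_def by (simp add: cis_cnj)
      ultimately show ?thesis unfolding c1_def c2_def w_def[symmetric]
        by (simp add: complex_eq_iff field_simps)
    qed
    have "integral {0..d} (\<lambda>x. h x * (of_real (f (e 1 x)) * v x) * e n x) = 0" for n
    proof -
      have "integral {0..d} (\<lambda>x. h x * (of_real (f (e 1 x)) * v x) * e n x)
        = integral {0..d} (\<lambda>x. c1 * (h x * v x * e (1 + n) x) + c2 * (h x * v x * e (-1 + n) x))"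
        unfolding f e_mult[symmetric] by (simp add: algebra_simps)
      also have "\<dots> = c1 * integral {0..d} (\<lambda>x. h x * v x * e (1 + n) x) + c2 * integral {0..d} (\<lambda>x. h x * v x * e (-1 + n) x)"
        using int[OF linear(2)]
        by (subst integral_add) (auto intro!: integrable_on_mult_right simp: integral_mult_right)
      finally show ?thesis using linear(3) by simp
    qed
    then show ?case unfolding f by (auto intro!: continuous_intros ce linear(2))
  next
    case (const c)
    have "integral {0..d} (\<lambda>x. h x * (of_real c * v x) * e n x) = of_real c * integral {0..d} (\<lambda>x. h x * v x * e n x)" for n
      unfolding integral_mult_right[symmetric] by (simp add: algebra_simps)
    with const show ?case by (auto intro!: continuous_intros)
  next
    case (add f g)
    note F = add.IH(1)[OF add.prems] and G = add.IH(2)[OF add.prems]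
    have "integral {0..d} (\<lambda>x. h x * (of_real (f (e 1 x) + g (e 1 x)) * v x) * e n x) =
       integral {0..d} (\<lambda>x. h x * (of_real (f (e 1 x)) * v x) * e n x + h x * (of_real (g (e 1 x)) * v x) * e n x)" for n
      by (simp add: algebra_simps)
    also have "\<dots> n = 0" for n
      using F G by (subst integral_add) (auto intro!: int)
    finally show ?case using F G by (auto simp: algebra_simps intro!: continuous_intros)
  next
    case (mult f g)
    note G = mult.IH(2)[OF mult.prems]
    show ?case using mult.IH(1)[of "\<lambda>x. of_real (g (e 1 x)) * v x"] G by (simp add: algebra_simps)
  }
qed

text \<open>Carries a periodic function to the circle, a compact set on which polynomial
  approximation is available. Continuity holds because the preimage of a closed set is the image of
  a compact part of the period under the exponential map.\<close>

lemma continuous_on_circle_quotient: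
  fixes u :: "real \<Rightarrow> real"
  assumes d: "d > 0" and u: "continuous_on UNIV u" and per: "\<And>x. u (x + d) = u x"
  obtains u' where "continuous_on (sphere 0 1) u'" "\<And>x. x \<in> {0..d} \<Longrightarrow> u' (cis (2 * pi * x / d)) = u x"
proof -
  define e where "e x = cis (2 * pi * x / d)" for x
  have eq: "u x = u y" if "e x = e y" "x \<in> {0..d}" "y \<in> {0..d}" for x y
  proof -
    from that(1) obtain n :: int where "\<i> * of_real (2 * pi * x / d) = \<i> * of_real (2 * pi * y / d) + (of_int (2 * n) * pi) * \<i>"
      unfolding e_def cis_conv_exp exp_eq by blast
    then have "complex_of_real (2 * pi * x / d) = of_real (2 * pi * y / d + 2 * of_int n * pi)"
      by (simp add: complex_eq_iff)
    then have "2 * pi * x / d = 2 * pi * y / d + 2 * of_int n * pi" by (simp only: of_real_eq_iff)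
    then have "2 * pi * x = 2 * pi * (y + of_int n * d)" using d by (simp add: field_simps)
    then have n: "x = y + of_int n * d" by simp
    \<comment> \<open>Both points lie in one closed period, so \<open>n\<close> can be nonzero only
      if they are its two end points.\<close>
    have "\<bar>of_int n * d\<bar> \<le> d" using n that(2,3) by auto
    then have "\<bar>real_of_int n\<bar> \<le> 1" using d by (simp add: abs_mult)
    then have "n = -1 \<or> n = 0 \<or> n = 1" by linarith
    then show ?thesis using n per[of y] per[of x] by auto
  qed
  define u' where "u' w = u (SOME x. x \<in> {0..d} \<and> e x = w)" for w
  have u': "u' (e x) = u x" if "x \<in> {0..d}" for x
    unfolding u'_def using someI[of "\<lambda>y. y \<in> {0..d} \<and> e y = e x" x] that eq by blast
  have ce: "continuous_on A e" for A
    unfolding e_def cis_conv_exp by (intro continuous_intros) (use d in auto)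
  have surj: "w \<in> e ` {0..d}" if "w \<in> sphere 0 1" for w
  proof -
    have w: "norm w = 1" using that by simp
    obtain t where t: "0 \<le> t" "t < 2 * pi" "w = cis t"
      using that[of "Arg2pi w"] Arg2pi[of w] w by (simp add: cis_conv_exp is_Arg_def)
    then show ?thesis using d unfolding e_def by (intro image_eqI[of _ _ "t * d / (2 * pi)"]) (auto simp: field_simps)
  qed
  have "closed (u' -` B \<inter> sphere 0 1)" if "closed B" for B
  proof -
    have "u' -` B \<inter> sphere 0 1 = e ` ({0..d} \<inter> u -` B)"
    proof (intro equalityI subsetI)
      fix w assume w: "w \<in> u' -` B \<inter> sphere 0 1"
      then obtain x where "x \<in> {0..d}" "w = e x" using surj by blast
      with w u' show "w \<in> e ` ({0..d} \<inter> u -` B)" by auto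
    qed (use u' in \<open>auto simp: e_def\<close>)
    moreover have "compact ({0..d} \<inter> u -` B)"
      using that u by (intro compact_Int_closed compact_Icc) (simp add: continuous_closed_vimage continuous_on_eq_continuous_at)
    ultimately show ?thesis using compact_continuous_image[OF ce] by (simp add: compact_imp_closed)
  qed
  then have "continuous_on (sphere 0 1) u'" by (subst continuous_on_closed_vimage) auto
  with u' that show ?thesis unfolding e_def by blast
qed

text \<open>By Stone-Weierstrass \<open>h\<close> is orthogonal to every continuous real periodic
  function, in particular to its own real and imaginary part; so the integral of |h|^2
  vanishes.\<close>

lemma fourier_coefficients_zero:
  fixes h :: "real \<Rightarrow> complex"
  assumes d: "d > 0" and h: "continuous_on UNIV h" and per: "\<And>x. h (x + d) = h x"
    and zero: "\<And>n::int. integral {0..d} (\<lambda>x. h x * cis (2 * pi * of_int n * x / d)) = 0"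
  shows "h x = 0"
proof -
  define e where "e n x = cis (2 * pi * of_int n * x / d)" for n :: int and x
  have ch: "continuous_on A h" for A using h continuous_on_subset by blast
  obtain B where B: "B > 0" "\<And>x. x \<in> {0..d} \<Longrightarrow> norm (h x) \<le> B"
  proof -
    have "bounded (h ` {0..d})" by (intro compact_imp_bounded compact_continuous_image ch) auto
    then show ?thesis using that unfolding bounded_pos by auto
  qed
  have orth: "integral {0..d} (\<lambda>x. h x * of_real (u x)) = 0"
    if u: "continuous_on UNIV u" "\<And>x. u (x + d) = u x" for u :: "real \<Rightarrow> real"
  proof -
    obtain u' where u': "continuous_on (sphere 0 1) u'" "\<And>x. x \<in> {0..d} \<Longrightarrow> u' (cis (2 * pi * x / d)) = u x"
      using continuous_on_circle_quotient[OF d u] by blast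
    have cu: "continuous_on A u" for A using u(1) continuous_on_subset by blast
    have "norm (integral {0..d} (\<lambda>x. h x * of_real (u x))) \<le> \<epsilon>" if eps: "\<epsilon> > 0" for \<epsilon>
    proof -
      \<comment> \<open>The bound \<open>B\<close> of \<open>h\<close> and the length
        \<open>d\<close> of the period turn this tolerance into \<open>\<epsilon>\<close>.\<close>
      obtain g where g: "real_polynomial_function g" "\<And>w. w \<in> sphere 0 1 \<Longrightarrow> \<bar>u' w - g w\<bar> < \<epsilon> / (B * d)"
        using Stone_Weierstrass_real_polynomial_function[OF _ u'(1), of "\<epsilon> / (B * d)"] B d eps by auto
      have G: "continuous_on {0..d} (\<lambda>x. complex_of_real (g (e 1 x)))"
        "integral {0..d} (\<lambda>x. h x * of_real (g (e 1 x))) = 0"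
      proof -
        have *: "continuous_on {0..d} (\<lambda>x. complex_of_real (g (e 1 x)) * 1) \<and>
          (\<forall>n. integral {0..d} (\<lambda>x. h x * (complex_of_real (g (e 1 x)) * 1) * e n x) = 0)"
          by (rule trig_polynomial_orthogonal[where d = d]) (use zero d in \<open>auto simp: e_def ch g\<close>)
        then show "continuous_on {0..d} (\<lambda>x. complex_of_real (g (e 1 x)))" by simp
        from * have "integral {0..d} (\<lambda>x. h x * (complex_of_real (g (e 1 x)) * 1) * e 0 x) = 0" by blast
        then show "integral {0..d} (\<lambda>x. h x * of_real (g (e 1 x))) = 0" by (simp add: e_def)
      qed
      have "integral {0..d} (\<lambda>x. h x * of_real (u x)) =
          integral {0..d} (\<lambda>x. h x * of_real (u x)) - integral {0..d} (\<lambda>x. h x * of_real (g (e 1 x)))"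
        using G by simp
      also have "\<dots> = integral {0..d} (\<lambda>x. h x * of_real (u x) - h x * of_real (g (e 1 x)))"
        by (rule integral_diff[symmetric]; intro integrable_continuous_real continuous_intros ch cu G(1))
      also have "norm \<dots> \<le> (\<epsilon> / d) * (d - 0)"
      proof (rule integral_bound)
        show "continuous_on {0..d} (\<lambda>x. h x * of_real (u x) - h x * of_real (g (e 1 x)))"
          by (intro continuous_intros ch cu G(1))
        fix x assume x: "x \<in> {0..d}"
        have "norm (h x * of_real (u x) - h x * of_real (g (e 1 x))) = norm (h x) * \<bar>u x - g (e 1 x)\<bar>"
          by (metis norm_mult norm_of_real of_real_diff right_diff_distrib)
        also have "\<bar>u x - g (e 1 x)\<bar> \<le> \<epsilon> / (B * d)"
          using g(2)[of "e 1 x"] u'(2)[OF x] by (simp add: e_def)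
        also have "norm (h x) * (\<epsilon> / (B * d)) \<le> B * (\<epsilon> / (B * d))"
          using B x eps d by (intro mult_right_mono) auto
        finally show "norm (h x * of_real (u x) - h x * of_real (g (e 1 x))) \<le> \<epsilon> / d"
          using B by (simp add: mult_left_mono)
      qed (use d in auto)
      finally show ?thesis using d by simp
    qed
    then have "norm (integral {0..d} (\<lambda>x. h x * of_real (u x))) \<le> 0" by (rule dense_ge)
    then show ?thesis by simp
  qed
  have i1: "integral {0..d} (\<lambda>x. h x * of_real (Re (h x))) = 0"
    by (rule orth) (auto intro!: continuous_intros ch simp: per)
  have i2: "integral {0..d} (\<lambda>x. h x * of_real (Im (h x))) = 0"
    by (rule orth) (auto intro!: continuous_intros ch simp: per)
  have "integral {0..d} (\<lambda>x. h x * of_real (Re (h x)) - \<i> * (h x * of_real (Im (h x)))) = 0"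
    by (subst integral_diff) (auto intro!: integrable_continuous_real continuous_intros ch simp: i1 i2 integral_mult_right)
  also have "(\<lambda>x. h x * of_real (Re (h x)) - \<i> * (h x * of_real (Im (h x)))) = (\<lambda>x. of_real ((norm (h x))\<^sup>2))"
    by (rule ext) (simp only: cmod_power2, simp add: complex_eq_iff power2_eq_square)
  finally have 0: "integral {0..d} (\<lambda>x. complex_of_real ((norm (h x))\<^sup>2)) = 0" .
  have ir: "(\<lambda>x. (norm (h x))\<^sup>2) integrable_on {0..d}"
    by (intro integrable_continuous_real continuous_intros ch)
  have "complex_of_real (integral {0..d} (\<lambda>x. (norm (h x))\<^sup>2)) = 0"
    using 0 integral_linear[OF ir, of "of_real :: real \<Rightarrow> complex"] by (simp add: o_def bounded_linear_of_real)
  then have "((\<lambda>x. (norm (h x))\<^sup>2) has_integral 0) {0..d}"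
    using ir by (simp add: has_integral_iff)
  then have z: "h x = 0" if "x \<in> {0..d}" for x
    using has_integral_0_cbox_imp_0[of 0 d "\<lambda>x. (norm (h x))\<^sup>2" x] that d
    by (simp add: continuous_intros ch)
  define l where "l = \<lfloor>x / d\<rfloor>"
  have hn: "h (y + real n * d) = h y" for y n
    by (induction n) (use per in \<open>auto simp: algebra_simps\<close>, metis add.assoc add.commute)
  have l: "x - of_int l * d \<in> {0..d}"
  proof -
    have "of_int l \<le> x / d" "x / d < of_int l + 1" unfolding l_def by linarith+
    then show ?thesis using d by (simp add: field_simps)
  qed
  have "h x = h (x - of_int l * d)"
    using hn[of x "nat (-l)"] hn[of "x - of_int l * d" "nat l"] by (cases "l \<ge> 0") auto
  then show ?thesis using z[OF l] by simp
qed

text \<open>The heat kernel on the line: with variance \<open>2 * t\<close> its Fourier transform is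
  exp(- t w^2), and convolution with it solves the heat equation with diffusion constant
  one.\<close>

definition heat1 :: "real \<Rightarrow> real \<Rightarrow> real" where
  "heat1 t = normal_density 0 (sqrt (2 * t))"

lemma heat1_nonneg: "heat1 t y \<ge> 0"
  unfolding heat1_def by (simp add: normal_density_def)

lemma heat1_eq: "t > 0 \<Longrightarrow> heat1 t y = exp (- (y\<^sup>2 / (4 * t))) / sqrt (4 * pi * t)"
  by (simp add: heat1_def normal_density_def field_simps)

lemma heat1_measurable [measurable]: "(\<lambda>(t, y). heat1 t y) \<in> borel_measurable (borel \<Otimes>\<^sub>M borel)"
  unfolding heat1_def normal_density_def by measurable

lemma heat1_integrable: "t > 0 \<Longrightarrow> integrable lborel (heat1 t)"
  and heat1_integral: "t > 0 \<Longrightarrow> integral\<^sup>L lborel (heat1 t) = 1"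
  unfolding heat1_def by (auto intro: integrable_normal_density integral_normal_density)

text \<open>The substitution y = s x with \<open>s = sqrt (2 * t)\<close> leads to the
  characteristic function of the standard normal distribution at \<open>w * s\<close>, where (w s)^2
  / 2 = t w^2.\<close>

lemma heat1_fourier:
  assumes t: "t > 0"
  shows "(\<integral>y. of_real (heat1 t y) * cis (w * y) \<partial>lborel) = of_real (exp (- (t * w\<^sup>2)))"
proof -
  define s where "s = sqrt (2 * t)"
  have s: "s > 0" "s\<^sup>2 = 2 * t" using t by (auto simp: s_def)
  have h: "s * heat1 t (s * x) = std_normal_density x" for x
  proof -
    have "sqrt (2 * pi * s\<^sup>2) = sqrt (2 * pi) * s" using s(1) by (simp add: real_sqrt_mult)
    moreover have "(s * x)\<^sup>2 / (2 * s\<^sup>2) = x\<^sup>2 / 2" using s(1) by (simp add: power_mult_distrib)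
    ultimately show ?thesis
      using s(1) unfolding heat1_def normal_density_def s_def[symmetric] by simp
  qed
  have "(\<integral>y. of_real (heat1 t y) * cis (w * y) \<partial>lborel)
      = \<bar>s\<bar> *\<^sub>R (\<integral>x. of_real (heat1 t (0 + s * x)) * cis (w * (0 + s * x)) \<partial>lborel)"
    by (rule lborel_integral_real_affine) (use s in simp)
  also have "\<dots> = (\<integral>x. \<bar>s\<bar> *\<^sub>R (of_real (heat1 t (0 + s * x)) * cis (w * (0 + s * x))) \<partial>lborel)"
    by (rule integral_scaleR_right[symmetric])
  also have "\<dots> = (\<integral>x. std_normal_density x *\<^sub>R iexp (w * s * x) \<partial>lborel)"
    using s by (intro Bochner_Integration.integral_cong) (auto simp: h[symmetric] cis_conv_exp scaleR_conv_of_real mult_ac)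
  also have "\<dots> = char std_normal_distribution (w * s)"
    unfolding char_def by (subst integral_density) auto
  also have "\<dots> = of_real (exp (- (t * w\<^sup>2)))"
    unfolding char_std_normal_distribution using s by (simp add: power_mult_distrib mult.commute)
  finally show ?thesis .
qed

lemma exp_minus_le_inverse: "s \<ge> 0 \<Longrightarrow> exp (- s) \<le> 1 / (1 + (s::real))"
  using exp_ge_add_one_self[of s] by (simp add: exp_minus field_simps)

text \<open>Passes from Gaussian decay to that of the weight through exp(-s) \<le> 1/(1+s). The
  factor 1 + 1/c serves small and large \<open>c\<close> at once.\<close>

lemma exp_minus_square_le:
  assumes "c > 0"
  shows "exp (- (c * y\<^sup>2)) \<le> (1 + 1 / c) * (1 / (1 + (y::real)\<^sup>2))"
proof -
  have "exp (- (c * y\<^sup>2)) \<le> 1 / (1 + c * y\<^sup>2)"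
    using assms by (intro exp_minus_le_inverse) auto
  also have "1 / (1 + c * y\<^sup>2) \<le> (1 + 1 / c) * (1 / (1 + y\<^sup>2))"
  proof -
    have "1 + y\<^sup>2 \<le> (1 + 1 / c) * (1 + c * y\<^sup>2)"
    proof -
      have "(1 + 1 / c) * (1 + c * y\<^sup>2) = 1 + y\<^sup>2 + 1 / c + c * y\<^sup>2"
        using assms by (simp add: algebra_simps)
      then show ?thesis using assms by simp
    qed
    moreover have "1 + c * y\<^sup>2 > 0" using assms by (simp add: add_pos_nonneg)
    ultimately show ?thesis using one_plus_sq_pos[of y] by (simp add: pos_divide_le_eq pos_le_divide_eq)
  qed
  finally show ?thesis .
qed

lemma heat1_le:
  assumes "t > 0"
  shows "heat1 t y \<le> (1 + 4 * t) / sqrt (4 * pi * t) * (1 / (1 + y\<^sup>2))"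
proof -
  have "exp (- (y\<^sup>2 / (4 * t))) \<le> (1 + 4 * t) * (1 / (1 + y\<^sup>2))"
    using exp_minus_square_le[of "1 / (4 * t)" y] assms by simp
  then have "exp (- (y\<^sup>2 / (4 * t))) / sqrt (4 * pi * t) \<le> (1 + 4 * t) * (1 / (1 + y\<^sup>2)) / sqrt (4 * pi * t)"
    by (rule divide_right_mono) (use assms in simp)
  then show ?thesis using assms by (simp add: heat1_eq mult.commute)
qed

lemma shifted_inverse_square_summable:
  assumes "(d::real) > 0"
  shows "(\<lambda>m::int. c * (1 / (1 + (y + d * real_of_int m)\<^sup>2))) summable_on UNIV"
  by (rule summable_on_cmult_right) (use shifted_inverse_square_sum[OF assms] in metis)

lemma heat1_summable:
  assumes "t > 0" "d > 0"
  shows "(\<lambda>m::int. heat1 t (x + d * real_of_int m)) summable_on UNIV"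
  by (rule summable_on_comparison_test[OF shifted_inverse_square_summable[OF assms(2)]])
    (rule heat1_le[OF assms(1)], rule heat1_nonneg)

lemma frequency_summable:
  assumes "t > 0" "d > 0"
  shows "(\<lambda>z::int. exp (- (t * (2 * pi * of_int z / d + \<eta>)\<^sup>2))) summable_on UNIV"
proof (rule summable_on_comparison_test[OF shifted_inverse_square_summable])
  show "0 < 2 * pi / d" using assms by simp
  show "exp (- (t * (2 * pi * of_int z / d + \<eta>)\<^sup>2)) \<le> (1 + 1 / t) * (1 / (1 + (\<eta> + 2 * pi / d * real_of_int z)\<^sup>2))" for z
    using exp_minus_square_le[OF assms(1), of "2 * pi * of_int z / d + \<eta>"] by (simp add: add.commute)
qed auto

text \<open>After division by the phase cis(\<eta> x) both sides are continuous and have period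
  \<open>d\<close>; their Fourier coefficients agree, so \<open>fourier_coefficients_zero\<close>
  applies to the difference.\<close>

lemma poisson1:
  assumes d: "d > 0" and t: "t > 0"
  shows "(\<Sum>\<^sub>\<infinity>m::int. of_real (heat1 t (x + d * of_int m)) * cis (- (\<eta> * (d * of_int m)))) =
    (\<Sum>\<^sub>\<infinity>z::int. of_real (exp (- (t * (2 * pi * of_int z / d + \<eta>)\<^sup>2)) / d) * cis ((2 * pi * of_int z / d + \<eta>) * x))"
proof -
  define w where "w z = 2 * pi * of_int z / d + \<eta>" for z :: int
  \<comment> \<open>The phase is put into \<psi>, which makes the lattice sum \<open>f\<close>
    periodic instead of quasi-periodic.\<close>
  define \<psi> where "\<psi> y = of_real (heat1 t y) * cis (- (\<eta> * y))" for y
  define f where "f x = (\<Sum>\<^sub>\<infinity>m::int. \<psi> (x + d * of_int m))" for x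
  define G where "G z x = of_real (exp (- (t * (w z)\<^sup>2)) / d) * cis (2 * pi * of_int z * x / d)" for z :: int and x
  define g where "g x = (\<Sum>\<^sub>\<infinity>z. G z x)" for x
  have n\<psi>: "norm (\<psi> y) = heat1 t y" for y by (simp add: \<psi>_def norm_mult heat1_nonneg)
  have nG: "norm (G z x) = exp (- (t * (w z)\<^sup>2)) / d" for z x using d by (simp add: G_def norm_mult norm_divide)
  have meas\<psi> [measurable]: "\<psi> \<in> borel_measurable borel"
    unfolding \<psi>_def cis_conv_exp by measurable
  have int\<psi>: "integrable lborel (\<lambda>y. \<psi> y * cis (c * y))" for c
  proof (rule Bochner_Integration.integrable_bound[OF heat1_integrable[OF t]])
    show "(\<lambda>y. \<psi> y * cis (c * y)) \<in> borel_measurable lborel" unfolding cis_conv_exp by measurable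
  qed (simp add: norm_mult n\<psi> heat1_nonneg)
  define K where "K R = (1 + 4 * t) / sqrt (4 * pi * t) * (1 + 2 * R\<^sup>2 / d\<^sup>2 + 2 / d\<^sup>2)" for R
  have bnd: "norm (\<psi> (x + d * of_int m)) \<le> K R * (1 / (1 + (real_of_int m)\<^sup>2))" if "\<bar>x\<bar> \<le> R" for x m R
  proof -
    have "norm (\<psi> (x + d * of_int m)) \<le> (1 + 4 * t) / sqrt (4 * pi * t) * (1 / (1 + (x + d * of_int m)\<^sup>2))"
      unfolding n\<psi> by (rule heat1_le[OF t])
    also have "\<dots> \<le> (1 + 4 * t) / sqrt (4 * pi * t) * ((1 + 2 * R\<^sup>2 / d\<^sup>2 + 2 / d\<^sup>2) / (1 + (real_of_int m)\<^sup>2))"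
      using t by (intro mult_left_mono shifted_inverse_square_le[OF d that]) auto
    finally show ?thesis by (simp add: K_def)
  qed
  have sK: "(\<lambda>m::int. K R * (1 / (1 + (real_of_int m)\<^sup>2))) summable_on UNIV" for R
    by (intro summable_on_cmult_right summable_int_inverse_square)
  have s\<psi>: "(\<lambda>m::int. norm (\<psi> (x + d * of_int m))) summable_on UNIV" for x
    using heat1_summable[OF t d] by (simp add: n\<psi>)
  have sG: "(\<lambda>z. exp (- (t * (w z)\<^sup>2)) / d) summable_on UNIV"
    using summable_on_cmult_left[OF frequency_summable[OF t d, of \<eta>], of "1 / d"] by (simp add: w_def)
  have cf: "continuous_on UNIV f"
  proof -
    have "continuous_on (ball 0 R) f" for R :: real
      unfolding f_def
    proof (rule continuous_on_infsum[OF _ sK[of R]])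
      show "norm (\<psi> (x + d * of_int m)) \<le> K R * (1 / (1 + (real_of_int m)\<^sup>2))" if "x \<in> ball 0 R" for x m
        by (rule bnd) (use that in auto)
      show "continuous_on (ball 0 R) (\<lambda>x. \<psi> (x + d * real_of_int m))" for m
        unfolding \<psi>_def heat1_eq[OF t] cis_conv_exp by (intro continuous_intros) (use t in auto)
    qed
    then have "continuous_on (\<Union>R. ball 0 R) f" by (intro continuous_on_open_UN) auto
    moreover have "(\<Union>R. ball 0 R) = (UNIV :: real set)" by (auto intro: gt_ex)
    ultimately show ?thesis by simp
  qed
  have cg: "continuous_on UNIV g"
    unfolding g_def
  proof (rule continuous_on_infsum[OF _ sG])
    show "continuous_on UNIV (G z)" for z unfolding G_def cis_conv_exp by (intro continuous_intros) (use d in auto)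
  qed (simp add: nG)
  have perf: "f (x + d) = f x" for x
  proof -
    have bij: "bij_betw (\<lambda>m::int. m + 1) UNIV UNIV"
      by (rule bij_betw_byWitness[where f' = "\<lambda>m. m - 1"]) auto
    show ?thesis unfolding f_def
      using infsum_reindex_bij_betw[OF bij, of "\<lambda>m. \<psi> (x + d * of_int m)"] by (simp add: algebra_simps)
  qed
  have cis_shift: "cis (2 * pi * of_int z * (x + of_int m * d) / d) = cis (2 * pi * of_int z * x / d)" for z m :: int and x
  proof -
    have "2 * pi * of_int z * (x + of_int m * d) / d = 2 * pi * of_int z * x / d + 2 * pi * of_int (z * m)"
      using d by (simp add: field_simps)
    then show ?thesis by (simp add: cis_mult[symmetric] cis_multiple_2pi)
  qed
  have perg: "g (x + d) = g x" for x
    unfolding g_def G_def using cis_shift[of _ x 1] by simp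
  have iI: "integrable lborel (indicat_real {0..<d})" "integrable lborel (indicat_real {0..d})"
    by (rule integrable_real_indicator; use d in simp)+
  have cof: "integral {0..d} (\<lambda>x. f x * cis (2 * pi * of_int n * x / d)) = of_real (exp (- (t * (w (-n))\<^sup>2)))" for n
  proof -
    define e where "e x = cis (2 * pi * of_int n * x / d)" for x
    have ce: "continuous_on A e" for A unfolding e_def cis_conv_exp by (intro continuous_intros) (use d in auto)
    have me [measurable]: "e \<in> borel_measurable borel" by (intro borel_measurable_continuous_onI ce)
    \<comment> \<open>Cuts the integral over the line into periods. The half-open intervals tile the
      line, so exactly one \<open>m\<close> contributes at each \<open>y\<close>.\<close>
    define F where "F m y = indicator {0..<d} (y - d * of_int m) *\<^sub>R (\<psi> y * e y)" for m :: int and y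
    have iF: "integrable lborel (\<lambda>y. \<psi> y * e y)"
      using int\<psi>[of "2 * pi * of_int n / d"] by (simp add: e_def)
    have ind: "indicator {0..<d} (y - d * of_int m) = (if m = \<lfloor>y / d\<rfloor> then 1 else (0::real))" for y and m :: int
    proof -
      have "y - d * of_int m \<in> {0..<d} \<longleftrightarrow> of_int m \<le> y / d \<and> y / d < of_int m + 1"
        using d by (auto simp: field_simps)
      also have "\<dots> \<longleftrightarrow> m = \<lfloor>y / d\<rfloor>" by linarith
      finally show ?thesis by (simp add: indicator_def)
    qed
    have hs: "((\<lambda>m. F m y) has_sum (\<psi> y * e y)) UNIV" and hn: "((\<lambda>m. norm (F m y)) has_sum norm (\<psi> y * e y)) UNIV" for y
      by (rule has_sum_finite_neutralI[of "{\<lfloor>y / d\<rfloor>}"]; simp add: F_def ind)+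
    have "((\<lambda>m. integral\<^sup>L lborel (F m)) has_sum (integral\<^sup>L lborel (\<lambda>y. \<Sum>\<^sub>\<infinity>m. F m y))) UNIV"
    proof (rule integral_has_sum_dominated(4)[where B = "\<lambda>y. norm (\<psi> y * e y)"])
      show "F i \<in> borel_measurable lborel" for i unfolding F_def by measurable
    qed (use hn iF in \<open>auto simp: has_sum_iff lborel.sigma_finite_measure_axioms simp del: norm_mult\<close>)
    also have "(\<lambda>y. \<Sum>\<^sub>\<infinity>m. F m y) = (\<lambda>y. \<psi> y * e y)" by (simp add: infsumI[OF hs])
    also have "integral\<^sup>L lborel (\<lambda>y. \<psi> y * e y) = (\<integral>y. of_real (heat1 t y) * cis ((2 * pi * of_int n / d - \<eta>) * y) \<partial>lborel)"
      unfolding \<psi>_def e_def by (simp add: mult.assoc cis_mult algebra_simps)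
    also have "\<dots> = of_real (exp (- (t * (w (-n))\<^sup>2)))"
      unfolding heat1_fourier[OF t] w_def by (simp add: power2_commute)
    finally have 1: "((\<lambda>m. integral\<^sup>L lborel (F m)) has_sum of_real (exp (- (t * (w (-n))\<^sup>2)))) UNIV" .
    have 2: "integral\<^sup>L lborel (F m) = (\<integral>x. indicator {0..<d} x *\<^sub>R (\<psi> (x + d * of_int m) * e x) \<partial>lborel)" for m
    proof -
      have "integral\<^sup>L lborel (F m) = (\<integral>x. F m (d * of_int m + 1 * x) \<partial>lborel)"
        by (subst lborel_integral_real_affine[of 1 _ "d * of_int m"]) auto
      also have "\<dots> = (\<integral>x. indicator {0..<d} x *\<^sub>R (\<psi> (x + d * of_int m) * e x) \<partial>lborel)"
        using cis_shift[of n _ m] by (intro Bochner_Integration.integral_cong) (auto simp: F_def e_def algebra_simps)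
      finally show ?thesis .
    qed
    \<comment> \<open>The same integrals, summed this time under one integral over the period;
      uniqueness of sums then identifies the coefficient.\<close>
    have "((\<lambda>m. \<integral>x. indicator {0..<d} x *\<^sub>R (\<psi> (x + d * of_int m) * e x) \<partial>lborel) has_sum
        (\<integral>x. (\<Sum>\<^sub>\<infinity>m. indicator {0..<d} x *\<^sub>R (\<psi> (x + d * of_int m) * e x)) \<partial>lborel)) UNIV"
    proof (rule integral_has_sum_dominated(4)[where B = "\<lambda>x. indicator {0..<d} x * (\<Sum>\<^sub>\<infinity>m::int. K d * (1 / (1 + (real_of_int m)\<^sup>2)))"])
      show "(\<lambda>x. indicator {0..<d} x *\<^sub>R (\<psi> (x + d * of_int m) * e x)) \<in> borel_measurable lborel" for m :: int by measurable
      show "(\<lambda>m. norm (indicator {0..<d} x *\<^sub>R (\<psi> (x + d * real_of_int m) * e x))) summable_on UNIV" for x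
        using summable_on_cmult_right[OF s\<psi>[of x], of "indicator {0..<d} x"] by (simp add: norm_mult e_def)
      show "(\<Sum>\<^sub>\<infinity>m. norm (indicator {0..<d} x *\<^sub>R (\<psi> (x + d * real_of_int m) * e x))) \<le> indicator {0..<d} x * (\<Sum>\<^sub>\<infinity>m::int. K d * (1 / (1 + (real_of_int m)\<^sup>2)))" for x
        using infsum_mono[OF s\<psi>[of x] sK[of d] bnd[of x d]] by (auto simp: norm_mult e_def indicator_def)
    qed (use iI in \<open>auto simp: lborel.sigma_finite_measure_axioms\<close>)
    then have "((\<lambda>m. integral\<^sup>L lborel (F m)) has_sum (\<integral>x. indicator {0..<d} x *\<^sub>R (f x * e x) \<partial>lborel)) UNIV"
      unfolding 2 f_def using s\<psi> by (simp add: infsum_scaleR_right infsum_cmult_left abs_summable_summable)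
    with 1 have "(\<integral>x. indicator {0..<d} x *\<^sub>R (f x * e x) \<partial>lborel) = of_real (exp (- (t * (w (-n))\<^sup>2)))"
      using has_sum_unique by blast
    \<comment> \<open>The tiling needed a half-open period, the comparison needs the closed one;
      they differ in the null set of the point \<open>d\<close>.\<close>
    also have "(\<integral>x. indicator {0..<d} x *\<^sub>R (f x * e x) \<partial>lborel) = (LINT x:{0..d}|lborel. f x * e x)"
      unfolding set_lebesgue_integral_def
    proof (rule integral_cong_AE)
      show "AE x in lborel. indicator {0..<d} x *\<^sub>R (f x * e x) = indicator {0..d} x *\<^sub>R (f x * e x)"
        using AE_lborel_singleton[of d] by eventually_elim (auto simp: indicator_def)
    qed (use borel_measurable_continuous_onI[OF cf] in measurable)
    also have "\<dots> = integral {0..d} (\<lambda>x. f x * e x)"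
      by (intro set_borel_integral_eq_integral borel_integrable_atLeastAtMost' continuous_intros ce continuous_on_subset[OF cf]) auto
    finally show ?thesis by (simp add: e_def)
  qed
  have cog: "integral {0..d} (\<lambda>x. g x * cis (2 * pi * of_int n * x / d)) = of_real (exp (- (t * (w (-n))\<^sup>2)))" for n
  proof -
    define e where "e x = cis (2 * pi * of_int n * x / d)" for x
    have ce: "continuous_on A e" for A unfolding e_def cis_conv_exp by (intro continuous_intros) (use d in auto)
    have me [measurable]: "e \<in> borel_measurable borel" by (intro borel_measurable_continuous_onI ce)
    have mG [measurable]: "G z \<in> borel_measurable borel" for z unfolding G_def cis_conv_exp by measurable
    have ge: "(\<Sum>\<^sub>\<infinity>z. indicator {0..d} x *\<^sub>R (G z x * e x)) = indicator {0..d} x *\<^sub>R (g x * e x)" for x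
      unfolding g_def using sG by (simp add: infsum_scaleR_right infsum_cmult_left abs_summable_summable nG)
    have "((\<lambda>z. \<integral>x. indicator {0..d} x *\<^sub>R (G z x * e x) \<partial>lborel) has_sum
        (\<integral>x. (\<Sum>\<^sub>\<infinity>z. indicator {0..d} x *\<^sub>R (G z x * e x)) \<partial>lborel)) UNIV"
    proof (rule integral_has_sum_dominated(4)[where B = "\<lambda>x. indicator {0..d} x * (\<Sum>\<^sub>\<infinity>z. exp (- (t * (w z)\<^sup>2)) / d)"])
      show "(\<lambda>x. indicator {0..d} x *\<^sub>R (G z x * e x)) \<in> borel_measurable lborel" for z by measurable
      show "(\<lambda>z. norm (indicator {0..d} x *\<^sub>R (G z x * e x))) summable_on UNIV" for x
        using summable_on_cmult_right[OF sG, of "indicator {0..d} x"] by (simp add: norm_mult e_def nG)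
      show "(\<Sum>\<^sub>\<infinity>z. norm (indicator {0..d} x *\<^sub>R (G z x * e x))) \<le> indicator {0..d} x * (\<Sum>\<^sub>\<infinity>z. exp (- (t * (w z)\<^sup>2)) / d)" for x
        by (auto simp: norm_mult e_def nG indicator_def)
    qed (use iI in \<open>auto simp: lborel.sigma_finite_measure_axioms\<close>)
    then have 1: "((\<lambda>z. \<integral>x. indicator {0..d} x *\<^sub>R (G z x * e x) \<partial>lborel) has_sum integral {0..d} (\<lambda>x. g x * e x)) UNIV"
      unfolding ge using set_borel_integral_eq_integral(2)[OF borel_integrable_atLeastAtMost'[of 0 d "\<lambda>x. g x * e x"]]
      by (simp add: set_lebesgue_integral_def continuous_on_mult ce continuous_on_subset[OF cg])
    \<comment> \<open>Orthogonality of the characters: only the frequency opposite to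
      \<open>n\<close> survives.\<close>
    have 2: "(\<integral>x. indicator {0..d} x *\<^sub>R (G z x * e x) \<partial>lborel) = (if z = -n then of_real (exp (- (t * (w z)\<^sup>2))) else 0)" for z
    proof -
      define a where "a = 2 * pi * of_int (z + n) / d"
      have Ge: "G z x * e x = of_real (exp (- (t * (w z)\<^sup>2)) / d) * cis (a * x)" for x
        unfolding G_def e_def a_def by (simp add: mult.assoc cis_mult algebra_simps add_divide_distrib)
      have cc: "continuous_on {0..d} (\<lambda>x. cis (a * x))" unfolding cis_conv_exp by (intro continuous_intros)
      have "(\<integral>x. indicator {0..d} x *\<^sub>R (G z x * e x) \<partial>lborel) = integral {0..d} (\<lambda>x. G z x * e x)"
        unfolding set_lebesgue_integral_def[symmetric] Ge
        by (intro set_borel_integral_eq_integral borel_integrable_atLeastAtMost' continuous_on_mult_left cc)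
      also have "\<dots> = of_real (exp (- (t * (w z)\<^sup>2)) / d) * integral {0..d} (\<lambda>x. cis (a * x))"
        unfolding Ge by (rule integral_mult_right)
      also have "integral {0..d} (\<lambda>x. cis (a * x)) = (if z = -n then of_real d else 0)"
      proof (cases "z = -n")
        case True then show ?thesis using d by (simp add: a_def scaleR_conv_of_real)
      next
        case False
        then have "z + n \<noteq> 0" by presburger
        then have a: "a \<noteq> 0" using d by (simp add: a_def)
        have "((\<lambda>x. cis (a * x)) has_integral (cis (a * d) / (\<i> * a) - cis (a * 0) / (\<i> * a))) {0..d}"
        proof (rule fundamental_theorem_of_calculus)
          fix x
          show "((\<lambda>x. cis (a * x) / (\<i> * a)) has_vector_derivative cis (a * x)) (at x within {0..d})"
          proof -
            have "((\<lambda>z. exp (\<i> * of_real a * z) / (\<i> * of_real a)) has_field_derivative exp (\<i> * of_real a * of_real x)) (at (of_real x))"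
              by (rule derivative_eq_intros refl | use a in simp)+
            from has_vector_derivative_real_field[OF this] show ?thesis
              by (simp add: cis_conv_exp mult.assoc)
          qed
        qed (use d in auto)
        moreover have "cis (a * d) = 1" using d cis_multiple_2pi[of "of_int (z + n)"] by (simp add: a_def)
        ultimately show ?thesis using False by (simp add: integral_unique)
      qed
      finally show ?thesis using d by simp
    qed
    have "((\<lambda>z. if z = -n then complex_of_real (exp (- (t * (w z)\<^sup>2))) else 0) has_sum of_real (exp (- (t * (w (-n))\<^sup>2)))) UNIV"
      by (rule has_sum_finite_neutralI[of "{-n}"]) auto
    with 1[unfolded 2] have "integral {0..d} (\<lambda>x. g x * e x) = of_real (exp (- (t * (w (-n))\<^sup>2)))"
      using has_sum_unique by blast
    then show ?thesis by (simp only: e_def)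
  qed
  have "f x - g x = 0" for x
  proof (rule fourier_coefficients_zero[OF d])
    show "continuous_on UNIV (\<lambda>x. f x - g x)" by (intro continuous_intros cf cg)
    fix n :: int
    have i: "(\<lambda>x. u x * cis (2 * pi * of_int n * x / d)) integrable_on {0..d}" if "continuous_on UNIV u" for u
      unfolding cis_conv_exp
      by (intro integrable_continuous_real continuous_intros continuous_on_subset[OF that]) (use d in auto)
    show "integral {0..d} (\<lambda>x. (f x - g x) * cis (2 * pi * of_int n * x / d)) = 0"
      unfolding left_diff_distrib by (subst integral_diff) (use i cf cg cof cog in auto)
  qed (simp add: perf perg)
  \<comment> \<open>Restores the phase on both sides.\<close>
  then have "f x * cis (\<eta> * x) = g x * cis (\<eta> * x)" by simp
  moreover have "f x * cis (\<eta> * x) = (\<Sum>\<^sub>\<infinity>m::int. of_real (heat1 t (x + d * of_int m)) * cis (- (\<eta> * (d * of_int m))))"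
    unfolding f_def \<psi>_def infsum_cmult_left'[symmetric] mult.assoc cis_mult
    by (rule infsum_cong) (simp add: algebra_simps)
  moreover have "g x * cis (\<eta> * x) = (\<Sum>\<^sub>\<infinity>z::int. of_real (exp (- (t * (w z)\<^sup>2)) / d) * cis (w z * x))"
    unfolding g_def G_def infsum_cmult_left'[symmetric] mult.assoc cis_mult
    by (rule infsum_cong) (simp add: algebra_simps w_def)
  ultimately show ?thesis by (simp add: w_def)
qed

section \<open>Ewald splitting of the Green function\<close>

lemma has_sum_diff:
  fixes f g :: "'a \<Rightarrow> 'b::real_normed_vector"
  assumes "(f has_sum a) A" "(g has_sum b) A"
  shows "((\<lambda>x. f x - g x) has_sum (a - b)) A"
  using has_sum_add[OF assms(1), of "\<lambda>x. - g x" "- b"] assms(2) by (simp add: has_sum_uminus)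

lemma prod_cis: "(\<Prod>i\<in>A. cis (f i)) = cis (\<Sum>i\<in>A. f i)"
  by (induction A rule: infinite_finite_induct) (auto simp: cis_mult)

lemma prod_Basis_vec:
  "(\<Prod>b\<in>(Basis :: (real ^ 'n) set). f (x \<bullet> b)) = (\<Prod>i\<in>UNIV. f (x $ i))"
proof -
  have B: "(Basis :: (real ^ 'n) set) = (\<lambda>i. axis i 1) ` UNIV" by (auto simp: Basis_vec_def)
  have "inj (\<lambda>i. axis i 1 :: real ^ 'n)" by (auto simp: inj_on_def axis_eq_axis)
  then show ?thesis unfolding B by (subst prod.reindex) (auto simp: inner_axis)
qed

lemma nn_integral_lborel_vec_prod:
  fixes f :: "real \<Rightarrow> real"
  assumes [measurable]: "f \<in> borel_measurable borel" and "\<And>x. f x \<ge> 0"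
  shows "(\<integral>\<^sup>+x. ennreal (\<Prod>i\<in>UNIV. f (x $ i)) \<partial>(lborel :: (real ^ 'n) measure)) = (\<integral>\<^sup>+x. ennreal (f x) \<partial>lborel) ^ CARD('n)"
proof -
  have "(\<integral>\<^sup>+x. ennreal (\<Prod>i\<in>UNIV. f (x $ i)) \<partial>(lborel :: (real ^ 'n) measure)) =
      (\<integral>\<^sup>+x. (\<Prod>b\<in>Basis. ennreal (f (x \<bullet> b))) \<partial>(lborel :: (real ^ 'n) measure))"
    by (simp add: prod_Basis_vec[of "\<lambda>y. ennreal (f y)"] prod_ennreal assms(2))
  also have "\<dots> = (\<integral>\<^sup>+x. ennreal (f x) \<partial>lborel) ^ CARD('n)"
    by (subst nn_integral_lborel_prod) auto
  finally show ?thesis .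
qed

lemma wt_integrable: "integrable lborel (wt :: real ^ 'n \<Rightarrow> real)"
proof -
  have "set_integrable lborel UNIV (\<lambda>x::real. inverse (1 + x\<^sup>2))"
    using integrable_inverse_1_plus_square by (simp add: einterval_def)
  then have "integrable lborel (\<lambda>x::real. 1 / (1 + x\<^sup>2))" by (simp add: set_integrable_def inverse_eq_divide)
  then have "(\<integral>\<^sup>+x. ennreal (1 / (1 + x\<^sup>2)) \<partial>(lborel :: real measure)) < \<infinity>"
    unfolding integrable_iff_bounded using one_plus_sq_pos by (simp add: less_imp_le)
  then have "(\<integral>\<^sup>+x. ennreal (wt x) \<partial>(lborel :: (real ^ 'n) measure)) < \<infinity>"
    unfolding wt_def by (subst nn_integral_lborel_vec_prod) (auto simp: one_plus_sq_pos less_imp_le power_less_top_ennreal)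
  then show ?thesis unfolding integrable_iff_bounded by (simp add: wt_pos abs_of_pos)
qed

lemma integrable_le_wt:
  fixes f :: "real ^ 'n \<Rightarrow> complex"
  assumes "f \<in> borel_measurable borel" and "\<And>x. norm (f x) \<le> c * wt x"
  shows "integrable lborel f"
proof (rule Bochner_Integration.integrable_bound[OF integrable_mult_right[OF wt_integrable, of c]])
  have "norm (f x) \<le> norm (c * wt x)" for x using assms(2)[of x] by (simp add: order.trans[OF _ abs_ge_self])
  then show "AE x in lborel. norm (f x) \<le> norm (c * wt x)" by simp
qed (use assms(1) in simp)

definition heat :: "real \<Rightarrow> real ^ 'n \<Rightarrow> real" where
  "heat t y = (\<Prod>i\<in>UNIV. heat1 t (y $ i))"

lemma heat_nonneg: "heat t y \<ge> 0"
  unfolding heat_def by (intro prod_nonneg) (simp add: heat1_nonneg)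

lemma borel_measurable_vec_nth' [measurable (raw)]:
  fixes f :: "'a \<Rightarrow> real ^ 'n"
  assumes "f \<in> borel_measurable M"
  shows "(\<lambda>x. f x $ i) \<in> borel_measurable M"
  by (rule measurable_compose[OF assms borel_measurable_continuous_onI]) (intro continuous_intros)

lemma heat_measurable [measurable]: "(\<lambda>(t, y). heat t y) \<in> borel_measurable (borel \<Otimes>\<^sub>M borel)"
  unfolding heat_def by measurable

lemma heat_measurable2 [measurable]: "heat t \<in> borel_measurable borel"
  unfolding heat_def heat1_def by measurable

lemma nn_integral_heat:
  assumes "t > 0" shows "(\<integral>\<^sup>+x. ennreal (heat t x) \<partial>lborel) = 1"
  unfolding heat_def
  using nn_integral_eq_integral[OF heat1_integrable[OF assms]] heat1_integral[OF assms]
  by (subst nn_integral_lborel_vec_prod) (auto simp: heat1_nonneg heat1_def)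

text \<open>Replaces the diagonal matrix by its diagonal, so that lattice points, frequencies and
  the volume of the cell are explicit in coordinates.\<close>

locale diagonal_lattice =
  fixes d :: "'n::finite \<Rightarrow> real" and \<eta> :: "real ^ 'n" and k :: complex
  assumes d_pos: "\<And>i. d i > 0"
begin

definition fr :: "int ^ 'n \<Rightarrow> real ^ 'n" where "fr z = (\<chi> i. 2 * pi * of_int (z $ i) / d i + \<eta> $ i)"
definition lat :: "int ^ 'n \<Rightarrow> real ^ 'n" where "lat m = (\<chi> i. d i * of_int (m $ i))"
definition vol :: real where "vol = (\<Prod>i\<in>UNIV. d i)"
definition lam :: "int ^ 'n \<Rightarrow> complex" where "lam z = of_real ((norm (fr z))\<^sup>2) - k\<^sup>2"
text \<open>Where \<^term>\<open>lam z = 0\<close>, the coefficient cancels the contribution $\int_0^1 1\,dt$ of the resonant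
  frequency to the singular part.\<close>

definition cof :: "int ^ 'n \<Rightarrow> complex" where
  "cof z = (if lam z = 0 then 1 / vol else - exp (- lam z) / (lam z * vol))"
definition smooth_part :: "real ^ 'n \<Rightarrow> complex" where
  "smooth_part x = (\<Sum>\<^sub>\<infinity>z. cof z * cis (x \<bullet> fr z))"
text \<open>The quasi-periodic heat kernel in its spectral form; \<open>poisson\<close> gives the
  form as a lattice sum.\<close>

definition theta :: "real \<Rightarrow> real ^ 'n \<Rightarrow> complex" where
  "theta t x = (\<Sum>\<^sub>\<infinity>z. of_real (exp (- (t * (norm (fr z))\<^sup>2)) / vol) * cis (x \<bullet> fr z))"
text \<open>Multiplying by exp(k^2 t) turns exp(-t |\<xi>|^2) into exp(-\<lambda> t), the integrand
  of the splitting.\<close>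

definition sing_part :: "real ^ 'n \<Rightarrow> complex" where
  "sing_part x = (LINT t:{0<..1}|lborel. exp (k\<^sup>2 * of_real t) * theta t x)"

lemma vol_pos: "vol > 0" unfolding vol_def by (simp add: prod_pos d_pos)

lemma norm_sq: "(norm (x :: real ^ 'n))\<^sup>2 = (\<Sum>i\<in>UNIV. (x $ i)\<^sup>2)"
  unfolding power2_norm_eq_inner inner_vec_def by (simp add: power2_eq_square)

lemma wt_lat_summable: "(\<lambda>m. wt (y + lat m)) summable_on UNIV"
  and wt_lat_bound: "\<exists>C>0. \<forall>y. (\<Sum>\<^sub>\<infinity>m. wt (y + lat m)) \<le> C"
proof -
  have eq: "y + lat m = (\<chi> i. y $ i + d i * real_of_int (m $ i))" for y m
    by (simp add: lat_def vec_eq_iff)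
  obtain C where C: "C > 0"
    "\<And>y. (\<lambda>m::int^'n. wt (\<chi> i. y $ i + d i * real_of_int (m $ i))) summable_on UNIV"
    "\<And>y. (\<Sum>\<^sub>\<infinity>m::int^'n. wt (\<chi> i. y $ i + d i * real_of_int (m $ i))) \<le> C"
    using wt_lattice_sum[of d, OF d_pos] by blast
  then show "(\<lambda>m. wt (y + lat m)) summable_on UNIV" "\<exists>C>0. \<forall>y. (\<Sum>\<^sub>\<infinity>m. wt (y + lat m)) \<le> C"
    unfolding eq by blast+
qed

lemma wt_fr_summable: "(\<lambda>z. wt (fr z)) summable_on UNIV"
proof -
  have eq: "fr z = (\<chi> i. \<eta> $ i + 2 * pi / d i * real_of_int (z $ i))" for z
    by (simp add: fr_def vec_eq_iff)
  have "2 * pi / d i > 0" for i using d_pos[of i] by simp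
  then show ?thesis unfolding eq using wt_lattice_sum[of "\<lambda>i. 2 * pi / d i"] by blast
qed

lemma exp_fr_prod: "exp (- (t * (norm (fr z))\<^sup>2)) = (\<Prod>i\<in>UNIV. exp (- (t * (2 * pi * of_int (z $ i) / d i + \<eta> $ i)\<^sup>2)))"
  unfolding norm_sq by (simp add: fr_def exp_sum[symmetric] sum_negf[symmetric] sum_distrib_left)

lemma exp_fr_summable: "t > 0 \<Longrightarrow> (\<lambda>z. exp (- (t * (norm (fr z))\<^sup>2))) summable_on UNIV"
  unfolding exp_fr_prod
  using abs_summable_prod_vec(1)[of "\<lambda>i z. exp (- (t * (2 * pi * of_int z / d i + \<eta> $ i)\<^sup>2))"]
    frequency_summable[OF _ d_pos] by (simp add: abs_prod)

lemma heat_summable: "t > 0 \<Longrightarrow> (\<lambda>m. heat t (x + lat m)) summable_on UNIV"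
  unfolding heat_def
  using abs_summable_prod_vec(1)[of "\<lambda>i m. heat1 t (x $ i + d i * of_int m)"]
    heat1_summable[OF _ d_pos] by (simp add: abs_prod heat1_nonneg lat_def)

text \<open>Gaussians and characters are products over the coordinates, so both sides factor into
  one-dimensional sums related by \<open>poisson1\<close>.\<close>

lemma poisson:
  assumes t: "t > 0"
  shows "theta t x = (\<Sum>\<^sub>\<infinity>m. of_real (heat t (x + lat m)) * cis (- (\<eta> \<bullet> lat m)))"
proof -
  define a where "a i m = complex_of_real (heat1 t (x $ i + d i * of_int m)) * cis (- (\<eta> $ i * (d i * of_int m)))" for i and m :: int
  define b where "b i z = complex_of_real (exp (- (t * (2 * pi * of_int z / d i + \<eta> $ i)\<^sup>2)) / d i) * cis ((2 * pi * of_int z / d i + \<eta> $ i) * (x $ i))" for i and z :: int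
  have sa: "(\<lambda>m. norm (a i m)) summable_on UNIV" for i
    using heat1_summable[OF t d_pos] by (simp add: a_def norm_mult heat1_nonneg)
  have sb: "(\<lambda>m. norm (b i m)) summable_on UNIV" for i
    using summable_on_cmult_left[OF frequency_summable[OF t d_pos[of i], of "\<eta> $ i"], of "1 / d i"] d_pos[of i]
    by (simp add: b_def norm_mult norm_divide)
  have pa: "(\<Prod>i\<in>UNIV. a i (m $ i)) = of_real (heat t (x + lat m)) * cis (- (\<eta> \<bullet> lat m))" for m
    by (simp add: a_def prod.distrib prod_cis heat_def lat_def inner_vec_def sum_negf)
  have pb: "(\<Prod>i\<in>UNIV. b i (z $ i)) = of_real (exp (- (t * (norm (fr z))\<^sup>2)) / vol) * cis (x \<bullet> fr z)" for z
    unfolding exp_fr_prod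
    by (simp add: b_def prod.distrib prod_cis vol_def fr_def inner_vec_def prod_dividef mult.commute)
  have "theta t x = (\<Prod>i\<in>UNIV. infsum (b i) UNIV)"
    using abs_summable_prod_vec(2)[of b, OF sb] unfolding pb theta_def by (rule infsumI)
  also have "\<dots> = (\<Prod>i\<in>UNIV. infsum (a i) UNIV)"
    unfolding a_def b_def using poisson1[OF d_pos t] by simp
  also have "\<dots> = (\<Sum>\<^sub>\<infinity>m. of_real (heat t (x + lat m)) * cis (- (\<eta> \<bullet> lat m)))"
    using abs_summable_prod_vec(2)[of a, OF sa] unfolding pa by (rule infsumI[symmetric])
  finally show ?thesis .
qed

text \<open>Taken from the lattice form, where all phases have modulus one. Absolute values in the
  spectral form would give a bound that is independent of \<open>x\<close> and blows up as
  \<open>t\<close> tends to 0.\<close>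

lemma norm_theta_le:
  assumes t: "t > 0" shows "norm (theta t x) \<le> (\<Sum>\<^sub>\<infinity>m. heat t (x + lat m))"
proof -
  have n: "norm (of_real (heat t (x + lat m)) * cis (- (\<eta> \<bullet> lat m))) = heat t (x + lat m)" for m
    by (simp add: norm_mult heat_nonneg)
  show ?thesis unfolding poisson[OF t]
    using norm_infsum_bound[of "\<lambda>m. of_real (heat t (x + lat m)) * cis (- (\<eta> \<bullet> lat m))" UNIV]
      heat_summable[OF t, of x] unfolding n by simp
qed

lemma theta_measurable [measurable]: "(\<lambda>(t, x). theta t x) \<in> borel_measurable (borel \<Otimes>\<^sub>M borel)"
  unfolding theta_def case_prod_beta
  by (rule borel_measurable_infsum) (unfold cis_conv_exp, measurable)

lemma smooth_part_measurable [measurable]: "smooth_part \<in> borel_measurable borel"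
  unfolding smooth_part_def by (rule borel_measurable_infsum) (unfold cis_conv_exp, measurable)

text \<open>The bound is independent of \<open>t\<close>, so the time integral over
  \<open>{0<..1}\<close> converges although theta concentrates at the lattice as \<open>t\<close>
  tends to 0. Unfolding moves the lattice sum onto the weight, where it is at most \<open>C\<close>,
  and the heat kernel has mass one.\<close>

lemma nn_integral_theta:
  obtains C where "C > 0"
    "\<And>t. t > 0 \<Longrightarrow> (\<integral>\<^sup>+x. ennreal (norm (theta t x) * wt x) \<partial>lborel) \<le> ennreal C"
proof -
  obtain C where C: "C > 0" "\<And>y. (\<Sum>\<^sub>\<infinity>m. wt (y + lat m)) \<le> C" using wt_lat_bound by blast
  have even: "wt (y - lat m) = wt (- y + lat m)" for y m
    unfolding wt_def by (intro prod.cong) (auto simp: power2_commute)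
  interpret C: sigma_finite_measure "count_space (UNIV :: (int ^ 'n) set)"
    by (rule sigma_finite_measure_count_space)
  interpret P: pair_sigma_finite "lborel :: (real ^ 'n) measure" "count_space (UNIV :: (int ^ 'n) set)" ..
  have "(\<integral>\<^sup>+x. ennreal (norm (theta t x) * wt x) \<partial>lborel) \<le> ennreal C" if t: "t > 0" for t
  proof -
    have m1: "(\<lambda>(x, m). ennreal (heat t (x + lat m) * wt x)) \<in> borel_measurable (lborel \<Otimes>\<^sub>M count_space UNIV)"
      by (rule measurable_pair_count_space) measurable
    have m2: "(\<lambda>(x, m). ennreal (heat t x * wt (x - lat m))) \<in> borel_measurable (lborel \<Otimes>\<^sub>M count_space UNIV)"
      by (rule measurable_pair_count_space) measurable
    have "(\<integral>\<^sup>+x. ennreal (norm (theta t x) * wt x) \<partial>lborel) \<le>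
        (\<integral>\<^sup>+x. (\<integral>\<^sup>+m. ennreal (heat t (x + lat m) * wt x) \<partial>count_space UNIV) \<partial>lborel)"
    proof (rule nn_integral_mono)
      fix x :: "real ^ 'n"
      have "norm (theta t x) * wt x \<le> (\<Sum>\<^sub>\<infinity>m. heat t (x + lat m) * wt x)"
        using norm_theta_le[OF t, of x] wt_pos[of x] by (simp add: infsum_cmult_left' mult_right_mono)
      then show "ennreal (norm (theta t x) * wt x) \<le> (\<integral>\<^sup>+m. ennreal (heat t (x + lat m) * wt x) \<partial>count_space UNIV)"
        using less_imp_le[OF wt_pos[of x]] by (subst nn_integral_count_space_infsum)
          (auto intro!: summable_on_cmult_left heat_summable t ennreal_leI mult_nonneg_nonneg heat_nonneg)
    qed
    also have "\<dots> = (\<integral>\<^sup>+m. (\<integral>\<^sup>+x. ennreal (heat t (x + lat m) * wt x) \<partial>lborel) \<partial>count_space UNIV)"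
      using P.Fubini'[OF m1] by simp
    \<comment> \<open>Translation by \<open>lat m\<close> moves the shift from the heat kernel to
      the weight.\<close>
    also have "\<dots> = (\<integral>\<^sup>+m. (\<integral>\<^sup>+x. ennreal (heat t x * wt (x - lat m)) \<partial>lborel) \<partial>count_space UNIV)"
    proof (rule nn_integral_cong)
      fix m :: "int ^ 'n"
      have "(\<integral>\<^sup>+x. ennreal (heat t x * wt (x - lat m)) \<partial>lborel) = (\<integral>\<^sup>+x. ennreal (heat t x * wt (x - lat m)) \<partial>distr lborel borel ((+) (lat m)))"
        by (simp add: lborel_distr_plus)
      also have "\<dots> = (\<integral>\<^sup>+x. ennreal (heat t (lat m + x) * wt (lat m + x - lat m)) \<partial>lborel)"
        by (subst nn_integral_distr) auto
      finally show "(\<integral>\<^sup>+x. ennreal (heat t (x + lat m) * wt x) \<partial>lborel) = (\<integral>\<^sup>+x. ennreal (heat t x * wt (x - lat m)) \<partial>lborel)"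
        by (simp add: add.commute)
    qed
    also have "\<dots> = (\<integral>\<^sup>+x. (\<integral>\<^sup>+m. ennreal (heat t x * wt (x - lat m)) \<partial>count_space UNIV) \<partial>lborel)"
      using P.Fubini'[OF m2] by simp
    also have "\<dots> \<le> (\<integral>\<^sup>+x. ennreal (heat t x * C) \<partial>(lborel :: (real ^ 'n) measure))"
    proof (rule nn_integral_mono)
      fix x :: "real ^ 'n"
      show "(\<integral>\<^sup>+m. ennreal (heat t x * wt (x - lat m)) \<partial>count_space UNIV) \<le> ennreal (heat t x * C)"
        unfolding even using wt_lat_summable[of "- x"] C(2)[of "- x"]
        by (subst nn_integral_count_space_infsum)
          (auto intro!: summable_on_cmult_right wt_lat_summable mult_nonneg_nonneg heat_nonneg less_imp_le[OF wt_pos] ennreal_leI mult_left_mono C simp: infsum_cmult_right')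
    qed
    also have "\<dots> = (\<integral>\<^sup>+x. ennreal (heat t x) \<partial>(lborel :: (real ^ 'n) measure)) * ennreal C"
      using C by (subst nn_integral_multc[symmetric]) (auto simp: ennreal_mult heat_nonneg)
    finally show ?thesis by (simp add: nn_integral_heat[OF t])
  qed
  with C that show ?thesis by blast
qed

lemma finite_fr_le: "finite {z. (norm (fr z))\<^sup>2 \<le> R}"
proof (rule finite_subset)
  show "finite {z. exp (- (1 * (norm (fr z))\<^sup>2)) \<ge> exp (- R)}"
    by (intro finite_superlevel_of_summable exp_fr_summable) auto
qed auto

text \<open>Beyond the radius given by |\<xi>|^2 = |k^2| + 1 one has |\<lambda>| \<ge> 1, and the
  factor exp(-\<lambda>) supplies the Gaussian. The finitely many remaining frequencies, the
  resonant ones among them, are absorbed into \<open>C\<close>.\<close>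

lemma cof_bound: obtains C where "C > 0" "\<And>z. norm (cof z) \<le> C * exp (- (norm (fr z))\<^sup>2)"
proof -
  define R where "R = norm (k\<^sup>2) + 1"
  define F where "F = {z. (norm (fr z))\<^sup>2 \<le> R}"
  have F: "finite F" unfolding F_def by (rule finite_fr_le)
  define C where "C = exp (Re (k\<^sup>2)) / vol + (\<Sum>z\<in>F. norm (cof z) * exp ((norm (fr z))\<^sup>2))"
  have C0: "exp (Re (k\<^sup>2)) / vol > 0" using vol_pos by simp
  have "norm (cof z) \<le> C * exp (- (norm (fr z))\<^sup>2)" for z
  proof (cases "z \<in> F")
    case True
    have "norm (cof z) * exp ((norm (fr z))\<^sup>2) \<le> (\<Sum>z\<in>F. norm (cof z) * exp ((norm (fr z))\<^sup>2))"
      using F True by (intro member_le_sum) auto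
    also have "\<dots> \<le> C" unfolding C_def using C0 by simp
    finally show ?thesis by (simp add: exp_minus field_simps)
  next
    case False
    have "1 \<le> (norm (fr z))\<^sup>2 - norm (k\<^sup>2)" using False by (simp add: F_def R_def)
    also have "\<dots> = norm (complex_of_real ((norm (fr z))\<^sup>2)) - norm (k\<^sup>2)" by (simp add: norm_power)
    also have "\<dots> \<le> norm (lam z)" unfolding lam_def by (rule norm_triangle_ineq2)
    finally have l: "1 \<le> norm (lam z)" .
    then have "norm (cof z) = exp (Re (k\<^sup>2) - (norm (fr z))\<^sup>2) / (norm (lam z) * vol)"
      using vol_pos by (auto simp: cof_def norm_divide norm_mult norm_exp_eq_Re lam_def)
    also have "\<dots> \<le> exp (Re (k\<^sup>2) - (norm (fr z))\<^sup>2) / (1 * vol)"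
      using l vol_pos less_le_trans[OF zero_less_one l] by (intro divide_left_mono mult_right_mono mult_pos_pos) auto
    also have "\<dots> = exp (Re (k\<^sup>2)) / vol * exp (- (norm (fr z))\<^sup>2)"
      by (simp add: exp_diff exp_minus field_simps)
    also have "\<dots> \<le> C * exp (- (norm (fr z))\<^sup>2)"
      unfolding C_def by (intro mult_right_mono) (auto intro!: sum_nonneg)
    finally show ?thesis .
  qed
  moreover have "C > 0" unfolding C_def using C0 by (intro add_pos_nonneg sum_nonneg) auto
  ultimately show ?thesis using that by blast
qed

lemma cof_summable: "(\<lambda>z. norm (cof z)) summable_on UNIV"
proof -
  obtain C where C: "C > 0" "\<And>z. norm (cof z) \<le> C * exp (- (norm (fr z))\<^sup>2)" using cof_bound by blast
  show ?thesis
    by (rule summable_on_comparison_test[OF summable_on_cmult_right[OF exp_fr_summable[of 1], of C]]) (use C in auto)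
qed

text \<open>The sign of the exponent is that of the series, so integrating a trigonometric series
  against \<open>f\<close> pairs its coefficients with \<open>fhat f\<close>.\<close>

definition fhat :: "(real ^ 'n \<Rightarrow> complex) \<Rightarrow> int ^ 'n \<Rightarrow> complex" where
  "fhat f z = (\<integral>x. cis (x \<bullet> fr z) * f x \<partial>lborel)"

text \<open>The sum of the norms of the coefficients times |f| is the integrable majorant for the
  exchange.\<close>

lemma trig_series_integral:
  assumes f: "integrable lborel f" and c: "(\<lambda>z. norm (c z)) summable_on UNIV"
  shows "integrable lborel (\<lambda>x. (\<Sum>\<^sub>\<infinity>z. c z * cis (x \<bullet> fr z)) * f x)"
    and "((\<lambda>z. c z * fhat f z) has_sum (\<integral>x. (\<Sum>\<^sub>\<infinity>z. c z * cis (x \<bullet> fr z)) * f x \<partial>lborel)) UNIV"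
proof -
  have [measurable]: "f \<in> borel_measurable lborel" using f by auto
  have eq: "(\<Sum>\<^sub>\<infinity>z. c z * (cis (x \<bullet> fr z) * f x)) = (\<Sum>\<^sub>\<infinity>z. c z * cis (x \<bullet> fr z)) * f x" for x
    by (simp add: infsum_cmult_left'[symmetric] mult.assoc)
  have m: "(\<lambda>x. c z * (cis (x \<bullet> fr z) * f x)) \<in> borel_measurable lborel" for z
    unfolding cis_conv_exp by measurable
  have s: "(\<lambda>z. norm (c z * (cis (x \<bullet> fr z) * f x))) summable_on UNIV" for x
    using summable_on_cmult_left[OF c, of "norm (f x)"] by (simp add: norm_mult)
  have le: "(\<Sum>\<^sub>\<infinity>z. norm (c z * (cis (x \<bullet> fr z) * f x))) \<le> (\<Sum>\<^sub>\<infinity>z. norm (c z)) * norm (f x)" for x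
    by (simp add: norm_mult infsum_cmult_left'[symmetric])
  note * = integral_has_sum_dominated[OF lborel.sigma_finite_measure_axioms m s le, unfolded eq]
  have i: "integrable lborel (\<lambda>x. (\<Sum>\<^sub>\<infinity>z. norm (c z)) * norm (f x))" using f by simp
  show "integrable lborel (\<lambda>x. (\<Sum>\<^sub>\<infinity>z. c z * cis (x \<bullet> fr z)) * f x)" by (rule *(1)[OF i])
  show "((\<lambda>z. c z * fhat f z) has_sum (\<integral>x. (\<Sum>\<^sub>\<infinity>z. c z * cis (x \<bullet> fr z)) * f x \<partial>lborel)) UNIV"
    using *(4)[OF i] by (simp add: fhat_def)
qed

lemma Re_mult_of_real_le: "0 \<le> t \<Longrightarrow> t \<le> 1 \<Longrightarrow> Re (c * of_real t) \<le> norm c"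
  using order.trans[OF complex_Re_le_cmod, of "c * of_real t" "norm c"] by (simp add: norm_mult mult_left_le)

text \<open>The value at l = 0 is the contribution of a resonant frequency that \<open>cof\<close>
  has to cancel.\<close>

lemma set_lebesgue_integral_exp:
  "(LINT t:{0<..1::real}|lborel. exp (- (l * of_real t))) = (if l = 0 then 1 else (1 - exp (- l)) / (l::complex))"
proof -
  have "(LINT t:{0<..1::real}|lborel. exp (- (l * of_real t))) = (LINT t:{0..1::real}|lborel. exp (- (l * of_real t)))"
    unfolding set_lebesgue_integral_def
  proof (rule integral_cong_AE)
    show "AE t in lborel. indicator {0<..1::real} t *\<^sub>R exp (- (l * of_real t)) = indicator {0..1} t *\<^sub>R exp (- (l * of_real t))"
      using AE_lborel_singleton[of 0] by eventually_elim (auto simp: indicator_def)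
  qed measurable
  also have "\<dots> = integral {0..1} (\<lambda>t. exp (- (l * of_real t)))"
    by (intro set_borel_integral_eq_integral borel_integrable_atLeastAtMost' continuous_intros)
  also have "\<dots> = (if l = 0 then 1 else (1 - exp (- l)) / l)"
  proof (cases "l = 0")
    case False
    have "((\<lambda>t. exp (- (l * of_real t))) has_integral (- exp (- (l * of_real 1)) / l - - exp (- (l * of_real 0)) / l)) {0..1::real}"
    proof (rule fundamental_theorem_of_calculus)
      fix t :: real
      have "((\<lambda>z. - exp (- (l * z)) / l) has_field_derivative exp (- (l * of_real t))) (at (of_real t))"
        by (rule derivative_eq_intros refl | use False in simp)+
      from has_vector_derivative_real_field[OF this]
      show "((\<lambda>t. - exp (- (l * of_real t)) / l) has_vector_derivative exp (- (l * of_real t))) (at t within {0..1})" .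
    qed simp
    then show ?thesis using False by (simp add: integral_unique diff_divide_distrib)
  qed simp
  finally show ?thesis .
qed

text \<open>Two exchanges are made: integration in time and space, justified by the uniform bound
  \<open>nn_integral_theta\<close>, and time integration with the sum over the frequencies,
  justified by the summability of \<open>fhat f\<close>.\<close>

lemma sing_part_integral:
  assumes f [measurable]: "f \<in> borel_measurable borel" and le: "\<And>x. norm (f x) \<le> c * wt x"
  shows "integrable lborel (\<lambda>x. sing_part x * f x)"
    and "(\<lambda>z. norm (fhat f z)) summable_on UNIV \<Longrightarrow>
      ((\<lambda>z. (if lam z = 0 then 1 else (1 - exp (- lam z)) / lam z) / vol * fhat f z)
        has_sum (\<integral>x. sing_part x * f x \<partial>lborel)) UNIV"
proof -
  define \<Phi> where "\<Phi> t x = indicator {0<..1} t *\<^sub>R (exp (k\<^sup>2 * of_real t) * theta t x * f x)" for t x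
  have m [measurable]: "case_prod \<Phi> \<in> borel_measurable (lborel \<Otimes>\<^sub>M lborel)"
    unfolding \<Phi>_def by measurable
  have c: "c \<ge> 0" using order.trans[OF norm_ge_zero le[of 0]] by (simp add: zero_le_mult_iff not_le[THEN iffD2, OF wt_pos])
  have fi: "integrable lborel f" by (rule integrable_le_wt[OF f le])
  obtain C where C: "C > 0"
    "\<And>t. t > 0 \<Longrightarrow> (\<integral>\<^sup>+x. ennreal (norm (theta t x) * wt x) \<partial>lborel) \<le> ennreal C"
    using nn_integral_theta by blast
  have "(\<integral>\<^sup>+p. ennreal (norm (case_prod \<Phi> p)) \<partial>(lborel \<Otimes>\<^sub>M lborel)) = (\<integral>\<^sup>+t. \<integral>\<^sup>+x. ennreal (norm (\<Phi> t x)) \<partial>lborel \<partial>lborel)"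
    by (subst lborel.nn_integral_fst[symmetric]) auto
  also have "\<dots> \<le> (\<integral>\<^sup>+t. ennreal (exp (norm (k\<^sup>2)) * c * C) * indicator {0<..1::real} t \<partial>lborel)"
  proof (rule nn_integral_mono)
    fix t :: real
    show "(\<integral>\<^sup>+x. ennreal (norm (\<Phi> t x)) \<partial>lborel) \<le> ennreal (exp (norm (k\<^sup>2)) * c * C) * indicator {0<..1} t"
    proof (cases "t \<in> {0<..1}")
      case True
      have "norm (exp (k\<^sup>2 * of_real t)) \<le> exp (norm (k\<^sup>2))"
        using True Re_mult_of_real_le[of t "k\<^sup>2"] by (simp add: norm_exp_eq_Re)
      then have "norm (\<Phi> t x) \<le> exp (norm (k\<^sup>2)) * norm (theta t x) * (c * wt x)" for x
        using True le[of x] unfolding \<Phi>_def by (simp add: norm_mult mult_mono)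
      then have "(\<integral>\<^sup>+x. ennreal (norm (\<Phi> t x)) \<partial>lborel) \<le> (\<integral>\<^sup>+x. ennreal (exp (norm (k\<^sup>2)) * c) * ennreal (norm (theta t x) * wt x) \<partial>lborel)"
        using c by (intro nn_integral_mono) (simp add: ennreal_mult[symmetric] less_imp_le[OF wt_pos] ennreal_leI algebra_simps)
      also have "\<dots> = ennreal (exp (norm (k\<^sup>2)) * c) * (\<integral>\<^sup>+x. ennreal (norm (theta t x) * wt x) \<partial>lborel)"
        by (rule nn_integral_cmult) measurable
      also have "\<dots> \<le> ennreal (exp (norm (k\<^sup>2)) * c) * ennreal C"
        using C(2)[of t] True by (intro mult_left_mono) auto
      also have "\<dots> = ennreal (exp (norm (k\<^sup>2)) * c * C)"
        using c C(1) by (intro ennreal_mult[symmetric]) auto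
      finally show ?thesis using True by simp
    qed (simp add: \<Phi>_def)
  qed
  also have "\<dots> < \<infinity>" by (subst nn_integral_cmult_indicator) (auto simp: ennreal_mult_less_top)
  finally have int: "integrable (lborel \<Otimes>\<^sub>M lborel) (case_prod \<Phi>)"
    unfolding integrable_iff_bounded using m by blast
  have eq: "(\<integral>t. \<Phi> t x \<partial>lborel) = sing_part x * f x" for x
    unfolding \<Phi>_def sing_part_def set_lebesgue_integral_def
    by (simp add: mult_scaleR_left[symmetric] del: mult_scaleR_left)
  show "integrable lborel (\<lambda>x. sing_part x * f x)"
    using lborel_pair.integrable_snd[OF int] unfolding eq .
  assume s: "(\<lambda>z. norm (fhat f z)) summable_on UNIV"
  \<comment> \<open>Contribution of the frequency \<open>z\<close> at time \<open>t\<close>, after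
    integration in space.\<close>
  define g where "g z t = indicator {0<..1} t *\<^sub>R (exp (- (lam z * of_real t)) / vol * fhat f z)" for z t
  have n: "norm (g z t) \<le> indicator {0<..1} t * (exp (norm (k\<^sup>2)) / vol) * norm (fhat f z)" for z t
  proof (cases "t \<in> {0<..1}")
    case True
    have "Re (k\<^sup>2 * of_real t) \<le> norm (k\<^sup>2)" using True by (intro Re_mult_of_real_le) auto
    moreover have "0 \<le> (norm (fr z))\<^sup>2 * t" using True by simp
    ultimately have "Re (- (lam z * of_real t)) \<le> norm (k\<^sup>2)"
      by (simp add: lam_def left_diff_distrib)
    then have "norm (exp (- (lam z * of_real t))) \<le> exp (norm (k\<^sup>2))" by (simp only: norm_exp_eq_Re exp_le_cancel_iff)
    then show ?thesis using True vol_pos by (simp add: g_def norm_mult norm_divide divide_right_mono mult_right_mono)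
  qed (simp add: g_def)
  have sn: "(\<lambda>z. indicator {0<..1} t * (exp (norm (k\<^sup>2)) / vol) * norm (fhat f z)) summable_on UNIV" for t :: real
    by (intro summable_on_cmult_right s)
  have sg: "(\<lambda>z. norm (g z t)) summable_on UNIV" for t
    by (rule summable_on_comparison_test[OF sn[of t]]) (use n in auto)
  have mg: "g z \<in> borel_measurable lborel" for z unfolding g_def by measurable
  have "(\<Sum>\<^sub>\<infinity>z. norm (g z t)) \<le> indicator {0<..1} t * (exp (norm (k\<^sup>2)) / vol * (\<Sum>\<^sub>\<infinity>z. norm (fhat f z)))" for t
    using infsum_mono[OF sg[of t] sn[of t] n] unfolding infsum_cmult_right' by (simp only: mult.assoc)
  then have "((\<lambda>z. integral\<^sup>L lborel (g z)) has_sum (\<integral>t. (\<Sum>\<^sub>\<infinity>z. g z t) \<partial>lborel)) UNIV"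
    by (rule integral_has_sum_dominated(4)[OF lborel.sigma_finite_measure_axioms mg sg]) simp
  also have "(\<integral>t. (\<Sum>\<^sub>\<infinity>z. g z t) \<partial>lborel) = (\<integral>t. (\<integral>x. \<Phi> t x \<partial>lborel) \<partial>lborel)"
  proof (rule Bochner_Integration.integral_cong[OF refl])
    fix t :: real
    show "(\<Sum>\<^sub>\<infinity>z. g z t) = (\<integral>x. \<Phi> t x \<partial>lborel)"
    proof (cases "t \<in> {0<..1}")
      case True
      have "(\<lambda>z. norm (complex_of_real (exp (- (t * (norm (fr z))\<^sup>2)) / vol))) summable_on UNIV"
        using summable_on_cmult_left[OF exp_fr_summable[of t], of "1 / vol"] True vol_pos by (simp add: norm_divide)
      from trig_series_integral(2)[OF fi this]
      have "((\<lambda>z. of_real (exp (- (t * (norm (fr z))\<^sup>2)) / vol) * fhat f z) has_sum (\<integral>x. theta t x * f x \<partial>lborel)) UNIV"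
        unfolding theta_def .
      from has_sum_cmult_right[OF this, of "exp (k\<^sup>2 * of_real t)"]
      have "((\<lambda>z. g z t) has_sum (exp (k\<^sup>2 * of_real t) * (\<integral>x. theta t x * f x \<partial>lborel))) UNIV"
        using True by (simp add: g_def lam_def exp_of_real[symmetric] exp_add[symmetric] mult.assoc[symmetric] algebra_simps)
      then have "(\<Sum>\<^sub>\<infinity>z. g z t) = exp (k\<^sup>2 * of_real t) * (\<integral>x. theta t x * f x \<partial>lborel)" by (rule infsumI)
      also have "\<dots> = (\<integral>x. \<Phi> t x \<partial>lborel)" using True by (simp add: \<Phi>_def mult.assoc)
      finally show ?thesis .
    qed (simp add: g_def \<Phi>_def)
  qed
  also have "\<dots> = (\<integral>x. sing_part x * f x \<partial>lborel)"
    using lborel_pair.Fubini_integral[OF int] unfolding eq by simp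
  finally have 1: "((\<lambda>z. integral\<^sup>L lborel (g z)) has_sum (\<integral>x. sing_part x * f x \<partial>lborel)) UNIV" .
  have "integral\<^sup>L lborel (g z) = (if lam z = 0 then 1 else (1 - exp (- lam z)) / lam z) / vol * fhat f z" for z
  proof -
    have "integral\<^sup>L lborel (g z) = (LINT t:{0<..1::real}|lborel. exp (- (lam z * of_real t))) / vol * fhat f z"
      unfolding g_def set_lebesgue_integral_def
      by (simp add: mult_scaleR_left[symmetric] scaleR_conv_of_real mult.assoc[symmetric] del: mult_scaleR_left)
    then show ?thesis by (simp only: set_lebesgue_integral_exp)
  qed
  with 1 show "((\<lambda>z. (if lam z = 0 then 1 else (1 - exp (- lam z)) / lam z) / vol * fhat f z)
        has_sum (\<integral>x. sing_part x * f x \<partial>lborel)) UNIV" by simp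
qed

text \<open>A difference, because up to the volume factor the series has the coefficients 1/(k^2 -
  |\<xi>|^2) = -1/\<lambda>.\<close>

definition green :: "real ^ 'n \<Rightarrow> complex" where "green x = smooth_part x - sing_part x"

text \<open>Off resonance -exp(-\<lambda>)/\<lambda> - (1 - exp(-\<lambda>))/\<lambda> =
  -1/\<lambda>; at a resonance 1 - 1 = 0. Domination by the weight is a condition met by indicators
  of compact sets as well as by Schwartz functions, so one statement gives both local integrability
  and the pairing.\<close>

lemma green_integral:
  assumes f [measurable]: "f \<in> borel_measurable borel" and le: "\<And>x. norm (f x) \<le> c * wt x"
  shows "integrable lborel (\<lambda>x. green x * f x)"
    and "(\<lambda>z. norm (fhat f z)) summable_on UNIV \<Longrightarrow>
      ((\<lambda>z. (if lam z = 0 then 0 else - 1 / (lam z * vol)) * fhat f z)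
        has_sum (\<integral>x. green x * f x \<partial>lborel)) UNIV"
proof -
  have fi: "integrable lborel f" by (rule integrable_le_wt[OF f le])
  note 1 = trig_series_integral[OF fi cof_summable, folded smooth_part_def]
  note 2 = sing_part_integral[OF f le]
  show "integrable lborel (\<lambda>x. green x * f x)"
    unfolding green_def left_diff_distrib by (rule Bochner_Integration.integrable_diff[OF 1(1) 2(1)])
  assume "(\<lambda>z. norm (fhat f z)) summable_on UNIV"
  from has_sum_diff[OF 1(2) 2(2)[OF this]]
  have "((\<lambda>z. cof z * fhat f z - (if lam z = 0 then 1 else (1 - exp (- lam z)) / lam z) / vol * fhat f z)
        has_sum (\<integral>x. green x * f x \<partial>lborel)) UNIV"
    unfolding green_def left_diff_distrib Bochner_Integration.integral_diff[OF 1(1) 2(1)] .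
  moreover have "cof z * fhat f z - (if lam z = 0 then 1 else (1 - exp (- lam z)) / lam z) / vol * fhat f z
      = (if lam z = 0 then 0 else - 1 / (lam z * vol)) * fhat f z" for z
    using vol_pos by (auto simp: cof_def field_simps)
  ultimately show "((\<lambda>z. (if lam z = 0 then 0 else - 1 / (lam z * vol)) * fhat f z)
        has_sum (\<integral>x. green x * f x \<partial>lborel)) UNIV" by simp
qed

end

section \<open>Decay of Fourier transforms of Schwartz functions\<close>

text \<open>Since 1 + (x $ i)^2 \<le> (1 + |x|)^2 in each coordinate, the Schwartz seminorm with the
  exponent \<open>2 * CARD('n)\<close> forces decay like that of the weight.\<close>

lemma one_plus_power_le_wt: "1 \<le> (1 + norm x) ^ (2 * CARD('n)) * wt (x :: real ^ 'n)"
proof -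
  have le: "1 + (x $ i)\<^sup>2 \<le> (1 + norm x)\<^sup>2" for i
  proof -
    have "(x $ i)\<^sup>2 \<le> (norm x)\<^sup>2" using component_le_norm_cart[of x i] by (simp add: abs_le_square_iff[symmetric])
    then show ?thesis using norm_ge_zero[of x] unfolding power2_sum one_power2 by linarith
  qed
  have "(\<Prod>i\<in>(UNIV::'n set). 1 + (x $ i)\<^sup>2) \<le> (\<Prod>i\<in>(UNIV::'n set). (1 + norm x)\<^sup>2)"
    by (intro prod_mono conjI le) (simp add: less_imp_le one_plus_sq_pos)
  also have "\<dots> = (1 + norm x) ^ (2 * CARD('n))" by (simp add: power_mult)
  finally have "(\<Prod>i\<in>(UNIV::'n set). 1 + (x $ i)\<^sup>2) * wt x \<le> (1 + norm x) ^ (2 * CARD('n)) * wt x"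
    by (rule mult_right_mono) (simp add: less_imp_le wt_pos)
  also have "(\<Prod>i\<in>(UNIV::'n set). 1 + (x $ i)\<^sup>2) * wt x = 1"
    unfolding wt_def prod.distrib[symmetric] using one_plus_sq_pos by (simp add: less_imp_neq[THEN not_sym])
  finally show ?thesis .
qed

lemma schwartz_partials:
  fixes \<phi> :: "real ^ 'n \<Rightarrow> complex"
  assumes "\<phi> \<in> schwartz"
  shows "iter_partial is \<phi> differentiable (at x)" and "continuous_on UNIV (iter_partial is \<phi>)"
    and "\<exists>C\<ge>0. \<forall>x. norm (iter_partial is \<phi> x) \<le> C * wt x"
    and "integrable lborel (iter_partial is \<phi>)"
proof -
  have "C_k_on (Suc (length is)) UNIV \<phi>" using assms by (simp add: schwartz_def)
  then show "iter_partial is \<phi> differentiable (at x)" and c: "continuous_on UNIV (iter_partial is \<phi>)"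
    unfolding C_k_on_def by auto
  have "bounded (range (\<lambda>x. of_real ((1 + norm x) ^ (2 * CARD('n))) * iter_partial is \<phi> x))"
    using assms by (simp add: schwartz_def)
  then obtain C where "C > 0" and C: "norm (of_real ((1 + norm x) ^ (2 * CARD('n))) * iter_partial is \<phi> x) \<le> C" for x
    unfolding bounded_pos by auto
  have bound: "norm (iter_partial is \<phi> x) \<le> C * wt x" for x
  proof -
    have "norm (iter_partial is \<phi> x) * 1 \<le> norm (iter_partial is \<phi> x) * ((1 + norm x) ^ (2 * CARD('n)) * wt x)"
      by (intro mult_left_mono one_plus_power_le_wt) auto
    also have "\<dots> = norm (of_real ((1 + norm x) ^ (2 * CARD('n))) * iter_partial is \<phi> x) * wt x"
      unfolding norm_mult norm_of_real by (simp add: mult_ac)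
    also have "\<dots> \<le> C * wt x" by (intro mult_right_mono C) (simp add: less_imp_le wt_pos)
    finally show ?thesis by simp
  qed
  then show "\<exists>C\<ge>0. \<forall>x. norm (iter_partial is \<phi> x) \<le> C * wt x" using \<open>C > 0\<close> by (intro exI[of _ C]) auto
  show "integrable lborel (iter_partial is \<phi>)"
    by (rule integrable_le_wt[OF borel_measurable_continuous_onI[OF c] bound])
qed

text \<open>Integrate $\psi(x + e_i) - \psi(x)$, which has integral 0 by translation invariance.\<close>

lemma integral_partial_derivative:
  fixes \<psi> :: "real ^ 'n \<Rightarrow> complex"
  assumes diff: "\<And>x. (\<psi> has_derivative \<psi>' x) (at x)"
    and p: "\<And>x. p x = \<psi>' x (axis i 1)" and cp: "continuous_on UNIV p"
    and int: "integrable lborel \<psi>" "integrable lborel p"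
  shows "integral\<^sup>L lborel p = 0"
proof -
  define e :: "real ^ 'n" where "e = axis i 1"
  have [measurable]: "p \<in> borel_measurable borel" using cp by (rule borel_measurable_continuous_onI)
  have shift: "integrable lborel (\<lambda>x. u (x + a))" "(\<integral>x. u (x + a) \<partial>lborel) = integral\<^sup>L lborel u"
    if "integrable lborel u" for u :: "real ^ 'n \<Rightarrow> complex" and a
  proof -
    have [measurable]: "u \<in> borel_measurable borel" using that by auto
    have "integrable (distr lborel borel ((+) a)) u" using that by (simp add: lborel_distr_plus)
    then show "integrable lborel (\<lambda>x. u (x + a))" by (subst (asm) integrable_distr_eq) (auto simp: add.commute)
    have "integral\<^sup>L (distr lborel borel ((+) a)) u = (\<integral>x. u (a + x) \<partial>lborel)" by (rule integral_distr) auto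
    then show "(\<integral>x. u (x + a) \<partial>lborel) = integral\<^sup>L lborel u" by (simp add: lborel_distr_plus add.commute)
  qed
  define \<Phi> where "\<Phi> s x = indicator {0..1::real} s *\<^sub>R p (x + s *\<^sub>R e)" for s x
  have m [measurable]: "case_prod \<Phi> \<in> borel_measurable (lborel \<Otimes>\<^sub>M lborel)"
    unfolding \<Phi>_def by measurable
  have i1: "integrable lborel (\<lambda>x. \<Phi> s x)" for s unfolding \<Phi>_def by (intro integrable_scaleR_right shift int)
  \<comment> \<open>\<open>shift\<close> concerns complex functions, so the norm is embedded into
    the complex numbers first.\<close>
  have nrm: "integrable lborel (\<lambda>x. complex_of_real (norm (p x)))" using int(2) by (simp add: integrable_of_real)
  have n1: "(\<integral>x. norm (\<Phi> s x) \<partial>lborel) = indicator {0..1} s * (\<integral>x. norm (p x) \<partial>lborel)" for s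
    using shift(2)[OF nrm, of "s *\<^sub>R e"] by (simp add: \<Phi>_def of_real_eq_iff flip: integral_of_real)
  have int\<Phi>: "integrable (lborel \<Otimes>\<^sub>M lborel) (case_prod \<Phi>)"
  proof (rule lborel_pair.Fubini_integrable[OF m])
    show "integrable lborel (\<lambda>s. \<integral>x. norm (case_prod \<Phi> (s, x)) \<partial>lborel)" by (simp add: n1)
    show "AE s in lborel. integrable lborel (\<lambda>x. case_prod \<Phi> (s, x))" using i1 by simp
  qed
  have ftc: "(\<integral>s. \<Phi> s x \<partial>lborel) = \<psi> (x + e) - \<psi> x" for x
  proof -
    have cc: "continuous_on {0..1} (\<lambda>s. p (x + s *\<^sub>R e))"
      by (intro continuous_on_compose2[OF cp] continuous_intros) auto
    have "(\<integral>s. \<Phi> s x \<partial>lborel) = integral {0..1} (\<lambda>s. p (x + s *\<^sub>R e))"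
      unfolding \<Phi>_def set_lebesgue_integral_def[symmetric]
      by (intro set_borel_integral_eq_integral borel_integrable_atLeastAtMost' cc)
    moreover have "((\<lambda>s. p (x + s *\<^sub>R e)) has_integral (\<psi> (x + 1 *\<^sub>R e) - \<psi> (x + 0 *\<^sub>R e))) {0..1}"
    proof (rule fundamental_theorem_of_calculus)
      fix s :: real
      have "((\<lambda>s. x + s *\<^sub>R e) has_derivative (\<lambda>h. h *\<^sub>R e)) (at s within {0..1})"
        by (auto intro!: derivative_eq_intros)
      from has_derivative_compose[OF this diff]
      have "((\<lambda>s. \<psi> (x + s *\<^sub>R e)) has_derivative (\<lambda>h. \<psi>' (x + s *\<^sub>R e) (h *\<^sub>R e))) (at s within {0..1})" .
      moreover have "\<psi>' y (h *\<^sub>R e) = h *\<^sub>R p y" for y h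
        using linear_cmul[OF has_derivative_linear[OF diff]] by (simp add: p e_def)
      ultimately show "((\<lambda>s. \<psi> (x + s *\<^sub>R e)) has_vector_derivative p (x + s *\<^sub>R e)) (at s within {0..1})"
        by (simp add: has_vector_derivative_def)
    qed simp
    ultimately show ?thesis by (simp add: integral_unique)
  qed
  have "0 = (\<integral>x. \<psi> (x + e) - \<psi> x \<partial>lborel)"
    using shift[OF int(1), of e] int(1) by simp
  also have "\<dots> = (\<integral>x. (\<integral>s. \<Phi> s x \<partial>lborel) \<partial>lborel)" by (simp only: ftc)
  also have "\<dots> = (\<integral>s. (\<integral>x. \<Phi> s x \<partial>lborel) \<partial>lborel)" by (rule lborel_pair.Fubini_integral[OF int\<Phi>])
  also have "\<dots> = (\<integral>s. indicator {0..1::real} s *\<^sub>R integral\<^sup>L lborel p \<partial>lborel)"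
    unfolding \<Phi>_def using shift(2)[OF int(2)] by simp
  also have "\<dots> = integral\<^sup>L lborel p" by simp
  finally show ?thesis by simp
qed

definition ft :: "(real ^ 'n \<Rightarrow> complex) \<Rightarrow> real ^ 'n \<Rightarrow> complex" where
  "ft f \<xi> = (\<integral>x. cis (x \<bullet> \<xi>) * f x \<partial>lborel)"

lemma integrable_cis_mult: "integrable lborel f \<Longrightarrow> integrable lborel (\<lambda>x. cis (x \<bullet> \<xi>) * f x)"
  by (rule Bochner_Integration.integrable_bound[of _ f]) (auto simp: norm_mult cis_conv_exp)

text \<open>Integration by parts: the partial derivative of
  \<open>cis (x \<bullet> \<xi>) * f x\<close> has integral 0 by
  \<open>integral_partial_derivative\<close>.\<close>

lemma ft_partial:
  assumes "\<phi> \<in> schwartz"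
  shows "ft (iter_partial (i # is) \<phi>) \<xi> = - (\<i> * of_real (\<xi> $ i)) * ft (iter_partial is \<phi>) \<xi>"
proof -
  define f where "f = iter_partial is \<phi>"
  define f' where "f' x = frechet_derivative f (at x)" for x
  have d: "(f has_derivative f' x) (at x)" for x
    using schwartz_partials(1)[OF assms, of "is" x] by (simp add: f_def f'_def frechet_derivative_works)
  define g where "g = iter_partial (i # is) \<phi>"
  have g: "g x = f' x (axis i 1)" for x by (simp add: g_def f'_def f_def)
  have int: "integrable lborel f" "integrable lborel g" and cont: "continuous_on UNIV f" "continuous_on UNIV g"
    unfolding f_def g_def by (rule schwartz_partials[OF assms])+
  define \<psi> where "\<psi> x = cis (x \<bullet> \<xi>) * f x" for x
  define p where "p x = cis (x \<bullet> \<xi>) * g x + (\<i> * of_real (\<xi> $ i)) * (cis (x \<bullet> \<xi>) * f x)" for x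
  have "integral\<^sup>L lborel p = 0"
  proof (rule integral_partial_derivative)
    show "(\<psi> has_derivative (\<lambda>h. cis (x \<bullet> \<xi>) * f' x h + (\<i> * of_real (h \<bullet> \<xi>) * cis (x \<bullet> \<xi>)) * f x)) (at x)" for x
    proof -
      have "((\<lambda>x. cis (x \<bullet> \<xi>)) has_derivative (\<lambda>h. \<i> * of_real (h \<bullet> \<xi>) * cis (x \<bullet> \<xi>))) (at x)"
      proof -
        have "bounded_linear (\<lambda>h. \<i> * of_real (h \<bullet> \<xi>))"
          by (intro bounded_linear_const_mult bounded_linear_compose[OF bounded_linear_of_real] bounded_linear_inner_left)
        from has_derivative_compose[OF bounded_linear_imp_has_derivative[OF this] DERIV_exp[unfolded has_field_derivative_def]]
        show ?thesis by (simp add: cis_conv_exp mult.commute)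
      qed
      from has_derivative_mult[OF this d] show ?thesis by (simp add: \<psi>_def[abs_def])
    qed
    show "p x = cis (x \<bullet> \<xi>) * f' x (axis i 1) + (\<i> * of_real (axis i 1 \<bullet> \<xi>) * cis (x \<bullet> \<xi>)) * f x" for x
      by (simp add: p_def g inner_axis' mult.assoc)
    show "continuous_on UNIV p" unfolding p_def cis_conv_exp by (intro continuous_intros cont)
    show "integrable lborel \<psi>" unfolding \<psi>_def by (intro integrable_cis_mult int)
    show "integrable lborel p" unfolding p_def
      by (intro Bochner_Integration.integrable_add integrable_mult_right integrable_cis_mult int)
  qed
  also have "integral\<^sup>L lborel p = ft g \<xi> + (\<i> * of_real (\<xi> $ i)) * ft f \<xi>"
    unfolding p_def ft_def
    by (subst Bochner_Integration.integral_add) (auto intro!: integrable_mult_right integrable_cis_mult int)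
  finally show ?thesis by (simp add: f_def g_def eq_neg_iff_add_eq_0)
qed

lemma ft_partial_replicate:
  assumes "\<phi> \<in> schwartz"
  shows "ft (iter_partial (replicate m i) \<phi>) \<xi> = (- (\<i> * of_real (\<xi> $ i))) ^ m * ft \<phi> \<xi>"
proof (induction m)
  case (Suc m)
  have "ft (iter_partial (replicate (Suc m) i) \<phi>) \<xi> = - (\<i> * of_real (\<xi> $ i)) * ft (iter_partial (replicate m i) \<phi>) \<xi>"
    unfolding replicate_Suc by (rule ft_partial[OF assms])
  then show ?case unfolding Suc.IH by (simp add: mult.assoc)
qed simp

lemma norm_ft_le: "norm (ft f \<xi>) \<le> (\<integral>x. norm (f x) \<partial>lborel)"
  unfolding ft_def by (rule order.trans[OF integral_norm_bound]) (simp add: norm_mult)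

text \<open>Let a be the largest (\<xi> $ j)^2, attained at the coordinate i. Taking
  \<open>2 * N\<close> derivatives in that direction bounds the transform times a^N, and 1/wt is at
  most (1 + a)^N \<le> 2^N (1 + a^N).\<close>

lemma ft_decay:
  fixes \<phi> :: "real ^ 'n \<Rightarrow> complex"
  assumes "\<phi> \<in> schwartz"
  obtains C where "\<And>\<xi>. norm (ft \<phi> \<xi>) \<le> C * wt \<xi>"
proof -
  define N where "N = CARD('n)"
  define A where "A i = (\<integral>x. norm (iter_partial (replicate (2 * N) i) \<phi> x) \<partial>lborel)" for i
  define A0 where "A0 = (\<integral>x. norm (\<phi> x) \<partial>lborel)"
  define C where "C = 2 ^ N * (A0 + (\<Sum>i\<in>UNIV. A i))"
  have nn: "A i \<ge> 0" for i unfolding A_def by (intro Bochner_Integration.integral_nonneg) auto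
  have "norm (ft \<phi> \<xi>) \<le> C * wt \<xi>" for \<xi>
  proof -
    \<comment> \<open>The direction \<open>i\<close> depends on \<xi>; the constant does not, as it
      sums the \<open>A i\<close> over all directions.\<close>
    obtain i where i: "\<And>j. \<bar>\<xi> $ j\<bar> \<le> \<bar>\<xi> $ i\<bar>"
    proof -
      have "finite (range (\<lambda>j. \<bar>\<xi> $ j\<bar>))" by simp
      then obtain i where "\<bar>\<xi> $ i\<bar> = Max (range (\<lambda>j. \<bar>\<xi> $ j\<bar>))" by (metis (no_types, lifting) Max_in UNIV_I empty_iff image_iff)
      then show ?thesis using that by (metis Max_ge \<open>finite (range (\<lambda>j. \<bar>\<xi> $ j\<bar>))\<close> rangeI)
    qed
    define a where "a = (\<xi> $ i)\<^sup>2"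
    have a: "a \<ge> 0" by (simp add: a_def)
    have F: "norm (ft \<phi> \<xi>) * a ^ N \<le> A i"
    proof -
      have "norm (ft \<phi> \<xi>) * a ^ N = norm (ft (iter_partial (replicate (2 * N) i) \<phi>) \<xi>)"
        unfolding ft_partial_replicate[OF assms] by (simp add: norm_mult norm_power a_def power_mult[symmetric] mult.commute power_even_abs)
      then show ?thesis unfolding A_def using norm_ft_le by metis
    qed
    have "(\<Prod>j\<in>UNIV. 1 + (\<xi> $ j)\<^sup>2) \<le> (\<Prod>j\<in>(UNIV::'n set). 1 + a)"
      unfolding a_def using i by (intro prod_mono conjI) (auto simp: abs_le_square_iff[symmetric])
    also have "\<dots> = (1 + a) ^ N" by (simp add: N_def)
    also have "\<dots> \<le> 2 ^ N * (1 + a ^ N)"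
    proof (cases "a \<le> 1")
      case True
      then have "(1 + a) ^ N \<le> 2 ^ N" using a by (intro power_mono) auto
      also have "\<dots> * 1 \<le> 2 ^ N * (1 + a ^ N)" using a by (intro mult_left_mono) auto
      finally show ?thesis by simp
    next
      case False
      then have "(1 + a) ^ N \<le> (2 * a) ^ N" using a by (intro power_mono) auto
      also have "\<dots> \<le> 2 ^ N * (1 + a ^ N)" by (simp add: power_mult_distrib)
      finally show ?thesis .
    qed
    finally have P: "(\<Prod>j\<in>UNIV. 1 + (\<xi> $ j)\<^sup>2) \<le> 2 ^ N * (1 + a ^ N)" .
    have "(\<Prod>j\<in>UNIV. 1 + (\<xi> $ j)\<^sup>2) * wt \<xi> = 1"
      unfolding wt_def prod.distrib[symmetric] using one_plus_sq_pos by (simp add: less_imp_neq[THEN not_sym])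
    then have "norm (ft \<phi> \<xi>) = norm (ft \<phi> \<xi>) * ((\<Prod>j\<in>UNIV. 1 + (\<xi> $ j)\<^sup>2) * wt \<xi>)" by simp
    also have "\<dots> \<le> norm (ft \<phi> \<xi>) * ((2 ^ N * (1 + a ^ N)) * wt \<xi>)"
      using P less_imp_le[OF wt_pos[of \<xi>]] by (intro mult_left_mono mult_right_mono) auto
    also have "\<dots> = 2 ^ N * (norm (ft \<phi> \<xi>) + norm (ft \<phi> \<xi>) * a ^ N) * wt \<xi>"
      by (simp add: algebra_simps)
    also have "\<dots> \<le> 2 ^ N * (A0 + (\<Sum>i\<in>UNIV. A i)) * wt \<xi>"
    proof (intro mult_right_mono mult_left_mono add_mono)
      show "norm (ft \<phi> \<xi>) \<le> A0" unfolding A0_def by (rule norm_ft_le)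
      show "norm (ft \<phi> \<xi>) * a ^ N \<le> (\<Sum>i\<in>UNIV. A i)"
        using F member_le_sum[of i UNIV A] nn by auto
    qed (auto simp: less_imp_le wt_pos)
    finally show ?thesis unfolding C_def .
  qed
  then show ?thesis using that by blast
qed

section \<open>Analyticity of the Green function off the lattice\<close>

definition mdeg :: "('n::finite \<Rightarrow> nat) \<Rightarrow> nat" where "mdeg \<beta> = (\<Sum>i\<in>UNIV. \<beta> i)"

definition mpow :: "('n::finite \<Rightarrow> nat) \<Rightarrow> real ^ 'n \<Rightarrow> real" where "mpow \<beta> z = (\<Prod>i\<in>UNIV. (z $ i) ^ \<beta> i)"

lemma abs_mpow_le:
  assumes "\<And>i. \<bar>z $ i\<bar> \<le> r" shows "\<bar>mpow \<beta> z\<bar> \<le> r ^ mdeg \<beta>"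
proof -
  have "\<bar>mpow \<beta> z\<bar> = (\<Prod>i\<in>UNIV. \<bar>z $ i\<bar> ^ \<beta> i)" by (simp add: mpow_def abs_prod power_abs)
  also have "\<dots> \<le> (\<Prod>i\<in>UNIV. r ^ \<beta> i)" by (intro prod_mono conjI power_mono assms) auto
  also have "\<dots> = r ^ mdeg \<beta>" by (simp add: mdeg_def power_sum)
  finally show ?thesis .
qed

lemma abs_component_less_ball: "x \<in> ball x0 r \<Longrightarrow> \<bar>(x - x0) $ i\<bar> \<le> r" for x x0 :: "real ^ 'n"
  using component_le_norm_cart[of "x - x0" i] by (simp add: dist_norm norm_minus_commute)

text \<open>Integrating over the parameter keeps the radius, since the integrated majorant dominates
  the series of the integrals. Summability and a bound for the new coefficients are part of the
  result because it is fed into a further summation.\<close>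

lemma analytic_integral:
  fixes a :: "'w \<Rightarrow> ('n::finite \<Rightarrow> nat) \<Rightarrow> complex" and x0 :: "real ^ 'n"
  assumes N: "sigma_finite_measure N"
    and meas: "\<And>\<beta>. (\<lambda>\<omega>. a \<omega> \<beta>) \<in> borel_measurable N"
    and exp: "\<And>\<omega> x. \<omega> \<in> space N \<Longrightarrow> x \<in> ball x0 r \<Longrightarrow> ((\<lambda>\<beta>. a \<omega> \<beta> * of_real (mpow \<beta> (x - x0))) has_sum f \<omega> x) UNIV"
    and sum: "\<And>\<omega>. \<omega> \<in> space N \<Longrightarrow> (\<lambda>\<beta>. norm (a \<omega> \<beta>) * r ^ mdeg \<beta>) summable_on UNIV"
    and le: "\<And>\<omega>. \<omega> \<in> space N \<Longrightarrow> (\<Sum>\<^sub>\<infinity>\<beta>. norm (a \<omega> \<beta>) * r ^ mdeg \<beta>) \<le> B \<omega>"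
    and B: "integrable N B" and r: "r > 0"
  shows "x \<in> ball x0 r \<Longrightarrow> ((\<lambda>\<beta>. (\<integral>\<omega>. a \<omega> \<beta> \<partial>N) * of_real (mpow \<beta> (x - x0))) has_sum (\<integral>\<omega>. f \<omega> x \<partial>N)) UNIV"
    and "(\<lambda>\<beta>. norm (\<integral>\<omega>. a \<omega> \<beta> \<partial>N) * r ^ mdeg \<beta>) summable_on UNIV"
    and "(\<Sum>\<^sub>\<infinity>\<beta>. norm (\<integral>\<omega>. a \<omega> \<beta> \<partial>N) * r ^ mdeg \<beta>) \<le> integral\<^sup>L N B"
proof -
  have nn: "norm (a \<omega> \<beta> * of_real (mpow \<beta> (x - x0))) \<le> norm (a \<omega> \<beta>) * r ^ mdeg \<beta>" if "x \<in> ball x0 r" for \<omega> \<beta> x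
    using abs_mpow_le[of "x - x0" r \<beta>] abs_component_less_ball[OF that]
    by (simp add: norm_mult mult_left_mono)
  {
    fix x assume x: "x \<in> ball x0 r"
    have s: "(\<lambda>\<beta>. norm (a \<omega> \<beta> * of_real (mpow \<beta> (x - x0)))) summable_on UNIV" if "\<omega> \<in> space N" for \<omega>
      by (rule summable_on_comparison_test[OF sum[OF that]]) (use nn[OF x] in auto)
    have "((\<lambda>\<beta>. \<integral>\<omega>. a \<omega> \<beta> * of_real (mpow \<beta> (x - x0)) \<partial>N) has_sum
      (\<integral>\<omega>. (\<Sum>\<^sub>\<infinity>\<beta>. a \<omega> \<beta> * of_real (mpow \<beta> (x - x0))) \<partial>N)) UNIV"
      by (rule integral_has_sum_dominated(4)[OF N _ s _ B])
        (use meas le in \<open>auto intro!: order.trans[OF infsum_mono[OF s sum nn[OF x]]]\<close>)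
    also have "(\<integral>\<omega>. (\<Sum>\<^sub>\<infinity>\<beta>. a \<omega> \<beta> * of_real (mpow \<beta> (x - x0))) \<partial>N) = (\<integral>\<omega>. f \<omega> x \<partial>N)"
      by (intro Bochner_Integration.integral_cong infsumI exp x refl)
    finally show "((\<lambda>\<beta>. (\<integral>\<omega>. a \<omega> \<beta> \<partial>N) * of_real (mpow \<beta> (x - x0))) has_sum (\<integral>\<omega>. f \<omega> x \<partial>N)) UNIV"
      by simp
  }
  \<comment> \<open>The majorants are written as complex numbers to reuse the exchange of sum and
    integral.\<close>
  have mb: "(\<lambda>\<omega>. complex_of_real (norm (a \<omega> \<beta>) * r ^ mdeg \<beta>)) \<in> borel_measurable N" for \<beta>
    using meas[of \<beta>] by measurable
  have n: "norm (complex_of_real (norm (a \<omega> \<beta>) * r ^ mdeg \<beta>)) = norm (a \<omega> \<beta>) * r ^ mdeg \<beta>" for \<omega> \<beta>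
    using r by (simp add: norm_mult norm_power)
  note D = integral_has_sum_dominated[OF N mb, unfolded n, OF sum le B]
  have i: "integrable N (\<lambda>\<omega>. norm (a \<omega> \<beta>) * r ^ mdeg \<beta>)" for \<beta>
  proof -
    have "integrable N (\<lambda>\<omega>. norm (complex_of_real (norm (a \<omega> \<beta>) * r ^ mdeg \<beta>)))" by (rule integrable_norm[OF D(2)])
    then show ?thesis unfolding n .
  qed
  have D4: "((\<lambda>\<beta>. \<integral>\<omega>. norm (a \<omega> \<beta>) * r ^ mdeg \<beta> \<partial>N) has_sum Re (\<integral>\<omega>. (\<Sum>\<^sub>\<infinity>\<beta>. complex_of_real (norm (a \<omega> \<beta>) * r ^ mdeg \<beta>)) \<partial>N)) UNIV"
    using has_sum_Re[OF D(4)] unfolding integral_of_real[symmetric] integral_complex_of_real Re_complex_of_real .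
  have le1: "norm (\<integral>\<omega>. a \<omega> \<beta> \<partial>N) * r ^ mdeg \<beta> \<le> (\<integral>\<omega>. norm (a \<omega> \<beta>) * r ^ mdeg \<beta> \<partial>N)" for \<beta>
    using mult_right_mono[OF integral_norm_bound[of N "\<lambda>\<omega>. a \<omega> \<beta>"], of "r ^ mdeg \<beta>"] r by simp
  show S: "(\<lambda>\<beta>. norm (\<integral>\<omega>. a \<omega> \<beta> \<partial>N) * r ^ mdeg \<beta>) summable_on UNIV"
    by (rule summable_on_comparison_test[OF has_sum_imp_summable[OF D4] le1]) (use r in auto)
  have "(\<Sum>\<^sub>\<infinity>\<beta>. norm (\<integral>\<omega>. a \<omega> \<beta> \<partial>N) * r ^ mdeg \<beta>) \<le> (\<Sum>\<^sub>\<infinity>\<beta>. \<integral>\<omega>. norm (a \<omega> \<beta>) * r ^ mdeg \<beta> \<partial>N)"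
    by (rule infsum_mono[OF S has_sum_imp_summable[OF D4] le1])
  also have "\<dots> = Re (\<integral>\<omega>. (\<Sum>\<^sub>\<infinity>\<beta>. complex_of_real (norm (a \<omega> \<beta>) * r ^ mdeg \<beta>)) \<partial>N)" by (rule infsumI[OF D4])
  also have "\<dots> \<le> norm (\<integral>\<omega>. (\<Sum>\<^sub>\<infinity>\<beta>. complex_of_real (norm (a \<omega> \<beta>) * r ^ mdeg \<beta>)) \<partial>N)" by (rule complex_Re_le_cmod)
  also have "\<dots> \<le> (\<integral>\<omega>. norm (\<Sum>\<^sub>\<infinity>\<beta>. complex_of_real (norm (a \<omega> \<beta>) * r ^ mdeg \<beta>)) \<partial>N)" by (rule integral_norm_bound)
  also have "\<dots> \<le> integral\<^sup>L N B"
  proof (rule integral_mono[OF integrable_norm[OF D(1)] B])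
    fix \<omega> assume w: "\<omega> \<in> space N"
    have "norm (\<Sum>\<^sub>\<infinity>\<beta>. complex_of_real (norm (a \<omega> \<beta>) * r ^ mdeg \<beta>)) \<le> (\<Sum>\<^sub>\<infinity>\<beta>. norm (complex_of_real (norm (a \<omega> \<beta>) * r ^ mdeg \<beta>)))"
      by (rule norm_infsum_bound) (use sum[OF w] n in simp)
    then show "norm (\<Sum>\<^sub>\<infinity>\<beta>. complex_of_real (norm (a \<omega> \<beta>) * r ^ mdeg \<beta>)) \<le> B \<omega>" using le[OF w] unfolding n by linarith
  qed
  finally show "(\<Sum>\<^sub>\<infinity>\<beta>. norm (\<integral>\<omega>. a \<omega> \<beta> \<partial>N) * r ^ mdeg \<beta>) \<le> integral\<^sup>L N B" .
qed

text \<open>\<open>analytic_integral\<close> for counting measure.\<close>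

lemma analytic_infsum:
  fixes a :: "'w::countable \<Rightarrow> ('n::finite \<Rightarrow> nat) \<Rightarrow> complex" and x0 :: "real ^ 'n"
  assumes exp: "\<And>\<omega> x. x \<in> ball x0 r \<Longrightarrow> ((\<lambda>\<beta>. a \<omega> \<beta> * of_real (mpow \<beta> (x - x0))) has_sum f \<omega> x) UNIV"
    and sum: "\<And>\<omega>. (\<lambda>\<beta>. norm (a \<omega> \<beta>) * r ^ mdeg \<beta>) summable_on UNIV"
    and le: "\<And>\<omega>. (\<Sum>\<^sub>\<infinity>\<beta>. norm (a \<omega> \<beta>) * r ^ mdeg \<beta>) \<le> B \<omega>"
    and B: "B summable_on UNIV" and r: "r > 0"
  shows "x \<in> ball x0 r \<Longrightarrow> ((\<lambda>\<beta>. (\<Sum>\<^sub>\<infinity>\<omega>. a \<omega> \<beta>) * of_real (mpow \<beta> (x - x0))) has_sum (\<Sum>\<^sub>\<infinity>\<omega>. f \<omega> x)) UNIV"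
proof -
  have "0 \<le> B \<omega>" for \<omega> by (rule order.trans[OF infsum_nonneg le]) (use r in auto)
  then have "(\<lambda>\<omega>. norm (complex_of_real (B \<omega>))) summable_on UNIV" using B by simp
  then have "integrable (count_space UNIV) (\<lambda>\<omega>. complex_of_real (B \<omega>))" by (simp only: infsum_complex_conv)
  then have "integrable (count_space UNIV) B" using integrable_Re[of "count_space UNIV" "\<lambda>\<omega>. complex_of_real (B \<omega>)"] by simp
  from analytic_integral(1)[OF sigma_finite_measure_count_space _ exp sum le this r]
  show "x \<in> ball x0 r \<Longrightarrow> ((\<lambda>\<beta>. (\<Sum>\<^sub>\<infinity>\<omega>. a \<omega> \<beta>) * of_real (mpow \<beta> (x - x0))) has_sum (\<Sum>\<^sub>\<infinity>\<omega>. f \<omega> x)) UNIV"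
    by (simp add: infsum_complex_conv)
qed

text \<open>Exponentials and Gaussians are products of functions of one variable, so this leaves
  only one-variable expansions to find; \<open>r ^ mdeg \<beta>\<close> splits over the coordinates
  like the coefficients.\<close>

lemma product_power_series:
  fixes g :: "'n::finite \<Rightarrow> nat \<Rightarrow> complex"
  assumes r: "r > 0"
    and s: "\<And>i. (\<lambda>j. norm (g i j) * r ^ j) summable_on UNIV"
    and le: "\<And>i. (\<Sum>\<^sub>\<infinity>j. norm (g i j) * r ^ j) \<le> B i"
    and hs: "\<And>i z. \<bar>z\<bar> \<le> r \<Longrightarrow> ((\<lambda>j. g i j * of_real (z ^ j)) has_sum F i z) UNIV"
  shows "(\<lambda>\<beta>. norm (\<Prod>i\<in>UNIV. g i (\<beta> i)) * r ^ mdeg \<beta>) summable_on UNIV"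
    and "(\<Sum>\<^sub>\<infinity>\<beta>. norm (\<Prod>i\<in>UNIV. g i (\<beta> i)) * r ^ mdeg \<beta>) \<le> (\<Prod>i\<in>UNIV. B i)"
    and "(\<And>i. \<bar>z $ i\<bar> \<le> r) \<Longrightarrow> ((\<lambda>\<beta>. (\<Prod>i\<in>UNIV. g i (\<beta> i)) * of_real (mpow \<beta> z)) has_sum (\<Prod>i\<in>UNIV. F i (z $ i))) UNIV"
proof -
  have eq: "norm (\<Prod>i\<in>UNIV. g i (\<beta> i)) * r ^ mdeg \<beta> = (\<Prod>i\<in>UNIV. norm (g i (\<beta> i)) * r ^ \<beta> i)" for \<beta>
    by (simp add: prod.distrib prod_norm mdeg_def power_sum)
  have s': "(\<lambda>j. norm (norm (g i j) * r ^ j)) summable_on UNIV" for i using s r by simp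
  note P = abs_summable_prod_fun[of "\<lambda>i j. norm (g i j) * r ^ j", OF s']
  show "(\<lambda>\<beta>. norm (\<Prod>i\<in>UNIV. g i (\<beta> i)) * r ^ mdeg \<beta>) summable_on UNIV"
    unfolding eq by (rule has_sum_imp_summable[OF P(2)])
  show "(\<Sum>\<^sub>\<infinity>\<beta>. norm (\<Prod>i\<in>UNIV. g i (\<beta> i)) * r ^ mdeg \<beta>) \<le> (\<Prod>i\<in>UNIV. B i)"
    unfolding eq infsumI[OF P(2)] using r by (intro prod_mono conjI le infsum_nonneg) auto
  assume z: "\<And>i. \<bar>z $ i\<bar> \<le> r"
  have "(\<lambda>j. norm (g i j * of_real ((z $ i) ^ j))) summable_on UNIV" for i
    by (rule summable_on_comparison_test[OF s[of i]])
      (use z[of i] in \<open>auto simp: norm_mult norm_power intro!: mult_left_mono power_mono\<close>)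
  from abs_summable_prod_fun(2)[of "\<lambda>i j. g i j * of_real ((z $ i) ^ j)", OF this]
  show "((\<lambda>\<beta>. (\<Prod>i\<in>UNIV. g i (\<beta> i)) * of_real (mpow \<beta> z)) has_sum (\<Prod>i\<in>UNIV. F i (z $ i))) UNIV"
    unfolding infsumI[OF hs[OF z]] by (simp add: prod.distrib mpow_def)
qed

lemma has_sum_exp: "((\<lambda>j. b ^ j / fact j) has_sum exp b) UNIV" for b :: "'a::{real_normed_field, banach}"
proof -
  have "summable (\<lambda>j. norm (b ^ j /\<^sub>R fact j))" by (rule summable_norm_exp)
  from norm_summable_imp_has_sum[OF this exp_converges[of b]] show ?thesis
    by (simp add: scaleR_conv_of_real field_simps)
qed

text \<open>Taylor coefficients of exp(c z^2) at 0.\<close>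

definition sq_coeff :: "real \<Rightarrow> nat \<Rightarrow> real" where
  "sq_coeff c j = (if even j then c ^ (j div 2) / fact (j div 2) else 0)"

lemma has_sum_sq_coeff: "((\<lambda>j. sq_coeff c j * z ^ j) has_sum exp (c * z\<^sup>2)) UNIV"
proof -
  have inj: "inj_on (\<lambda>j::nat. 2 * j) UNIV" by (auto simp: inj_on_def)
  have "((\<lambda>j. (c * z\<^sup>2) ^ j / fact j) has_sum exp (c * z\<^sup>2)) UNIV" by (rule has_sum_exp)
  then have "((\<lambda>j. sq_coeff c j * z ^ j) has_sum exp (c * z\<^sup>2)) (range (\<lambda>j. 2 * j))"
    by (subst has_sum_reindex[OF inj]) (simp add: o_def sq_coeff_def power_mult_distrib power_mult)
  then show ?thesis
    by (subst has_sum_cong_neutral[where S = "range (\<lambda>j. 2 * j)", symmetric])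
      (auto simp: sq_coeff_def elim!: evenE)
qed

text \<open>Taylor coefficients of exp(b z + c z^2) at 0, as the Cauchy product of two exponential
  series.\<close>

definition quad_coeff :: "real \<Rightarrow> real \<Rightarrow> nat \<Rightarrow> real" where
  "quad_coeff b c j = (\<Sum>i\<le>j. b ^ i / fact i * sq_coeff c (j - i))"

text \<open>Replacing \<open>b\<close> and \<open>c\<close> by their absolute values makes all
  coefficients nonnegative and dominates the original ones, so the majorant series has the same
  closed form.\<close>

lemma quad_coeff_sums:
  shows "((\<lambda>j. quad_coeff b c j * z ^ j) has_sum exp (b * z + c * z\<^sup>2)) UNIV"
    and "(\<lambda>j. \<bar>quad_coeff b c j\<bar> * \<bar>z\<bar> ^ j) summable_on UNIV"
    and "(\<Sum>\<^sub>\<infinity>j. \<bar>quad_coeff b c j\<bar> * \<bar>z\<bar> ^ j) \<le> exp (\<bar>b\<bar> * \<bar>z\<bar> + \<bar>c\<bar> * z\<^sup>2)"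
proof -
  have abs_sq: "\<bar>sq_coeff c j\<bar> = sq_coeff \<bar>c\<bar> j" for c j by (simp add: sq_coeff_def power_abs)
  have abs_le: "\<bar>quad_coeff b c j\<bar> \<le> quad_coeff \<bar>b\<bar> \<bar>c\<bar> j" for j
    unfolding quad_coeff_def by (rule order.trans[OF sum_abs]) (simp add: abs_mult power_abs abs_sq)
  have Q: "(\<lambda>j. quad_coeff b c j * z ^ j) sums exp (b * z + c * z\<^sup>2)" for b c z
  proof -
    define u where "u j = b ^ j / fact j * z ^ j" for j
    define v where "v j = sq_coeff c j * z ^ j" for j
    have u: "u sums exp (b * z)" using has_sum_imp_sums[OF has_sum_exp[of "b * z"]] by (simp add: u_def[abs_def] power_mult_distrib)
    have v: "v sums exp (c * z\<^sup>2)" using has_sum_imp_sums[OF has_sum_sq_coeff[of c z]] by (simp add: v_def[abs_def])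
    have uv: "(\<Sum>i\<le>j. u i * v (j - i)) = quad_coeff b c j * z ^ j" for j
      unfolding u_def v_def quad_coeff_def sum_distrib_right
      by (intro sum.cong) (auto simp: power_add[symmetric] mult_ac)
    have su: "summable (\<lambda>j. norm (u j))"
      using sums_summable[OF has_sum_imp_sums[OF has_sum_exp[of "\<bar>b * z\<bar>"]]] by (simp add: u_def[abs_def] power_mult_distrib abs_mult power_abs)
    have sv: "summable (\<lambda>j. norm (v j))"
      using sums_summable[OF has_sum_imp_sums[OF has_sum_sq_coeff[of "\<bar>c\<bar>" "\<bar>z\<bar>"]]] by (simp add: v_def[abs_def] abs_mult power_abs abs_sq)
    from Cauchy_product_sums[OF su sv] show ?thesis
      using u v unfolding uv by (simp add: sums_iff exp_add)
  qed
  have nn: "quad_coeff \<bar>b\<bar> \<bar>c\<bar> j * \<bar>z\<bar> ^ j \<ge> 0" for j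
    using abs_le[of j] by (intro mult_nonneg_nonneg) auto
  have M: "((\<lambda>j. quad_coeff \<bar>b\<bar> \<bar>c\<bar> j * \<bar>z\<bar> ^ j) has_sum exp (\<bar>b\<bar> * \<bar>z\<bar> + \<bar>c\<bar> * z\<^sup>2)) UNIV"
    using norm_summable_imp_has_sum[OF _ Q[of "\<bar>b\<bar>" "\<bar>c\<bar>" "\<bar>z\<bar>"]] sums_summable[OF Q[of "\<bar>b\<bar>" "\<bar>c\<bar>" "\<bar>z\<bar>"]] nn by simp
  have le: "\<bar>quad_coeff b c j\<bar> * \<bar>z\<bar> ^ j \<le> quad_coeff \<bar>b\<bar> \<bar>c\<bar> j * \<bar>z\<bar> ^ j" for j
    by (rule mult_right_mono[OF abs_le]) simp
  show S: "(\<lambda>j. \<bar>quad_coeff b c j\<bar> * \<bar>z\<bar> ^ j) summable_on UNIV"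
    by (rule summable_on_comparison_test[OF has_sum_imp_summable[OF M] le]) simp
  show "(\<Sum>\<^sub>\<infinity>j. \<bar>quad_coeff b c j\<bar> * \<bar>z\<bar> ^ j) \<le> exp (\<bar>b\<bar> * \<bar>z\<bar> + \<bar>c\<bar> * z\<^sup>2)"
    using infsum_mono[OF S has_sum_imp_summable[OF M] le] infsumI[OF M] by simp
  show "((\<lambda>j. quad_coeff b c j * z ^ j) has_sum exp (b * z + c * z\<^sup>2)) UNIV"
  proof (rule norm_summable_imp_has_sum[OF _ Q])
    show "summable (\<lambda>j. norm (quad_coeff b c j * z ^ j))"
      using summable_on_imp_summable[OF S] by (simp add: abs_mult power_abs)
  qed
qed

context diagonal_lattice
begin

text \<open>The majorant of the expansion of the character with frequency \<open>fr z\<close> is the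
  product of the exp |fr z $ i|. By s \<le> 1/2 + s^2/2 it grows at most like exp(|fr z|^2/2), half
  of what the coefficient \<open>cof z\<close> decays. The radius 1 therefore works at every
  point.\<close>

lemma smooth_part_analytic:
  "\<exists>a. \<forall>x\<in>ball x0 1. ((\<lambda>\<beta>. a \<beta> * of_real (mpow \<beta> (x - x0))) has_sum smooth_part x) UNIV"
proof -
  define g where "g z i j = (\<i> * of_real (fr z $ i)) ^ j / fact j" for z i and j :: nat
  define a where "a z \<beta> = cof z * cis (x0 \<bullet> fr z) * (\<Prod>i\<in>UNIV. g z i (\<beta> i))" for z \<beta>
  obtain C where C: "C > 0" "\<And>z. norm (cof z) \<le> C * exp (- (norm (fr z))\<^sup>2)" using cof_bound by blast
  define B where "B z = C * exp (real CARD('n) / 2) * exp (- (1 / 2 * (norm (fr z))\<^sup>2))" for z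
  have ng: "norm (g z i j) * 1 ^ j = \<bar>fr z $ i\<bar> ^ j / fact j" for z i j
    by (simp add: g_def norm_divide norm_power norm_mult)
  have h: "((\<lambda>j. norm (g z i j) * 1 ^ j) has_sum exp \<bar>fr z $ i\<bar>) UNIV" for z i
    unfolding ng by (rule has_sum_exp)
  have hs: "((\<lambda>j. g z i j * of_real (t ^ j)) has_sum cis (t * fr z $ i)) UNIV" for z i t
    using has_sum_exp[of "\<i> * of_real (t * fr z $ i)"]
    by (simp add: g_def cis_conv_exp power_mult_distrib mult_ac)
  note P = product_power_series[of 1 "g z" "\<lambda>i. exp \<bar>fr z $ i\<bar>" "\<lambda>i t. cis (t * fr z $ i)" for z,
      OF zero_less_one has_sum_imp_summable[OF h] eq_refl[OF infsumI[OF h]] hs]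
  have "((\<lambda>\<beta>. (\<Sum>\<^sub>\<infinity>z. a z \<beta>) * of_real (mpow \<beta> (x - x0))) has_sum (\<Sum>\<^sub>\<infinity>z. cof z * cis (x \<bullet> fr z))) UNIV"
    if "x \<in> ball x0 1" for x
  proof (rule analytic_infsum[where B = B, OF _ _ _ _ zero_less_one that])
    fix z x assume x: "x \<in> ball x0 1"
    have "((\<lambda>\<beta>. (\<Prod>i\<in>UNIV. g z i (\<beta> i)) * of_real (mpow \<beta> (x - x0))) has_sum (\<Prod>i\<in>UNIV. cis ((x - x0) $ i * fr z $ i))) UNIV"
      by (rule P(3)) (rule abs_component_less_ball[OF x])
    from has_sum_cmult_right[OF this, of "cof z * cis (x0 \<bullet> fr z)"]
    have "((\<lambda>\<beta>. a z \<beta> * of_real (mpow \<beta> (x - x0))) has_sum (cof z * cis (x0 \<bullet> fr z) * (\<Prod>i\<in>UNIV. cis ((x - x0) $ i * fr z $ i)))) UNIV"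
      by (simp add: a_def mult.assoc)
    moreover have "cis (x0 \<bullet> fr z) * (\<Prod>i\<in>UNIV. cis ((x - x0) $ i * fr z $ i)) = cis (x \<bullet> fr z)"
      unfolding prod_cis cis_mult by (simp add: inner_vec_def sum.distrib[symmetric] algebra_simps)
    ultimately show "((\<lambda>\<beta>. a z \<beta> * of_real (mpow \<beta> (x - x0))) has_sum (cof z * cis (x \<bullet> fr z))) UNIV"
      by (simp add: mult.assoc)
  next
    fix z
    have na: "norm (a z \<beta>) * 1 ^ mdeg \<beta> = norm (cof z) * (norm (\<Prod>i\<in>UNIV. g z i (\<beta> i)) * 1 ^ mdeg \<beta>)" for \<beta>
      by (simp add: a_def norm_mult)
    show "(\<lambda>\<beta>. norm (a z \<beta>) * 1 ^ mdeg \<beta>) summable_on UNIV"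
      unfolding na by (intro summable_on_cmult_right P(1))
    have pr: "(\<Prod>i\<in>UNIV. exp \<bar>fr z $ i\<bar>) \<le> (\<Prod>i\<in>(UNIV::'n set). exp (1 / 2 + (fr z $ i)\<^sup>2 / 2))"
    proof (intro prod_mono conjI)
      fix i
      have "0 \<le> (\<bar>fr z $ i\<bar> - 1)\<^sup>2" by simp
      then show "exp \<bar>fr z $ i\<bar> \<le> exp (1 / 2 + (fr z $ i)\<^sup>2 / 2)"
        by (simp add: power2_diff)
    qed simp
    have eq: "(\<Prod>i\<in>(UNIV::'n set). exp (1 / 2 + (fr z $ i)\<^sup>2 / 2)) = exp (real CARD('n) / 2 + (norm (fr z))\<^sup>2 / 2)"
      unfolding norm_sq by (simp add: exp_sum[symmetric] sum.distrib sum_divide_distrib[symmetric])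
    have "(\<Sum>\<^sub>\<infinity>\<beta>. norm (a z \<beta>) * 1 ^ mdeg \<beta>) = norm (cof z) * (\<Sum>\<^sub>\<infinity>\<beta>. norm (\<Prod>i\<in>UNIV. g z i (\<beta> i)) * 1 ^ mdeg \<beta>)"
      unfolding na by (rule infsum_cmult_right')
    also have "\<dots> \<le> (C * exp (- (norm (fr z))\<^sup>2)) * exp (real CARD('n) / 2 + (norm (fr z))\<^sup>2 / 2)"
      using C by (intro mult_mono order.trans[OF P(2) pr[unfolded eq]] infsum_nonneg) (auto simp: less_imp_le)
    also have "\<dots> = B z"
    proof -
      have "exp (- (norm (fr z))\<^sup>2) * exp (real CARD('n) / 2 + (norm (fr z))\<^sup>2 / 2)
          = exp (real CARD('n) / 2) * exp (- (1 / 2 * (norm (fr z))\<^sup>2))"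
        unfolding exp_add[symmetric] by simp
      then show ?thesis by (simp add: B_def mult.assoc)
    qed
    finally show "(\<Sum>\<^sub>\<infinity>\<beta>. norm (a z \<beta>) * 1 ^ mdeg \<beta>) \<le> B z" .
  next
    show "B summable_on UNIV" unfolding B_def by (intro summable_on_cmult_right exp_fr_summable) simp
  qed
  then show ?thesis
    by (intro exI[of _ "\<lambda>\<beta>. \<Sum>\<^sub>\<infinity>z. a z \<beta>"] ballI) (simp add: smooth_part_def)
qed

end

section \<open>Expansion of the heat kernel away from the origin, uniformly in time\<close>

lemma power_div_fact_le_exp: "0 \<le> s \<Longrightarrow> s ^ n / fact n \<le> exp (s::real)"
  using finite_sum_le_has_sum[OF has_sum_exp[of s], of "{n}"] by simp

lemma sum_abs_component_le: "(\<Sum>i\<in>UNIV. \<bar>y $ i\<bar>) \<le> real CARD('n) * norm (y :: real ^ 'n)"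
  using sum_mono[of UNIV "\<lambda>i. \<bar>y $ i\<bar>" "\<lambda>_. norm y"] component_le_norm_cart[of y] by simp

lemma heat_eq: "t > 0 \<Longrightarrow> heat t y = exp (- ((norm y)\<^sup>2 / (4 * t))) / sqrt (4 * pi * t) ^ CARD('n)" for y :: "real ^ 'n"
  unfolding power2_norm_eq_inner inner_vec_def
  by (simp add: heat_def heat1_eq prod_dividef exp_sum[symmetric] sum_negf[symmetric] sum_divide_distrib power2_eq_square)

text \<open>The left side is the majorant of the Taylor series of the heat kernel at
  \<open>y\<close>. The radius is so small that expanding costs only half of the exponent
  |y|^2/(4t). Of the rest, exp(-\<delta>^2/(16t)) compensates the singular factor t^(-n), and
  exp(-|y|^2/16) remains for the summation over the lattice; the result does not depend on
  \<open>t\<close>.\<close>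

lemma heat_majorant:
  fixes y :: "real ^ 'n"
  assumes t: "0 < t" "t \<le> 1" and \<delta>: "0 < \<delta>" "\<delta> \<le> norm y" and r: "r = \<delta> / (6 * real CARD('n))"
  shows "heat t y * exp (\<Sum>i\<in>UNIV. \<bar>y $ i\<bar> / (2 * t) * r + 1 / (4 * t) * r\<^sup>2)
    \<le> fact CARD('n) / (\<delta>\<^sup>2 / 16) ^ CARD('n) * exp (- ((norm y)\<^sup>2 / 16))"
proof -
  define n where "n = CARD('n)"
  have n: "n \<ge> 1" unfolding n_def by (simp add: Suc_leI)
  have r0: "r > 0" using \<delta>(1) n by (simp add: r n_def)
  have nr: "real n * r = \<delta> / 6" using n by (simp add: r n_def)
  have rd: "r \<le> \<delta>" using n \<delta>(1) unfolding r n_def[symmetric] by (simp add: field_simps)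
  have "(\<Sum>i\<in>UNIV. \<bar>y $ i\<bar> / (2 * t) * r + 1 / (4 * t) * r\<^sup>2) = (\<Sum>i\<in>UNIV. \<bar>y $ i\<bar>) * (r / (2 * t)) + real n * (1 / (4 * t) * r\<^sup>2)"
    by (simp add: sum.distrib sum_distrib_right sum_divide_distrib n_def)
  also have "\<dots> \<le> (real n * norm y) * (r / (2 * t)) + real n * (1 / (4 * t) * r\<^sup>2)"
    using t r0 sum_abs_component_le[of y] unfolding n_def by (intro add_right_mono mult_right_mono) auto
  also have "\<dots> = (2 * (real n * r) * norm y + (real n * r) * r) / (4 * t)"
    using t by (simp add: field_simps power2_eq_square)
  also have "\<dots> \<le> ((norm y)\<^sup>2 / 2) / (4 * t)"
  proof (rule divide_right_mono)
    \<comment> \<open>By n r = \<delta>/6 the two terms are at most a third and a sixth of |y|^2,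
      which add up to the half claimed.\<close>
    have "\<delta> * norm y \<le> norm y * norm y" using \<delta> by (intro mult_right_mono) auto
    moreover have "\<delta> * r \<le> norm y * norm y" using \<delta> rd r0 by (intro mult_mono) auto
    ultimately show "2 * (real n * r) * norm y + (real n * r) * r \<le> (norm y)\<^sup>2 / 2"
      unfolding nr by (simp add: power2_eq_square)
  qed (use t in simp)
  finally have S: "(\<Sum>i\<in>UNIV. \<bar>y $ i\<bar> / (2 * t) * r + 1 / (4 * t) * r\<^sup>2) \<le> (norm y)\<^sup>2 / (8 * t)" by simp
  have "- ((norm y)\<^sup>2 / (4 * t)) + (\<Sum>i\<in>UNIV. \<bar>y $ i\<bar> / (2 * t) * r + 1 / (4 * t) * r\<^sup>2) \<le> - ((norm y)\<^sup>2 / (4 * t)) + (norm y)\<^sup>2 / (8 * t)"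
    using S by simp
  also have "\<dots> = - ((norm y)\<^sup>2 / (16 * t)) - (norm y)\<^sup>2 / (16 * t)" by (simp add: field_simps)
  also have "\<dots> \<le> - (\<delta>\<^sup>2 / (16 * t)) - (norm y)\<^sup>2 / 16"
  proof -
    have "\<delta>\<^sup>2 / (16 * t) \<le> (norm y)\<^sup>2 / (16 * t)" using \<delta> t by (intro divide_right_mono power_mono) auto
    moreover have "(norm y)\<^sup>2 / 16 \<le> (norm y)\<^sup>2 / (16 * t)" using t by (intro divide_left_mono) auto
    ultimately show ?thesis by linarith
  qed
  finally have E: "- ((norm y)\<^sup>2 / (4 * t)) + (\<Sum>i\<in>UNIV. \<bar>y $ i\<bar> / (2 * t) * r + 1 / (4 * t) * r\<^sup>2) \<le> - (\<delta>\<^sup>2 / (16 * t)) - (norm y)\<^sup>2 / 16" .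
  \<comment> \<open>For t \<le> 1 the power n/2 of 1/t is enlarged to the integer power n, to which
    the bound s^n/n! \<le> exp s applies.\<close>
  have K: "1 / sqrt (4 * pi * t) ^ n \<le> (1 / t) ^ n"
  proof -
    have "t * t \<le> 1 * t" using t by (intro mult_right_mono) auto
    also have "1 * t \<le> 4 * pi * t" using t pi_gt3 by (intro mult_right_mono) auto
    finally have "t \<le> sqrt (4 * pi * t)" using t by (intro real_le_rsqrt) (simp add: power2_eq_square)
    then have "1 / sqrt (4 * pi * t) \<le> 1 / t" using t by (intro divide_left_mono) auto
    then have "(1 / sqrt (4 * pi * t)) ^ n \<le> (1 / t) ^ n" using t by (intro power_mono) auto
    then show ?thesis by (simp add: power_divide)
  qed
  have P: "(1 / t) ^ n * exp (- (\<delta>\<^sup>2 / (16 * t))) \<le> fact n / (\<delta>\<^sup>2 / 16) ^ n"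
  proof -
    define s where "s = \<delta>\<^sup>2 / (16 * t)"
    have "s ^ n / fact n \<le> exp s" by (rule power_div_fact_le_exp) (use t in \<open>simp add: s_def\<close>)
    then have "s ^ n * exp (- s) \<le> fact n" by (simp add: exp_minus field_simps)
    moreover have "s = \<delta>\<^sup>2 / 16 * (1 / t)" by (simp add: s_def)
    then have "s ^ n = (\<delta>\<^sup>2 / 16) ^ n * (1 / t) ^ n" by (simp only: power_mult_distrib)
    ultimately have "(\<delta>\<^sup>2 / 16) ^ n * ((1 / t) ^ n * exp (- s)) \<le> fact n" by (simp only: mult.assoc)
    moreover have "(\<delta>\<^sup>2 / 16) ^ n > 0" using \<delta> by simp
    ultimately show ?thesis unfolding s_def[symmetric] by (simp add: pos_le_divide_eq mult.commute)
  qed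
  have "heat t y * exp (\<Sum>i\<in>UNIV. \<bar>y $ i\<bar> / (2 * t) * r + 1 / (4 * t) * r\<^sup>2)
    = 1 / sqrt (4 * pi * t) ^ n * exp (- ((norm y)\<^sup>2 / (4 * t)) + (\<Sum>i\<in>UNIV. \<bar>y $ i\<bar> / (2 * t) * r + 1 / (4 * t) * r\<^sup>2))"
    unfolding heat_eq[OF t(1)] exp_add n_def by simp
  also have "\<dots> \<le> (1 / t) ^ n * exp (- (\<delta>\<^sup>2 / (16 * t)) - (norm y)\<^sup>2 / 16)"
    using K E t by (intro mult_mono) auto
  also have "\<dots> = ((1 / t) ^ n * exp (- (\<delta>\<^sup>2 / (16 * t)))) * exp (- ((norm y)\<^sup>2 / 16))"
    unfolding mult.assoc exp_add[symmetric] by simp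
  also have "\<dots> \<le> fact n / (\<delta>\<^sup>2 / 16) ^ n * exp (- ((norm y)\<^sup>2 / 16))"
    using P by (intro mult_right_mono) auto
  finally show ?thesis unfolding n_def .
qed

lemma exp_norm_le_wt:
  fixes y :: "real ^ 'n"
  assumes "c > 0"
  shows "exp (- (c * (norm y)\<^sup>2)) \<le> (1 + 1 / c) ^ CARD('n) * wt y"
proof -
  have "exp (- (c * (norm y)\<^sup>2)) = (\<Prod>i\<in>UNIV. exp (- (c * (y $ i)\<^sup>2)))"
    unfolding power2_norm_eq_inner inner_vec_def
    by (simp add: exp_sum[symmetric] sum_negf[symmetric] sum_distrib_left power2_eq_square)
  also have "\<dots> \<le> (\<Prod>i\<in>UNIV. (1 + 1 / c) * (1 / (1 + (y $ i)\<^sup>2)))"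
    by (intro prod_mono conjI exp_minus_square_le assms) auto
  also have "\<dots> = (1 + 1 / c) ^ CARD('n) * wt y" unfolding prod.distrib wt_def by simp
  finally show ?thesis .
qed

text \<open>In each coordinate the heat kernel at y + z is that at y times exp(- y z/(2t) -
  z^2/(4t)); these are its Taylor coefficients in z.\<close>

definition heat_coeff :: "real \<Rightarrow> real ^ 'n \<Rightarrow> ('n \<Rightarrow> nat) \<Rightarrow> complex" where
  "heat_coeff t y \<beta> = (\<Prod>i\<in>UNIV. of_real (heat1 t (y $ i) * quad_coeff (- (y $ i / (2 * t))) (- (1 / (4 * t))) (\<beta> i)))"

lemma heat_coeff_measurable: "(\<lambda>t. heat_coeff t y \<beta>) \<in> borel_measurable borel"
  unfolding heat_coeff_def quad_coeff_def sq_coeff_def heat1_def normal_density_def by measurable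

text \<open>An instance of \<open>product_power_series\<close>; the bound in the second claim is the
  quantity that \<open>heat_majorant\<close> estimates.\<close>

lemma heat_expansion:
  fixes y :: "real ^ 'n"
  assumes t: "t > 0" and r: "r > 0"
  shows "(\<lambda>\<beta>. norm (heat_coeff t y \<beta>) * r ^ mdeg \<beta>) summable_on UNIV"
    and "(\<Sum>\<^sub>\<infinity>\<beta>. norm (heat_coeff t y \<beta>) * r ^ mdeg \<beta>) \<le> heat t y * exp (\<Sum>i\<in>UNIV. \<bar>y $ i\<bar> / (2 * t) * r + 1 / (4 * t) * r\<^sup>2)"
    and "(\<And>i. \<bar>z $ i\<bar> \<le> r) \<Longrightarrow> ((\<lambda>\<beta>. heat_coeff t y \<beta> * of_real (mpow \<beta> z)) has_sum of_real (heat t (y + z))) UNIV"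
proof -
  define b where "b i = - (y $ i / (2 * t))" for i
  define c where "c = - (1 / (4 * t))"
  define g where "g i j = complex_of_real (heat1 t (y $ i) * quad_coeff (b i) c j)" for i j
  have ng: "norm (g i j) * r ^ j = heat1 t (y $ i) * (\<bar>quad_coeff (b i) c j\<bar> * \<bar>r\<bar> ^ j)" for i j
    using r by (simp add: g_def norm_mult abs_mult heat1_nonneg)
  have s: "(\<lambda>j. norm (g i j) * r ^ j) summable_on UNIV" for i
    unfolding ng by (intro summable_on_cmult_right quad_coeff_sums)
  have le: "(\<Sum>\<^sub>\<infinity>j. norm (g i j) * r ^ j) \<le> heat1 t (y $ i) * exp (\<bar>y $ i\<bar> / (2 * t) * r + 1 / (4 * t) * r\<^sup>2)" for i
    unfolding ng infsum_cmult_right'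
    using mult_left_mono[OF quad_coeff_sums(3)[of "b i" c r] heat1_nonneg[of t "y $ i"]] t r by (simp add: b_def c_def)
  have hs: "((\<lambda>j. g i j * of_real (z ^ j)) has_sum of_real (heat1 t (y $ i + z))) UNIV" for i z
  proof -
    have "b i * z + c * z\<^sup>2 - (y $ i)\<^sup>2 / (4 * t) = - ((y $ i + z)\<^sup>2 / (4 * t))"
      using t by (simp add: b_def c_def power2_sum field_simps)
    then have "exp (- ((y $ i)\<^sup>2 / (4 * t))) * exp (b i * z + c * z\<^sup>2) = exp (- ((y $ i + z)\<^sup>2 / (4 * t)))"
      unfolding exp_add[symmetric] by (simp add: algebra_simps)
    then have h: "heat1 t (y $ i) * exp (b i * z + c * z\<^sup>2) = heat1 t (y $ i + z)"
      by (simp add: heat1_eq[OF t])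
    have "((\<lambda>j. heat1 t (y $ i) * (quad_coeff (b i) c j * z ^ j)) has_sum heat1 t (y $ i + z)) UNIV"
      unfolding h[symmetric] by (intro has_sum_cmult_right quad_coeff_sums)
    from has_sum_bounded_linear[OF bounded_linear_of_real this]
    have "((\<lambda>j. complex_of_real (heat1 t (y $ i) * (quad_coeff (b i) c j * z ^ j))) has_sum of_real (heat1 t (y $ i + z))) UNIV" .
    then show ?thesis by (simp add: g_def mult.assoc)
  qed
  note P = product_power_series[where g = g and r = r and B = "\<lambda>i. heat1 t (y $ i) * exp (\<bar>y $ i\<bar> / (2 * t) * r + 1 / (4 * t) * r\<^sup>2)"
      and F = "\<lambda>i z. of_real (heat1 t (y $ i + z))", OF r s le hs]
  have gc: "(\<Prod>i\<in>UNIV. g i (\<beta> i)) = heat_coeff t y \<beta>" for \<beta> by (simp add: heat_coeff_def g_def b_def c_def)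
  show "(\<lambda>\<beta>. norm (heat_coeff t y \<beta>) * r ^ mdeg \<beta>) summable_on UNIV" using P(1) unfolding gc .
  show "(\<Sum>\<^sub>\<infinity>\<beta>. norm (heat_coeff t y \<beta>) * r ^ mdeg \<beta>) \<le> heat t y * exp (\<Sum>i\<in>UNIV. \<bar>y $ i\<bar> / (2 * t) * r + 1 / (4 * t) * r\<^sup>2)"
    using P(2) unfolding gc prod.distrib by (simp add: heat_def exp_sum)
  show "((\<lambda>\<beta>. heat_coeff t y \<beta> * of_real (mpow \<beta> z)) has_sum of_real (heat t (y + z))) UNIV" if "\<And>i. \<bar>z $ i\<bar> \<le> r"
    using P(3)[of z, OF that] unfolding gc by (simp add: heat_def)
qed

context diagonal_lattice
begin

text \<open>A point \<open>x0 + lat m\<close> in the unit ball has weight at least (1/2)^n, so only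
  finitely many lie there, and none of them is 0.\<close>

lemma lat_distance:
  assumes "x0 \<notin> range lat"
  obtains \<delta> where "\<delta> > 0" "\<And>m. \<delta> \<le> norm (x0 + lat m)"
proof -
  define F where "F = {m. wt (x0 + lat m) \<ge> (1 / 2) ^ CARD('n)}"
  have F: "finite F" unfolding F_def by (rule finite_superlevel_of_summable[OF wt_lat_summable]) (auto simp: less_imp_le wt_pos)
  define \<delta> where "\<delta> = Min (insert 1 ((\<lambda>m. norm (x0 + lat m)) ` F))"
  have nz: "x0 + lat m \<noteq> 0" for m
  proof
    assume "x0 + lat m = 0"
    then have "x0 = - lat m" by (simp add: add_eq_0_iff2)
    also have "\<dots> = lat (- m)" by (simp add: lat_def vec_eq_iff)
    finally show False using assms by blast
  qed
  have "\<delta> > 0" unfolding \<delta>_def using F nz by (subst Min_gr_iff) auto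
  moreover have "\<delta> \<le> norm (x0 + lat m)" for m
  proof (cases "m \<in> F")
    case True
    then show ?thesis unfolding \<delta>_def using F by (intro Min_le) auto
  next
    case False
    have "1 \<le> norm (x0 + lat m)"
    proof (rule ccontr)
      assume "\<not> 1 \<le> norm (x0 + lat m)"
      then have "\<bar>(x0 + lat m) $ i\<bar> \<le> 1" for i using component_le_norm_cart[of "x0 + lat m" i] by linarith
      then have "((x0 + lat m) $ i)\<^sup>2 \<le> 1" for i using abs_le_square_iff[of "(x0 + lat m) $ i" 1] by simp
      then have "(\<Prod>i\<in>(UNIV::'n set). 1 / 2) \<le> wt (x0 + lat m)"
        unfolding wt_def by (intro prod_mono conjI divide_left_mono) (auto simp: one_plus_sq_pos intro!: add_pos_nonneg)
      with False show False by (simp add: F_def)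
    qed
    moreover have "\<delta> \<le> 1" unfolding \<delta>_def using F by (intro Min_le) auto
    ultimately show ?thesis by linarith
  qed
  ultimately show ?thesis using that by blast
qed

text \<open>One radius \<open>r\<close> serves the heat kernels at all points
  \<open>x0 + lat m\<close> and all times, because the norms of these points are bounded below;
  \<open>heat_majorant\<close> gives a majorant summable in \<open>m\<close>. The time integral is
  expanded first, then the lattice sum.\<close>

lemma sing_part_analytic:
  assumes "x0 \<notin> range lat"
  shows "\<exists>r>0. \<exists>a. \<forall>x\<in>ball x0 r. ((\<lambda>\<beta>. a \<beta> * of_real (mpow \<beta> (x - x0))) has_sum sing_part x) UNIV"
proof -
  obtain \<delta> where \<delta>: "\<delta> > 0" "\<And>m. \<delta> \<le> norm (x0 + lat m)" using lat_distance[OF assms] by blast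
  define r where "r = \<delta> / (6 * real CARD('n))"
  have r: "r > 0" using \<delta>(1) by (simp add: r_def)
  define C1 where "C1 = fact CARD('n) / (\<delta>\<^sup>2 / 16) ^ CARD('n)"
  have C1: "C1 \<ge> 0" by (simp add: C1_def)
  define D where "D m = exp (norm (k\<^sup>2)) * (C1 * exp (- ((norm (x0 + lat m))\<^sup>2 / 16)))" for m
  have D0: "D m \<ge> 0" for m using C1 by (simp add: D_def)
  have sD: "D summable_on UNIV"
  proof (rule summable_on_comparison_test[OF summable_on_cmult_right[OF wt_lat_summable]])
    fix m
    have "exp (- (1 / 16 * (norm (x0 + lat m))\<^sup>2)) \<le> (1 + 1 / (1 / 16)) ^ CARD('n) * wt (x0 + lat m)"
      by (rule exp_norm_le_wt) simp
    then have "exp (norm (k\<^sup>2)) * C1 * exp (- ((norm (x0 + lat m))\<^sup>2 / 16)) \<le> exp (norm (k\<^sup>2)) * C1 * (17 ^ CARD('n) * wt (x0 + lat m))"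
      using C1 by (intro mult_left_mono) auto
    then show "D m \<le> (exp (norm (k\<^sup>2)) * C1 * 17 ^ CARD('n)) * wt (x0 + lat m)" by (simp add: D_def mult.assoc)
  qed (rule D0)
  define I where "I t = indicat_real {0<..1} t" for t :: real
  define a where "a m t \<beta> = I (t::real) *\<^sub>R (exp (k\<^sup>2 * of_real t) * heat_coeff t (x0 + lat m) \<beta>)" for m t \<beta>
  define f where "f m t x = I (t::real) *\<^sub>R (exp (k\<^sup>2 * of_real t) * complex_of_real (heat t (x + lat m)))" for m t x
  have ek: "norm (exp (k\<^sup>2 * of_real t)) \<le> exp (norm (k\<^sup>2))" if "0 < t" "t \<le> 1" for t
    using that Re_mult_of_real_le[of t "k\<^sup>2"] by (simp add: norm_exp_eq_Re)
  have am: "(\<lambda>t. a m t \<beta>) \<in> borel_measurable lborel" for m \<beta>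
    unfolding a_def I_def using heat_coeff_measurable[of "x0 + lat m" \<beta>] by measurable
  have exp: "((\<lambda>\<beta>. a m t \<beta> * of_real (mpow \<beta> (x - x0))) has_sum f m t x) UNIV" if x: "x \<in> ball x0 r" for m t x
  proof (cases "t \<in> {0<..1}")
    case True
    have "((\<lambda>\<beta>. heat_coeff t (x0 + lat m) \<beta> * of_real (mpow \<beta> (x - x0))) has_sum of_real (heat t (x0 + lat m + (x - x0)))) UNIV"
      by (rule heat_expansion(3)[OF _ r]) (use True abs_component_less_ball[OF x] in auto)
    from has_sum_cmult_right[OF this, of "exp (k\<^sup>2 * of_real t)"] show ?thesis
      using True by (simp add: a_def f_def I_def mult.assoc add.commute)
  qed (simp add: a_def f_def I_def)
  have na: "norm (a m t \<beta>) * r ^ mdeg \<beta> = (I t * norm (exp (k\<^sup>2 * of_real t))) * (norm (heat_coeff t (x0 + lat m) \<beta>) * r ^ mdeg \<beta>)" for m t \<beta>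
    by (simp add: a_def norm_mult I_def)
  have sa: "(\<lambda>\<beta>. norm (a m t \<beta>) * r ^ mdeg \<beta>) summable_on UNIV" for m t
  proof (cases "t \<in> {0<..1}")
    case True
    show ?thesis unfolding na by (intro summable_on_cmult_right heat_expansion(1)[OF _ r]) (use True in auto)
  qed (simp add: a_def I_def)
  have le: "(\<Sum>\<^sub>\<infinity>\<beta>. norm (a m t \<beta>) * r ^ mdeg \<beta>) \<le> I t * D m" for m t
  proof (cases "t \<in> {0<..1}")
    case True
    have "(\<Sum>\<^sub>\<infinity>\<beta>. norm (a m t \<beta>) * r ^ mdeg \<beta>) = norm (exp (k\<^sup>2 * of_real t)) * (\<Sum>\<^sub>\<infinity>\<beta>. norm (heat_coeff t (x0 + lat m) \<beta>) * r ^ mdeg \<beta>)"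
      unfolding na infsum_cmult_right' using True by (simp add: I_def)
    also have "\<dots> \<le> exp (norm (k\<^sup>2)) * (C1 * exp (- ((norm (x0 + lat m))\<^sup>2 / 16)))"
    proof (intro mult_mono ek)
      have "(\<Sum>\<^sub>\<infinity>\<beta>. norm (heat_coeff t (x0 + lat m) \<beta>) * r ^ mdeg \<beta>) \<le> heat t (x0 + lat m) * exp (\<Sum>i\<in>UNIV. \<bar>(x0 + lat m) $ i\<bar> / (2 * t) * r + 1 / (4 * t) * r\<^sup>2)"
        by (rule heat_expansion(2)[OF _ r]) (use True in auto)
      also have "\<dots> \<le> C1 * exp (- ((norm (x0 + lat m))\<^sup>2 / 16))"
        unfolding C1_def by (rule heat_majorant[OF _ _ \<delta>(1) \<delta>(2) r_def]) (use True in auto)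
      finally show "(\<Sum>\<^sub>\<infinity>\<beta>. norm (heat_coeff t (x0 + lat m) \<beta>) * r ^ mdeg \<beta>) \<le> C1 * exp (- ((norm (x0 + lat m))\<^sup>2 / 16))" .
    qed (use True r in \<open>auto intro!: infsum_nonneg\<close>)
    finally show ?thesis using True by (simp add: I_def D_def)
  qed (simp add: a_def I_def)
  have iB: "integrable lborel (\<lambda>t. I t * D m)" and vB: "(\<integral>t. I t * D m \<partial>lborel) = D m" for m
    unfolding I_def by (simp_all add: integrable_real_indicator)
  have A: "x \<in> ball x0 r \<Longrightarrow> ((\<lambda>\<beta>. (\<integral>t. a m t \<beta> \<partial>lborel) * of_real (mpow \<beta> (x - x0))) has_sum (\<integral>t. f m t x \<partial>lborel)) UNIV"
    "(\<lambda>\<beta>. norm (\<integral>t. a m t \<beta> \<partial>lborel) * r ^ mdeg \<beta>) summable_on UNIV"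
    "(\<Sum>\<^sub>\<infinity>\<beta>. norm (\<integral>t. a m t \<beta> \<partial>lborel) * r ^ mdeg \<beta>) \<le> integral\<^sup>L lborel (\<lambda>t. I t * D m)" for m x
    by (rule analytic_integral[OF lborel.sigma_finite_measure_axioms am exp sa le iB r]; assumption)+
  define c where "c m = cis (- (\<eta> \<bullet> lat m))" for m
  \<comment> \<open>The same majorant allows the lattice form of theta to be integrated in time term
    by term.\<close>
  have S: "sing_part x = (\<Sum>\<^sub>\<infinity>m. (\<integral>t. f m t x \<partial>lborel) * c m)" if x: "x \<in> ball x0 r" for x
  proof -
    have nf: "norm (f m t x * c m) \<le> I t * D m" for m t
    proof -
      have le1: "norm (a m t \<beta> * of_real (mpow \<beta> (x - x0))) \<le> norm (a m t \<beta>) * r ^ mdeg \<beta>" for \<beta>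
        using abs_mpow_le[of "x - x0" r \<beta>] abs_component_less_ball[OF x] by (simp add: norm_mult mult_left_mono)
      have "norm (f m t x) \<le> (\<Sum>\<^sub>\<infinity>\<beta>. norm (a m t \<beta>) * r ^ mdeg \<beta>)"
        by (rule norm_infsum_le[OF exp[OF x] has_sum_infsum[OF sa] le1])
      also note le
      finally show ?thesis by (simp add: norm_mult c_def)
    qed
    have mf: "(\<lambda>t. f m t x * c m) \<in> borel_measurable lborel" for m unfolding f_def I_def by measurable
    have sf: "(\<lambda>m. norm (f m t x * c m)) summable_on UNIV" for t
      by (rule summable_on_comparison_test[OF summable_on_cmult_right[OF sD, of "I t"] nf]) simp
    have lf: "(\<Sum>\<^sub>\<infinity>m. norm (f m t x * c m)) \<le> I t * (\<Sum>\<^sub>\<infinity>m. D m)" for t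
      unfolding infsum_cmult_right'[symmetric] by (rule infsum_mono[OF sf summable_on_cmult_right[OF sD] nf])
    have "((\<lambda>m. \<integral>t. f m t x * c m \<partial>lborel) has_sum (\<integral>t. (\<Sum>\<^sub>\<infinity>m. f m t x * c m) \<partial>lborel)) UNIV"
      by (rule integral_has_sum_dominated(4)[OF lborel.sigma_finite_measure_axioms mf sf lf]) (simp add: I_def)
    also have "(\<integral>t. (\<Sum>\<^sub>\<infinity>m. f m t x * c m) \<partial>lborel) = sing_part x"
      unfolding sing_part_def set_lebesgue_integral_def
    proof (rule Bochner_Integration.integral_cong[OF refl])
      fix t :: real
      show "(\<Sum>\<^sub>\<infinity>m. f m t x * c m) = indicator {0<..1} t *\<^sub>R (exp (k\<^sup>2 * of_real t) * theta t x)"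
      proof (cases "t \<in> {0<..1}")
        case True
        then have "(\<Sum>\<^sub>\<infinity>m. f m t x * c m) = (\<Sum>\<^sub>\<infinity>m. exp (k\<^sup>2 * of_real t) * (of_real (heat t (x + lat m)) * cis (- (\<eta> \<bullet> lat m))))"
          by (simp add: f_def I_def c_def mult.assoc)
        also have "\<dots> = exp (k\<^sup>2 * of_real t) * theta t x"
          using True by (simp add: infsum_cmult_right' poisson)
        finally show ?thesis using True by simp
      qed (simp add: f_def I_def)
    qed
    finally show ?thesis by (simp add: infsumI)
  qed
  define b where "b m \<beta> = (\<integral>t. a m t \<beta> \<partial>lborel) * c m" for m \<beta>
  have nb: "norm (b m \<beta>) = norm (\<integral>t. a m t \<beta> \<partial>lborel)" for m \<beta> by (simp add: b_def norm_mult c_def)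
  have "((\<lambda>\<beta>. (\<Sum>\<^sub>\<infinity>m. b m \<beta>) * of_real (mpow \<beta> (x - x0))) has_sum sing_part x) UNIV" if x: "x \<in> ball x0 r" for x
    unfolding S[OF x]
  proof (rule analytic_infsum[where B = D, OF _ _ _ sD r x])
    fix m x assume x: "x \<in> ball x0 r"
    from has_sum_cmult_left[OF A(1)[OF x, of m], of "c m"]
    show "((\<lambda>\<beta>. b m \<beta> * of_real (mpow \<beta> (x - x0))) has_sum (\<integral>t. f m t x \<partial>lborel) * c m) UNIV"
      by (simp add: b_def mult_ac)
  qed (unfold nb, rule A(2), rule A(3)[unfolded vB])
  then show ?thesis using r by (intro exI[of _ r] conjI exI[of _ "\<lambda>\<beta>. \<Sum>\<^sub>\<infinity>m. b m \<beta>"] ballI)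
qed

lemma real_analytic_green: "real_analytic_fun_on (UNIV - range lat) green"
  unfolding real_analytic_fun_on_def
proof
  fix x0 assume "x0 \<in> UNIV - range lat"
  then have "x0 \<notin> range lat" by blast
  from sing_part_analytic[OF this]
  obtain r where R: "r > 0 \<and> (\<exists>a. \<forall>x\<in>ball x0 r. ((\<lambda>\<beta>. a \<beta> * of_real (mpow \<beta> (x - x0))) has_sum sing_part x) UNIV)" ..
  from R have r: "r > 0" ..
  from R have "\<exists>a. \<forall>x\<in>ball x0 r. ((\<lambda>\<beta>. a \<beta> * of_real (mpow \<beta> (x - x0))) has_sum sing_part x) UNIV" ..
  then obtain a where a: "\<forall>x\<in>ball x0 r. ((\<lambda>\<beta>. a \<beta> * of_real (mpow \<beta> (x - x0))) has_sum sing_part x) UNIV" ..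
  from smooth_part_analytic[of x0]
  obtain b where b: "\<forall>x\<in>ball x0 1. ((\<lambda>\<beta>. b \<beta> * of_real (mpow \<beta> (x - x0))) has_sum smooth_part x) UNIV" ..
  have "((\<lambda>\<beta>. (b \<beta> - a \<beta>) * of_real (\<Prod>i\<in>UNIV. (x $ i - x0 $ i) ^ \<beta> i)) has_sum green x) UNIV" if "x \<in> ball x0 (min r 1)" for x
    using has_sum_diff[OF bspec[OF b] bspec[OF a], of x] that by (simp add: green_def mpow_def left_diff_distrib)
  then show "\<exists>r>0. \<exists>a. \<forall>x\<in>ball x0 r. ((\<lambda>\<beta>. a \<beta> * of_real (\<Prod>i\<in>UNIV. (x $ i - x0 $ i) ^ \<beta> i)) has_sum green x) UNIV"
    using r by (intro exI[of _ "min r 1"] conjI exI[of _ "\<lambda>\<beta>. b \<beta> - a \<beta>"] ballI) auto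
qed

end

section \<open>Existence of the Green function\<close>

lemma cell_eq_box: "cell q = box 0 (\<chi> i. q $ i $ i)"
  by (auto simp: cell_def mem_box_cart)

text \<open>Once the notions for the matrix are identified with those of the locale, local
  integrability and the pairing are two uses of \<open>green_integral\<close>.\<close>

lemma is_green_function_exists:
  fixes q :: "real ^ 'n ^ 'n"
  assumes q: "q \<in> pos_diag"
  shows "\<exists>g. is_green_function q \<eta> k g"
proof -
  define d where "d i = q $ i $ i" for i
  have d: "d i > 0" "i \<noteq> j \<Longrightarrow> q $ i $ j = 0" for i j
    using q by (auto simp: pos_diag_def d_def split: if_splits)
  interpret diagonal_lattice d \<eta> k by standard (rule d)
  have mv: "q *v v = (\<chi> i. d i * v $ i)" for v
  proof -
    have "(\<Sum>j\<in>UNIV. q $ i $ j * v $ j) = (\<Sum>j\<in>UNIV. if j = i then d i * v $ i else 0)" for i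
      by (rule sum.cong) (auto simp: d d_def)
    then show ?thesis by (simp add: matrix_vector_mult_def vec_eq_iff)
  qed
  have lat: "periodic_lattice q = range lat"
    unfolding periodic_lattice_def mv by (simp add: lat_def int_vec_def)
  have "det q \<noteq> 0"
    using d(1) by (subst det_diagonal) (auto simp: d(2) d_def less_imp_neq[THEN not_sym])
  then have "q ** matrix_inv q = mat 1"
    unfolding invertible_det_nz[symmetric] invertible_def matrix_inv_def by (rule someI2_ex) blast
  then have "q *v (matrix_inv q *v v) = v" for v by (simp add: matrix_vector_mul_assoc)
  then have inv: "d i * (matrix_inv q *v v) $ i = v $ i" for i v unfolding mv by (metis vec_lambda_beta)
  have fr: "freq q \<eta> z = fr z" for z
    using inv[of _ "int_vec z"] d(1) unfolding freq_def fr_def vec_eq_iff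
    by (simp add: int_vec_def field_simps less_imp_neq[THEN not_sym])
  have vol: "measure lborel (cell q) = vol"
  proof -
    have "0 \<bullet> b \<le> (\<chi> i. q $ i $ i) \<bullet> b" if "b \<in> Basis" for b :: "real ^ 'n"
      using that d(1) by (auto simp: Basis_vec_def inner_axis d_def less_imp_le)
    then have "measure lborel (cell q) = (\<Prod>b\<in>Basis. (\<chi> i. q $ i $ i) \<bullet> b)"
      unfolding cell_eq_box measure_lborel_box_eq by simp
    also have "\<dots> = vol" using prod_Basis_vec[of "\<lambda>x. x" "\<chi> i. q $ i $ i"] by (simp add: vol_def d_def)
    finally show ?thesis .
  qed
  have lam: "lam z = 0 \<longleftrightarrow> z \<in> Z_res q \<eta> k" for z
    by (auto simp: lam_def Z_res_def fr)
  have gt: "green_term q \<eta> k z x = - 1 / (lam z * vol) * cis (x \<bullet> fr z)" for z x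
  proof -
    have "of_real vol * (k\<^sup>2 - of_real ((norm (fr z))\<^sup>2)) = - (lam z * vol)" by (simp add: lam_def algebra_simps)
    then show ?thesis unfolding green_term_def fr vol cis_conv_exp by simp
  qed
  have "is_green_function q \<eta> k green"
    unfolding is_green_function_def
  proof (intro conjI allI impI ballI)
    show "real_analytic_fun_on (UNIV - periodic_lattice q) green" unfolding lat by (rule real_analytic_green)
  next
    fix K :: "(real ^ 'n) set" assume K: "compact K"
    \<comment> \<open>The positive minimum of the weight on \<open>K\<close> makes a multiple of the
      weight dominate the indicator of \<open>K\<close>.\<close>
    obtain c where c: "c > 0" "\<And>x. x \<in> K \<Longrightarrow> c \<le> wt x"
    proof (cases "K = {}")
      case False
      have "continuous_on K wt" unfolding wt_def
        by (intro continuous_intros) (simp add: less_imp_neq[OF one_plus_sq_pos, THEN not_sym])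
      from continuous_attains_inf[OF K False this] obtain x where "x \<in> K" "\<And>y. y \<in> K \<Longrightarrow> wt x \<le> wt y" by blast
      then show ?thesis using that wt_pos by blast
    qed (use that[of 1] in auto)
    have [measurable]: "K \<in> sets borel" using K by (simp add: borel_compact)
    have "integrable lborel (\<lambda>x. green x * indicator K x)"
    proof (rule green_integral(1)[where c = "1 / c"])
      show "norm (indicator K x :: complex) \<le> 1 / c * wt x" for x
        using c less_imp_le[OF wt_pos[of x]] by (auto simp: indicator_def pos_le_divide_eq)
    qed measurable
    then show "set_integrable lborel K green"
      unfolding set_integrable_def by (simp add: scaleR_conv_of_real mult.commute of_real_indicator)
  next
    fix \<phi> :: "real ^ 'n \<Rightarrow> complex" assume \<phi>: "\<phi> \<in> schwartz"
    obtain c where c: "\<And>x. norm (\<phi> x) \<le> c * wt x" using schwartz_partials(3)[OF \<phi>, of "[]"] by auto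
    have m: "\<phi> \<in> borel_measurable borel"
      using schwartz_partials(2)[OF \<phi>, of "[]"] by (simp add: borel_measurable_continuous_onI)
    show "integrable lborel (\<lambda>x. green x * \<phi> x)" by (rule green_integral(1)[OF m c])
    have fh: "fhat \<phi> z = ft \<phi> (fr z)" for z by (simp add: fhat_def ft_def)
    obtain C where C: "\<And>\<xi>. norm (ft \<phi> \<xi>) \<le> C * wt \<xi>" using ft_decay[OF \<phi>] by blast
    have "(\<lambda>z. norm (fhat \<phi> z)) summable_on UNIV"
      by (rule summable_on_comparison_test[OF summable_on_cmult_right[OF wt_fr_summable, of C]]) (auto simp: fh C)
    from green_integral(2)[OF m c this]
    have *: "((\<lambda>z. (if lam z = 0 then 0 else - 1 / (lam z * vol)) * fhat \<phi> z) has_sum (\<integral>x. green x * \<phi> x \<partial>lborel)) UNIV" .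
    have i: "(LINT x|lborel. green_term q \<eta> k z x * \<phi> x) = - 1 / (lam z * vol) * fhat \<phi> z" for z
      unfolding gt fhat_def by (simp add: mult.assoc)
    \<comment> \<open>Resonant frequencies carry the coefficient 0 in the full sum, so they can be
      removed from the index set.\<close>
    show "((\<lambda>z. LINT x|lborel. green_term q \<eta> k z x * \<phi> x) has_sum (LINT x|lborel. green x * \<phi> x)) (UNIV - Z_res q \<eta> k)"
      using * unfolding i by (subst (asm) has_sum_cong_neutral[where T = "UNIV - Z_res q \<eta> k" and g = "\<lambda>z. - 1 / (lam z * vol) * fhat \<phi> z"]) (auto simp: lam)
  qed
  then show ?thesis by blast
qed

section \<open>Derivatives of real analytic functions\<close>

text \<open>The l^1 norm of the coefficients scaled to the closed cube of radius \<open>r\<close>;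
  it bounds the sum of the series there and is easy to follow through differentiation.\<close>

definition pnorm :: "real \<Rightarrow> (('n::finite \<Rightarrow> nat) \<Rightarrow> complex) \<Rightarrow> real" where
  "pnorm r a = (\<Sum>\<^sub>\<infinity>\<beta>. norm (a \<beta>) * r ^ mdeg \<beta>)"

definition psummable :: "real \<Rightarrow> (('n::finite \<Rightarrow> nat) \<Rightarrow> complex) \<Rightarrow> bool" where
  "psummable r a \<longleftrightarrow> (\<lambda>\<beta>. norm (a \<beta>) * r ^ mdeg \<beta>) summable_on UNIV"

definition pser :: "(('n::finite \<Rightarrow> nat) \<Rightarrow> complex) \<Rightarrow> real ^ 'n \<Rightarrow> complex" where
  "pser a z = (\<Sum>\<^sub>\<infinity>\<beta>. a \<beta> * of_real (mpow \<beta> z))"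

text \<open>Coefficients of the formal partial derivative. Working on coefficients turns the
  symmetry of mixed derivatives into \<open>pdiff_commute\<close>.\<close>

definition pdiff :: "'n::finite \<Rightarrow> (('n \<Rightarrow> nat) \<Rightarrow> complex) \<Rightarrow> ('n \<Rightarrow> nat) \<Rightarrow> complex" where
  "pdiff i a \<beta> = of_nat (Suc (\<beta> i)) * a (\<beta>(i := Suc (\<beta> i)))"

lemma pdiff_commute: "pdiff i (pdiff j a) = pdiff j (pdiff i a)"
proof (cases "i = j")
  case False
  then show ?thesis by (auto simp: pdiff_def fun_eq_iff fun_upd_twist[OF False])
qed simp

lemma abs_summable_pser:
  assumes "psummable r a" "\<And>i. \<bar>z $ i\<bar> \<le> r"
  shows "(\<lambda>\<beta>. norm (a \<beta> * of_real (mpow \<beta> z))) summable_on UNIV" and "norm (pser a z) \<le> pnorm r a"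
    and "((\<lambda>\<beta>. a \<beta> * of_real (mpow \<beta> z)) has_sum pser a z) UNIV"
proof -
  have le: "norm (a \<beta> * of_real (mpow \<beta> z)) \<le> norm (a \<beta>) * r ^ mdeg \<beta>" for \<beta>
    using abs_mpow_le[of z r \<beta>] assms(2) by (simp add: norm_mult mult_left_mono)
  show s: "(\<lambda>\<beta>. norm (a \<beta> * of_real (mpow \<beta> z))) summable_on UNIV"
    by (rule summable_on_comparison_test[OF assms(1)[unfolded psummable_def] le]) simp
  show hs: "((\<lambda>\<beta>. a \<beta> * of_real (mpow \<beta> z)) has_sum pser a z) UNIV"
    unfolding pser_def by (rule has_sum_infsum[OF abs_summable_summable[OF s]])
  show "norm (pser a z) \<le> pnorm r a"
    unfolding pnorm_def by (rule norm_infsum_le[OF hs has_sum_infsum[OF assms(1)[unfolded psummable_def]] le])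
qed

text \<open>R^m - r^m is R - r times a sum of m products, each at least r^(m-1). The induction keeps
  r^m on the left, the sharper statement that it needs.\<close>

lemma power_diff_bound:
  assumes "0 \<le> r" "r < (R::real)"
  shows "real m * r ^ (m - 1) \<le> R ^ m / (R - r)"
proof -
  have "real m * r ^ (m - 1) * (R - r) + r ^ m \<le> R ^ m"
  proof (induction m)
    case (Suc m)
    have "real (Suc m) * r ^ (Suc m - 1) * (R - r) + r ^ Suc m = r * (real m * r ^ (m - 1) * (R - r)) + R * r ^ m"
      by (cases m) (auto simp: algebra_simps)
    also have "\<dots> \<le> R * (real m * r ^ (m - 1) * (R - r)) + R * r ^ m"
      using assms by (intro add_right_mono mult_right_mono mult_nonneg_nonneg) auto
    also have "\<dots> = R * (real m * r ^ (m - 1) * (R - r) + r ^ m)" by (simp add: algebra_simps)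
    also have "\<dots> \<le> R * R ^ m" using Suc assms by (intro mult_left_mono) auto
    finally show ?case by simp
  qed simp
  moreover have "r ^ m \<ge> 0" using assms by simp
  ultimately have "real m * r ^ (m - 1) * (R - r) \<le> R ^ m" by linarith
  then show ?thesis using assms by (simp add: pos_le_divide_eq)
qed

lemma mdeg_upd: "mdeg (\<beta>(i := Suc (\<beta> i))) = Suc (mdeg \<beta>)"
proof -
  have "(\<Sum>j\<in>UNIV. (\<beta>(i := Suc (\<beta> i))) j) = (\<Sum>j\<in>UNIV. \<beta> j + (if j = i then 1 else 0))"
    by (rule sum.cong) auto
  then show ?thesis unfolding mdeg_def by (simp add: sum.distrib)
qed

lemma component_le_mdeg: "\<beta> i \<le> mdeg \<beta>"
  unfolding mdeg_def by (rule member_le_sum) auto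

lemma inj_upd_Suc: "inj (\<lambda>\<beta>::'n \<Rightarrow> nat. \<beta>(i := Suc (\<beta> i)))"
proof (rule injI)
  fix \<beta> \<gamma> :: "'n \<Rightarrow> nat" assume eq: "\<beta>(i := Suc (\<beta> i)) = \<gamma>(i := Suc (\<gamma> i))"
  show "\<beta> = \<gamma>"
  proof
    fix j show "\<beta> j = \<gamma> j" using fun_cong[OF eq, of j] by (cases "j = i") auto
  qed
qed

lemma range_upd_Suc: "range (\<lambda>\<beta>::'n \<Rightarrow> nat. \<beta>(i := Suc (\<beta> i))) = {\<gamma>. \<gamma> i \<noteq> 0}"
proof (intro equalityI subsetI)
  fix \<gamma> :: "'n \<Rightarrow> nat" assume "\<gamma> \<in> {\<gamma>. \<gamma> i \<noteq> 0}"
  then show "\<gamma> \<in> range (\<lambda>\<beta>. \<beta>(i := Suc (\<beta> i)))"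
    by (intro image_eqI[of _ _ "\<gamma>(i := \<gamma> i - 1)"]) (auto simp: fun_eq_iff)
qed auto

text \<open>Derivative of one term of the series. Where \<open>\<beta> i = 0\<close> the truncated
  \<open>\<beta> i - 1\<close> does no harm, because the factor \<open>\<beta> i\<close> is
  0.\<close>

definition pterm :: "'n::finite \<Rightarrow> (('n \<Rightarrow> nat) \<Rightarrow> complex) \<Rightarrow> ('n \<Rightarrow> nat) \<Rightarrow> real ^ 'n \<Rightarrow> complex" where
  "pterm i a \<beta> x = a \<beta> * of_real (real (\<beta> i) * mpow (\<beta>(i := \<beta> i - 1)) x)"

lemma pterm_bound:
  assumes "0 < r" "r < R" "\<And>i. \<bar>x $ i\<bar> \<le> r"
  shows "norm (pterm i a \<beta> x) \<le> norm (a \<beta>) * R ^ mdeg \<beta> / (R - r)"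
proof (cases "\<beta> i = 0")
  case False
  define \<gamma> where "\<gamma> = \<beta>(i := \<beta> i - 1)"
  have \<beta>: "\<beta> = \<gamma>(i := Suc (\<gamma> i))" using False by (auto simp: \<gamma>_def)
  have d: "mdeg \<gamma> = mdeg \<beta> - 1" using mdeg_upd[of \<gamma> i] unfolding \<beta>[symmetric] by linarith
  have "norm (pterm i a \<beta> x) = norm (a \<beta>) * (real (\<beta> i) * \<bar>mpow \<gamma> x\<bar>)"
    by (simp add: pterm_def norm_mult \<gamma>_def abs_mult)
  also have "\<dots> \<le> norm (a \<beta>) * (real (mdeg \<beta>) * r ^ (mdeg \<beta> - 1))"
    using component_le_mdeg[of \<beta> i] abs_mpow_le[OF assms(3), of \<gamma>] assms(1) unfolding d
    by (intro mult_left_mono mult_mono) auto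
  also have "\<dots> \<le> norm (a \<beta>) * (R ^ mdeg \<beta> / (R - r))"
    using assms by (intro mult_left_mono power_diff_bound) auto
  finally show ?thesis by simp
qed (use assms in \<open>simp add: pterm_def\<close>)

text \<open>A derivative costs the factor 1/(R - r), by \<open>power_diff_bound\<close>. Raising the
  exponent of \<open>i\<close> is injective, so the terms of the derivative are dominated by
  distinct terms of the original majorant.\<close>

lemma pdiff_psummable:
  assumes "0 < r" "r < R" "psummable R a"
  shows "psummable r (pdiff i a)" and "pnorm r (pdiff i a) \<le> pnorm R a / (R - r)"
proof -
  define F where "F \<gamma> = norm (a \<gamma>) * R ^ mdeg \<gamma> / (R - r)" for \<gamma>
  have "F summable_on UNIV"
    using summable_on_cmult_left[OF assms(3)[unfolded psummable_def], of "1 / (R - r)"] by (simp add: F_def[abs_def])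
  then have sF: "F summable_on A" for A
    by (rule summable_on_subset_banach) simp
  have F0: "F \<gamma> \<ge> 0" for \<gamma> using assms by (simp add: F_def)
  let ?u = "\<lambda>\<beta>::'a \<Rightarrow> nat. \<beta>(i := Suc (\<beta> i))"
  have le: "norm (pdiff i a \<beta>) * r ^ mdeg \<beta> \<le> F (?u \<beta>)" for \<beta>
  proof -
    have "norm (pdiff i a \<beta>) * r ^ mdeg \<beta> = norm (a (?u \<beta>)) * (real (Suc (\<beta> i)) * r ^ mdeg \<beta>)"
      by (simp only: pdiff_def norm_mult norm_of_nat mult_ac)
    also have "\<dots> \<le> norm (a (?u \<beta>)) * (real (mdeg (?u \<beta>)) * r ^ (mdeg (?u \<beta>) - 1))"
      using component_le_mdeg[of "?u \<beta>" i] assms by (intro mult_left_mono mult_mono) (auto simp: mdeg_upd)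
    also have "\<dots> \<le> norm (a (?u \<beta>)) * (R ^ mdeg (?u \<beta>) / (R - r))"
      using assms by (intro mult_left_mono power_diff_bound) auto
    finally show ?thesis by (simp add: F_def)
  qed
  have sFu: "(\<lambda>\<beta>. F (?u \<beta>)) summable_on UNIV"
    using summable_on_reindex[OF inj_upd_Suc[of i], of F] sF by (simp add: o_def)
  show s: "psummable r (pdiff i a)"
    unfolding psummable_def by (rule summable_on_comparison_test[OF sFu le]) (use assms in auto)
  have "pnorm r (pdiff i a) \<le> (\<Sum>\<^sub>\<infinity>\<beta>. F (?u \<beta>))"
    unfolding pnorm_def by (rule infsum_mono[OF s[unfolded psummable_def] sFu le])
  also have "\<dots> = infsum F (range ?u)"
    using infsum_reindex[OF inj_upd_Suc[of i], of F] by (simp add: o_def)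
  also have "\<dots> \<le> infsum F UNIV" by (rule infsum_mono_neutral[OF sF sF]) (auto simp: F0)
  also have "\<dots> = pnorm R a / (R - r)"
    unfolding F_def pnorm_def divide_inverse by (rule infsum_cmult_left')
  finally show "pnorm r (pdiff i a) \<le> pnorm R a / (R - r)" .
qed

text \<open>Terms with \<open>\<beta> i = 0\<close> vanish, and the others are the terms of the
  formal derivative after lowering the exponent of \<open>i\<close>.\<close>

lemma has_sum_pterm:
  assumes "psummable r (pdiff i a)" "\<And>i. \<bar>x $ i\<bar> \<le> r"
  shows "((\<lambda>\<beta>. pterm i a \<beta> x) has_sum pser (pdiff i a) x) UNIV"
proof -
  let ?u = "\<lambda>\<beta>::'a \<Rightarrow> nat. \<beta>(i := Suc (\<beta> i))"
  have "pterm i a (?u \<beta>) x = pdiff i a \<beta> * of_real (mpow \<beta> x)" for \<beta>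
    by (simp add: pterm_def pdiff_def)
  then have "((\<lambda>\<beta>. pterm i a \<beta> x) has_sum pser (pdiff i a) x) (range ?u)"
    using abs_summable_pser(3)[OF assms] by (subst has_sum_reindex[OF inj_upd_Suc]) (simp add: o_def)
  then show ?thesis
    by (subst has_sum_cong_neutral[where S = "range ?u", symmetric]) (auto simp: range_upd_Suc pterm_def)
qed

lemma mpow_has_derivative:
  "(mpow \<beta> has_derivative (\<lambda>h. \<Sum>i\<in>UNIV. h $ i * (real (\<beta> i) * mpow (\<beta>(i := \<beta> i - 1)) x))) (at x within S)"
proof -
  have "((\<lambda>x. \<Prod>i\<in>UNIV. (x $ i) ^ \<beta> i) has_derivative
      (\<lambda>h. \<Sum>i\<in>UNIV. (of_nat (\<beta> i) * (h $ i) * (x $ i) ^ (\<beta> i - 1)) * (\<Prod>j\<in>UNIV - {i}. (x $ j) ^ \<beta> j))) (at x within S)"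
    by (intro has_derivative_prod has_derivative_power bounded_linear_imp_has_derivative bounded_linear_vec_nth)
  moreover have "mpow (\<beta>(i := \<beta> i - 1)) x = (x $ i) ^ (\<beta> i - 1) * (\<Prod>j\<in>UNIV - {i}. (x $ j) ^ \<beta> j)" for i
    unfolding mpow_def by (subst prod.remove[of UNIV i]) (auto intro!: prod.cong)
  ultimately show ?thesis unfolding mpow_def[abs_def] by (simp add: mult_ac)
qed

text \<open>Termwise differentiation works with sequences, so the multi-indices are numbered by
  \<open>to_nat\<close>; numbers that are not codes contribute 0.\<close>

definition enum_terms :: "('i::countable \<Rightarrow> 'a::zero) \<Rightarrow> nat \<Rightarrow> 'a" where
  "enum_terms F n = (if n \<in> range (to_nat :: 'i \<Rightarrow> nat) then F (from_nat n) else 0)"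

lemma has_sum_enum_terms:
  fixes F :: "'i::countable \<Rightarrow> 'a::{topological_comm_monoid_add,t2_space}"
  assumes "(F has_sum s) UNIV"
  shows "(enum_terms F has_sum s) UNIV"
proof -
  have "(enum_terms F has_sum s) (range (to_nat :: 'i \<Rightarrow> nat))"
    using assms by (subst has_sum_reindex) (auto simp: o_def enum_terms_def)
  then show ?thesis
    by (subst has_sum_cong_neutral[where S = "range (to_nat :: 'i \<Rightarrow> nat)", symmetric]) (auto simp: enum_terms_def)
qed

text \<open>On the cube of radius \<open>r\<close>, chosen halfway between the largest coordinate of
  \<open>x\<close> and \<open>R\<close>, the differentiated series converges uniformly by
  \<open>pterm_bound\<close>, so termwise differentiation is justified.\<close>

lemma pser_has_derivative:
  fixes a :: "('n::finite \<Rightarrow> nat) \<Rightarrow> complex"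
  assumes R: "psummable R a" and x: "\<And>i. \<bar>x $ i\<bar> < R"
  shows "(pser a has_derivative (\<lambda>h. \<Sum>i\<in>UNIV. of_real (h $ i) * pser (pdiff i a) x)) (at x)"
proof -
  define m where "m = Max (range (\<lambda>i. \<bar>x $ i\<bar>))"
  have m: "\<bar>x $ i\<bar> \<le> m" "0 \<le> m" "m < R" for i
  proof -
    show *: "\<bar>x $ i\<bar> \<le> m" for i unfolding m_def by (intro Max_ge) auto
    show "0 \<le> m" using order.trans[OF abs_ge_zero *] .
    show "m < R" unfolding m_def using x by (subst Max_less_iff) auto
  qed
  define r where "r = (m + R) / 2"
  have r: "0 < r" "r < R" "\<bar>x $ i\<bar> < r" for i using m(1)[of i] m(2,3) by (auto simp: r_def field_simps)
  define S where "S = {x :: real ^ 'n. \<forall>i. \<bar>x $ i\<bar> < r}"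
  have S_eq: "S = (\<Inter>i. {x. \<bar>x $ i\<bar> < r})" by (auto simp: S_def)
  have oS: "open S" unfolding S_eq by (intro open_INT ballI open_Collect_less continuous_intros) auto
  have cS: "convex S"
  proof -
    have "S = box (- (\<chi> i. r)) (\<chi> i. r)" 
    proof -
      have "\<bar>t\<bar> < r \<longleftrightarrow> - r < t \<and> t < r" for t by linarith
      then show ?thesis by (simp add: S_def set_eq_iff mem_box_cart)
    qed
    then show ?thesis by simp
  qed
  have xS: "x \<in> S" using r by (simp add: S_def)
  have inS: "\<bar>y $ i\<bar> \<le> r" if "y \<in> S" for y i using that by (auto simp: S_def less_imp_le)
  define f where "f n y = enum_terms (\<lambda>\<beta>. a \<beta> * of_real (mpow \<beta> y)) n" for n y
  define c where "c i n y = enum_terms (\<lambda>\<beta>. pterm i a \<beta> y) n" for i n y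
  define f' where "f' n y h = (\<Sum>i\<in>UNIV. of_real (h $ i) * c i n y)" for n y h
  define g' where "g' y h = (\<Sum>i\<in>UNIV. of_real (h $ i) * pser (pdiff i a) y)" for y h
  have der: "(f n has_derivative f' n y) (at y within S)" for n y
  proof (cases "n \<in> range (to_nat :: ('n \<Rightarrow> nat) \<Rightarrow> nat)")
    case True
    define \<beta> :: "'n \<Rightarrow> nat" where "\<beta> = from_nat n"
    have "((\<lambda>y. a \<beta> * of_real (mpow \<beta> y)) has_derivative
        (\<lambda>h. a \<beta> * of_real (\<Sum>i\<in>UNIV. h $ i * (real (\<beta> i) * mpow (\<beta>(i := \<beta> i - 1)) y)))) (at y within S)"
      by (intro has_derivative_mult_right has_derivative_of_real mpow_has_derivative)
    then show ?thesis
      using True by (simp add: f_def[abs_def] f'_def[abs_def] c_def enum_terms_def \<beta>_def[symmetric] pterm_def sum_distrib_left mult_ac)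
  qed (simp add: f_def[abs_def] f'_def[abs_def] c_def enum_terms_def)
  have psd: "psummable r (pdiff i a)" for i by (rule pdiff_psummable[OF r(1,2) R])
  have uni: "uniform_limit S (\<lambda>n y. \<Sum>k<n. c i k y) (\<lambda>y. pser (pdiff i a) y) sequentially" for i
  proof -
    define B where "B n = enum_terms (\<lambda>\<beta>. norm (a \<beta>) * R ^ mdeg \<beta> / (R - r)) n" for n
    have "(\<lambda>\<beta>. norm (a \<beta>) * R ^ mdeg \<beta> / (R - r)) summable_on UNIV"
      using summable_on_cmult_left[OF R[unfolded psummable_def], of "1 / (R - r)"] by simp
    from has_sum_enum_terms[OF has_sum_infsum[OF this]] have "summable B"
      unfolding B_def[abs_def] by (auto dest: has_sum_imp_sums sums_summable)
    have "uniform_limit S (\<lambda>n y. \<Sum>k<n. c i k y) (\<lambda>y. suminf (\<lambda>k. c i k y)) sequentially"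
    proof (rule Weierstrass_m_test[OF _ \<open>summable B\<close>])
      show "norm (c i n y) \<le> B n" if "y \<in> S" for n y
        using pterm_bound[OF r(1,2) inS[OF that]] by (simp add: c_def B_def enum_terms_def)
    qed
    moreover have "suminf (\<lambda>k. c i k y) = pser (pdiff i a) y" if "y \<in> S" for y
      using has_sum_imp_sums[OF has_sum_enum_terms[OF has_sum_pterm[OF psd inS[OF that], of i]]]
      by (simp add: c_def[abs_def] sums_iff)
    ultimately show ?thesis by (subst uniform_limit_cong'[symmetric]) auto
  qed
  have ev: "\<forall>\<^sub>F n in sequentially. \<forall>y\<in>S. \<forall>h. norm ((\<Sum>k<n. f' k y h) - g' y h) \<le> e * norm h" if "e > 0" for e
  proof -
    \<comment> \<open>Each of the n coordinates may contribute this much to the operator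
      bound.\<close>
    define e' where "e' = e / real CARD('n)"
    have e': "e' > 0" using that by (simp add: e'_def)
    have "\<forall>\<^sub>F n in sequentially. \<forall>i\<in>(UNIV::'n set). \<forall>y\<in>S. dist (\<Sum>k<n. c i k y) (pser (pdiff i a) y) < e'"
    proof (rule eventually_ball_finite[OF finite], rule ballI)
      show "\<forall>\<^sub>F n in sequentially. \<forall>y\<in>S. dist (\<Sum>k<n. c i k y) (pser (pdiff i a) y) < e'" for i
        using uniform_limitD[OF uni e'] .
    qed
    then show ?thesis
    proof eventually_elim
      case (elim n)
      show ?case
      proof (intro ballI allI)
        fix y h assume y: "y \<in> S"
        have "(\<Sum>k<n. f' k y h) - g' y h = (\<Sum>i\<in>UNIV. of_real (h $ i) * ((\<Sum>k<n. c i k y) - pser (pdiff i a) y))"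
          unfolding f'_def g'_def
          by (subst sum.swap) (simp add: sum_subtractf[symmetric] sum_distrib_left right_diff_distrib)
        also have "norm \<dots> \<le> (\<Sum>i\<in>(UNIV::'n set). norm h * e')"
        proof (rule sum_norm_le)
          fix i
          have "norm (of_real (h $ i) * ((\<Sum>k<n. c i k y) - pser (pdiff i a) y)) = \<bar>h $ i\<bar> * dist (\<Sum>k<n. c i k y) (pser (pdiff i a) y)"
            by (simp add: norm_mult dist_norm)
          also have "\<dots> \<le> norm h * e'"
            using elim y component_le_norm_cart[of h i] by (intro mult_mono) (auto simp: less_imp_le)
          finally show "norm (of_real (h $ i) * ((\<Sum>k<n. c i k y) - pser (pdiff i a) y)) \<le> norm h * e'" .
        qed
        also have "\<dots> = e * norm h" by (simp add: e'_def)
        finally show "norm ((\<Sum>k<n. f' k y h) - g' y h) \<le> e * norm h" .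
      qed
    qed
  qed
  have fs: "(\<lambda>n. f n y) sums pser a y" if "y \<in> S" for y
  proof -
    have "\<bar>y $ i\<bar> \<le> R" for i using inS[OF that, of i] r(2) by linarith
    from has_sum_imp_sums[OF has_sum_enum_terms[OF abs_summable_pser(3)[OF R this]]]
    show ?thesis by (simp only: f_def[abs_def])
  qed
  obtain g where g: "\<And>y. y \<in> S \<Longrightarrow> (\<lambda>n. f n y) sums g y" "\<And>y. y \<in> S \<Longrightarrow> (g has_derivative g' y) (at y within S)"
    using has_derivative_series[OF cS der ev xS fs[OF xS]] by blast
  have "g y = pser a y" if "y \<in> S" for y using g(1)[OF that] fs[OF that] by (rule sums_unique2)
  then have "(pser a has_derivative g' x) (at x within S)"
    using has_derivative_transform[OF xS _ g(2)[OF xS]] by metis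
  then show ?thesis unfolding g'_def using at_within_open[OF xS oS] by simp
qed

text \<open>Cubes are used instead of balls because a cube is the set on which \<open>pnorm\<close>
  at one radius controls the series.\<close>

definition chart :: "(real ^ 'n \<Rightarrow> complex) \<Rightarrow> real ^ 'n \<Rightarrow> real \<Rightarrow> (('n \<Rightarrow> nat) \<Rightarrow> complex) \<Rightarrow> bool" where
  "chart f y R a \<longleftrightarrow> 0 < R \<and> psummable R a \<and> (\<forall>z. (\<forall>i. \<bar>z $ i\<bar> < R) \<longrightarrow> f (y + z) = pser a z)"

lemma open_cube: "open {x :: real ^ 'n. \<forall>i. \<bar>(x - y) $ i\<bar> < R}"
proof -
  have "{x :: real ^ 'n. \<forall>i. \<bar>(x - y) $ i\<bar> < R} = (\<Inter>i. {x. \<bar>(x - y) $ i\<bar> < R})" by auto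
  then show ?thesis by (simp only:) (intro open_INT ballI open_Collect_less continuous_intros; simp)
qed

lemma chart_has_derivative:
  assumes c: "chart f y R a" and z: "\<And>i. \<bar>(x - y) $ i\<bar> < R"
  shows "(f has_derivative (\<lambda>h. \<Sum>i\<in>UNIV. of_real (h $ i) * pser (pdiff i a) (x - y))) (at x)"
proof -
  have "((\<lambda>x. pser a (x - y)) has_derivative (\<lambda>h. \<Sum>i\<in>UNIV. of_real (h $ i) * pser (pdiff i a) (x - y))) (at x)"
  proof -
    have 1: "((\<lambda>x. x - y) has_derivative (\<lambda>h. h)) (at x)" by (rule derivative_eq_intros refl | simp)+
    have 2: "(pser a has_derivative (\<lambda>h. \<Sum>i\<in>UNIV. of_real (h $ i) * pser (pdiff i a) (x - y))) (at (x - y))"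
      by (rule pser_has_derivative) (use c z in \<open>auto simp: chart_def\<close>)
    from has_derivative_compose[OF 1 2] show ?thesis .
  qed
  then show ?thesis
  proof (rule has_derivative_transform_within_open[OF _ open_cube[of y R]])
    show "pser a (w - y) = f w" if "w \<in> {x. \<forall>i. \<bar>(x - y) $ i\<bar> < R}" for w
      using c that unfolding chart_def by (metis (no_types, lifting) add.commute diff_add_cancel mem_Collect_eq)
  qed (use z in auto)
qed

lemma chart_iter_partial_Cons:
  assumes c: "chart (iter_partial is f) y R a" and r: "0 < r" "r < R"
  shows "chart (iter_partial (i # is) f) y r (pdiff i a)" and "pnorm r (pdiff i a) \<le> pnorm R a / (R - r)"
proof -
  show "pnorm r (pdiff i a) \<le> pnorm R a / (R - r)"
    using pdiff_psummable[OF r, of a i] c by (simp add: chart_def)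
  have "iter_partial (i # is) f (y + z) = pser (pdiff i a) z" if z: "\<forall>i. \<bar>z $ i\<bar> < r" for z
  proof -
    have "(iter_partial is f has_derivative (\<lambda>h. \<Sum>i\<in>UNIV. of_real (h $ i) * pser (pdiff i a) z)) (at (y + z))"
      using chart_has_derivative[OF c, of "y + z"] z r by (force intro: less_trans)
    from fun_cong[OF frechet_derivative_at[OF this], of "axis i 1"]
    have "iter_partial (i # is) f (y + z) = (\<Sum>j\<in>UNIV. of_real (axis i 1 $ j) * pser (pdiff j a) z)"
      by simp
    also have "\<dots> = (\<Sum>j\<in>UNIV. if j = i then pser (pdiff i a) z else 0)"
      by (intro sum.cong) (auto simp: axis_def)
    finally show ?thesis by simp
  qed
  then show "chart (iter_partial (i # is) f) y r (pdiff i a)"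
    using c r pdiff_psummable(1)[OF r, of a i] by (simp add: chart_def)
qed

text \<open>Every derivative spends \<delta> of the radius and costs a factor 1/\<delta>.\<close>

lemma chart_iter_partial:
  assumes "chart f y R a" "0 < \<delta>" "real (length is) * \<delta> < R"
  shows "chart (iter_partial is f) y (R - real (length is) * \<delta>) (foldr pdiff is a) \<and>
    pnorm (R - real (length is) * \<delta>) (foldr pdiff is a) \<le> pnorm R a / \<delta> ^ length is"
  using assms(3)
proof (induction "is")
  case (Cons i "is")
  have "real (length is) * \<delta> < R" using Cons.prems assms(2) by (simp add: distrib_right)
  note IH = Cons.IH[OF this]
  have eq: "R - real (length is) * \<delta> - (R - real (length (i # is)) * \<delta>) = \<delta>" by (simp add: algebra_simps)
  have r: "0 < R - real (length (i # is)) * \<delta>" "R - real (length (i # is)) * \<delta> < R - real (length is) * \<delta>"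
    using Cons.prems assms(2) by (auto simp: algebra_simps)
  note C = chart_iter_partial_Cons[OF conjunct1[OF IH] r, of i, unfolded eq]
  have "pnorm (R - real (length is) * \<delta>) (foldr pdiff is a) / \<delta> \<le> pnorm R a / \<delta> ^ length is / \<delta>"
    using IH assms(2) by (intro divide_right_mono) auto
  with C show ?case by (simp add: mult.commute)
qed (use assms in auto)

text \<open>Each of the \<open>l\<close> derivatives shrinks the radius by $R/(2l)$, whence the factor $l^l$.\<close>

lemma chart_bound:
  assumes c: "chart f y R a" and x: "\<And>i. \<bar>(x - y) $ i\<bar> < R / 2"
  shows "norm (iter_partial is f x) \<le> pnorm R a * (real (length is) / (R / 2)) ^ length is"
    and "iter_partial is f differentiable (at x)"
proof -
  have R: "R > 0" using c by (simp add: chart_def)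
  obtain r where r: "R / 2 \<le> r" "chart (iter_partial is f) y r (foldr pdiff is a)"
    "pnorm r (foldr pdiff is a) \<le> pnorm R a * (real (length is) / (R / 2)) ^ length is"
  proof (cases "is")
    \<comment> \<open>No radius is spent here; the claimed factor is 0^0 = 1.\<close>
    case Nil
    then show ?thesis using that[of R] c R by simp
  next
    case (Cons j js)
    define \<delta> where "\<delta> = R / (2 * real (length is))"
    have l: "real (length is) > 0" using Cons by simp
    then have ld: "real (length is) * \<delta> = R / 2" by (simp add: \<delta>_def)
    have "\<delta> > 0" using l R by (simp add: \<delta>_def)
    from chart_iter_partial[OF c this, of "is"] show ?thesis
      using that[of "R / 2"] R l unfolding ld by (simp add: \<delta>_def power_divide mult_ac)
  qed
  have x': "\<bar>(x - y) $ i\<bar> < r" for i using x[of i] r(1) by linarith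
  have "iter_partial is f (y + (x - y)) = pser (foldr pdiff is a) (x - y)"
    using r(2) x' unfolding chart_def by blast
  then have "norm (iter_partial is f x) \<le> pnorm r (foldr pdiff is a)"
    using abs_summable_pser(2)[of r "foldr pdiff is a" "x - y"] r(2) x' by (simp add: chart_def less_imp_le)
  with r(3) show "norm (iter_partial is f x) \<le> pnorm R a * (real (length is) / (R / 2)) ^ length is" by linarith
  show "iter_partial is f differentiable (at x)"
    using chart_has_derivative[OF r(2) x'] by (auto simp: differentiable_def)
qed

lemma foldr_pdiff_commute: "foldr pdiff is (foldr pdiff js a) = foldr pdiff js (foldr pdiff is a)"
proof (induction "is")
  case (Cons i "is")
  have "pdiff i (foldr pdiff js b) = foldr pdiff js (pdiff i b)" for b
    by (induction js) (auto simp: pdiff_commute[of i])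
  with Cons show ?case by simp
qed simp

text \<open>At the centre of a chart both sides are values at 0 of formal derivatives, which
  commute. The symmetry serves to exchange derivatives in \<open>x\<close> with those along
  \<open>s\<close>.\<close>

lemma chart_commute:
  assumes c: "chart f y R a"
  shows "iter_partial (is @ js) f y = iter_partial (js @ is) f y"
proof -
  have R: "R > 0" using c by (simp add: chart_def)
  \<comment> \<open>Leaves more than half of the radius after all derivatives; the added 1 covers
    the empty list.\<close>
  define \<delta> where "\<delta> = R / (2 * real (length (is @ js) + 1))"
  have d: "\<delta> > 0" using R by (simp add: \<delta>_def)
  have l: "real (length ks) * \<delta> < R" if "length ks = length (is @ js)" for ks :: "'a list"
  proof -
    define N where "N = real (length (is @ js))"
    have "N \<ge> 0" by (simp add: N_def)
    then have "R = 2 * (N + 1) * \<delta>" unfolding \<delta>_def N_def[symmetric] of_nat_add of_nat_1 by simp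
    then have "R = 2 * (N * \<delta>) + 2 * \<delta>" by (simp add: algebra_simps)
    then have "R = 2 * (real (length ks) * \<delta>) + 2 * \<delta>" unfolding that N_def .
    moreover have "0 \<le> real (length ks) * \<delta>" using d by simp
    ultimately show ?thesis using d by linarith
  qed
  have "iter_partial ks f y = pser (foldr pdiff ks a) 0" if "length ks = length (is @ js)" for ks
    using chart_iter_partial[OF c d l[OF that]] unfolding chart_def
    by (metis (no_types, lifting) abs_zero add.right_neutral zero_index)
  from this[of "is @ js"] this[of "js @ is"] show ?thesis by (simp add: foldr_pdiff_commute)
qed

text \<open>Convergence at the corner (R, ..., R) is unconditional, hence absolute, and gives
  summability of the majorant. The radius is r/(2n) so that this corner lies in the ball of
  convergence.\<close>

lemma real_analytic_chart:
  fixes f :: "real ^ 'n \<Rightarrow> complex"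
  assumes f: "real_analytic_fun_on U f" and y: "y \<in> U"
  obtains R a where "chart f y R a"
proof -
  from f y obtain r where R: "r > 0 \<and> (\<exists>a. \<forall>x\<in>ball y r. ((\<lambda>\<beta>. a \<beta> * of_real (\<Prod>i\<in>UNIV. (x $ i - y $ i) ^ \<beta> i)) has_sum f x) UNIV)"
    unfolding real_analytic_fun_on_def by blast
  then have r: "r > 0" ..
  from R have "\<exists>a. \<forall>x\<in>ball y r. ((\<lambda>\<beta>. a \<beta> * of_real (\<Prod>i\<in>UNIV. (x $ i - y $ i) ^ \<beta> i)) has_sum f x) UNIV" ..
  then obtain a where a: "\<forall>x\<in>ball y r. ((\<lambda>\<beta>. a \<beta> * of_real (\<Prod>i\<in>UNIV. (x $ i - y $ i) ^ \<beta> i)) has_sum f x) UNIV" ..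
  define R where "R = r / (2 * real CARD('n))"
  have R: "R > 0" using r by (simp add: R_def)
  have in_ball: "y + z \<in> ball y r" if "\<And>i. \<bar>z $ i\<bar> \<le> R" for z
  proof -
    have "norm z \<le> (\<Sum>i\<in>UNIV. \<bar>z $ i\<bar>)" by (rule norm_le_l1_cart)
    also have "\<dots> \<le> (\<Sum>i\<in>(UNIV::'n set). R)" by (intro sum_mono that)
    also have "\<dots> < r" using r by (simp add: R_def)
    finally show ?thesis by (simp add: dist_norm)
  qed
  have hs: "((\<lambda>\<beta>. a \<beta> * of_real (mpow \<beta> z)) has_sum f (y + z)) UNIV" if "\<And>i. \<bar>z $ i\<bar> \<le> R" for z
    using bspec[OF a in_ball[OF that]] by (simp add: mpow_def)
  have "chart f y R a"
    unfolding chart_def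
  proof (intro conjI allI impI R)
    have "mpow \<beta> (\<chi> i. R) = R ^ mdeg \<beta>" for \<beta> :: "'n \<Rightarrow> nat" by (simp add: mpow_def mdeg_def power_sum)
    moreover have "(\<lambda>\<beta>. a \<beta> * of_real (mpow \<beta> (\<chi> i. R))) summable_on UNIV"
      using hs[of "\<chi> i. R"] R by (auto intro: has_sum_imp_summable)
    then have "(\<lambda>\<beta>. norm (a \<beta> * of_real (mpow \<beta> (\<chi> i. R)))) summable_on UNIV"
      by (rule summable_on_iff_abs_summable_on_complex[THEN iffD1])
    ultimately show "psummable R a" using R by (simp add: psummable_def norm_mult norm_power)
    fix z :: "real ^ 'n" assume "\<forall>i. \<bar>z $ i\<bar> < R"
    then have "\<And>i. \<bar>z $ i\<bar> \<le> R" by (simp add: less_imp_le)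
    from infsumI[OF hs[OF this]] show "f (y + z) = pser a z" by (simp add: pser_def)
  qed
  then show ?thesis using that by blast
qed

lemma linear_axis_expansion:
  fixes D :: "real ^ 'n \<Rightarrow> 'b::real_vector"
  assumes "linear D"
  shows "D h = (\<Sum>j\<in>UNIV. (h $ j) *\<^sub>R D (axis j 1))"
proof -
  interpret linear D by fact
  have "h = (\<Sum>j\<in>UNIV. (h $ j) *\<^sub>R axis j 1)"
    using basis_expansion[of h] by (simp add: scalar_mult_eq_scaleR)
  then have "D h = D (\<Sum>j\<in>UNIV. (h $ j) *\<^sub>R axis j 1)" by (rule arg_cong)
  then show ?thesis unfolding sum scale .
qed

lemma real_analytic_iter_partial:
  fixes f :: "real ^ 'n \<Rightarrow> complex"
  assumes f: "real_analytic_fun_on U f" and y: "y \<in> U"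
  shows "iter_partial is f differentiable (at y)"
    and "iter_partial (is @ js) f y = iter_partial (js @ is) f y"
    and "(iter_partial is f has_derivative (\<lambda>h. \<Sum>i\<in>UNIV. of_real (h $ i) * iter_partial (i # is) f y)) (at y)"
proof -
  obtain R a where c: "chart f y R a" using real_analytic_chart[OF f y] .
  show d: "iter_partial is f differentiable (at y)" using chart_bound(2)[OF c] c by (simp add: chart_def)
  show "iter_partial (is @ js) f y = iter_partial (js @ is) f y" by (rule chart_commute[OF c])
  let ?D = "frechet_derivative (iter_partial is f) (at y)"
  have D: "(iter_partial is f has_derivative ?D) (at y)" using d by (simp add: frechet_derivative_works)
  have eq: "?D = (\<lambda>h. \<Sum>i\<in>UNIV. of_real (h $ i) * iter_partial (i # is) f y)"
  proof
    fix h
    have "?D h = (\<Sum>i\<in>UNIV. (h $ i) *\<^sub>R ?D (axis i 1))"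
      by (rule linear_axis_expansion[OF has_derivative_linear[OF D]])
    then show "?D h = (\<Sum>i\<in>UNIV. of_real (h $ i) * iter_partial (i # is) f y)"
      by (simp add: scaleR_conv_of_real)
  qed
  from D show "(iter_partial is f has_derivative (\<lambda>h. \<Sum>i\<in>UNIV. of_real (h $ i) * iter_partial (i # is) f y)) (at y)"
    unfolding eq .
qed

text \<open>Half cubes of charts cover \<open>K\<close> and finitely many suffice; \<open>B\<close>
  adds their norms, and \<delta> lies below all their half radii. The growth l^l is harmless later,
  since Taylor's formula divides by l!.\<close>

lemma real_analytic_compact_bound:
  fixes f :: "real ^ 'n \<Rightarrow> complex"
  assumes f: "real_analytic_fun_on U f" and K: "compact K" "K \<subseteq> U"
  obtains B \<delta> where "B \<ge> 0" "\<delta> > 0"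
    "\<And>is y. y \<in> K \<Longrightarrow> norm (iter_partial is f y) \<le> B * (real (length is) / \<delta>) ^ length is"
proof -
  have "\<forall>y. \<exists>R a. y \<in> U \<longrightarrow> chart f y R a" using real_analytic_chart[OF f] by metis
  then obtain R a where c: "\<And>y. y \<in> U \<Longrightarrow> chart f y (R y) (a y)" by metis
  then have R: "R y > 0" if "y \<in> U" for y using that by (simp add: chart_def)
  define W where "W y = {x. \<forall>i. \<bar>(x - y) $ i\<bar> < R y / 2}" for y
  have "K \<subseteq> (\<Union>y\<in>K. W y)" using K R unfolding W_def by fastforce
  moreover have "open (W y)" for y unfolding W_def by (rule open_cube)
  ultimately obtain F where F: "F \<subseteq> K" "finite F" "K \<subseteq> (\<Union>y\<in>F. W y)"
    using compactE_image[OF K(1), of K W] by metis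
  define \<delta> where "\<delta> = Min (insert 1 ((\<lambda>y. R y / 2) ` F))"
  define B where "B = (\<Sum>y\<in>F. pnorm (R y) (a y))"
  have \<delta>: "\<delta> > 0" unfolding \<delta>_def using F R K by (subst Min_gr_iff) auto
  have pn: "pnorm (R y) (a y) \<ge> 0" if "y \<in> F" for y
    unfolding pnorm_def using R[of y] that F K by (intro infsum_nonneg) (auto simp: less_imp_le)
  have "B \<ge> 0" unfolding B_def by (intro sum_nonneg pn)
  moreover have "norm (iter_partial is f x) \<le> B * (real (length is) / \<delta>) ^ length is" if xK: "x \<in> K" for "is" x
  proof -
    obtain y where y: "y \<in> F" "x \<in> W y" using F xK by blast
    have Ry: "R y > 0" using y F K R by blast
    have "norm (iter_partial is f x) \<le> pnorm (R y) (a y) * (real (length is) / (R y / 2)) ^ length is"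
      using chart_bound(1)[OF c[of y]] y F K unfolding W_def by blast
    also have "\<dots> \<le> B * (real (length is) / \<delta>) ^ length is"
    proof (intro mult_mono power_mono divide_left_mono)
      show "pnorm (R y) (a y) \<le> B" unfolding B_def using y F pn by (intro member_le_sum) auto
      show "\<delta> \<le> R y / 2" unfolding \<delta>_def using y F by (intro Min_le) auto
    qed (use \<open>B \<ge> 0\<close> \<delta> Ry in auto)
    finally show ?thesis .
  qed
  ultimately show ?thesis using that \<delta> by blast
qed

text \<open>Makes the derivative bounds available for \<open>iter_partial is g\<close> in place of
  \<open>g\<close>, as the norm of the target space asks for.\<close>

lemma real_analytic_iter_partial_analytic:
  fixes f :: "real ^ 'n \<Rightarrow> complex"
  assumes f: "real_analytic_fun_on U f"
  shows "real_analytic_fun_on U (iter_partial is f)"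
  unfolding real_analytic_fun_on_def
proof
  fix y assume "y \<in> U"
  then obtain R a where c: "chart f y R a" using real_analytic_chart[OF f] by blast
  \<comment> \<open>With this choice a positive radius is left after all derivatives.\<close>
  define \<delta> where "\<delta> = R / (real (length is) + 1)"
  have R: "R > 0" using c by (simp add: chart_def)
  have "real (length is) * R < R * (real (length is) + 1)" using R by (simp add: algebra_simps)
  then have "\<delta> > 0" "real (length is) * \<delta> < R" using R by (auto simp: \<delta>_def pos_divide_less_eq)
  then obtain r b where r: "chart (iter_partial is f) y r b" using chart_iter_partial[OF c] by blast
  have "((\<lambda>\<beta>. b \<beta> * of_real (\<Prod>i\<in>UNIV. (x $ i - y $ i) ^ \<beta> i)) has_sum iter_partial is f x) UNIV" if x: "x \<in> ball y r" for x
  proof -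
    have z: "\<bar>(x - y) $ i\<bar> < r" for i
      using component_le_norm_cart[of "x - y" i] x by (simp add: dist_norm norm_minus_commute)
    have "iter_partial is f (y + (x - y)) = pser b (x - y)"
      using r z unfolding chart_def by blast
    then show ?thesis
      using abs_summable_pser(3)[of r b "x - y"] r z by (simp add: chart_def mpow_def less_imp_le)
  qed
  moreover have "r > 0" using r by (simp add: chart_def)
  ultimately show "\<exists>r>0. \<exists>a. \<forall>x\<in>ball y r. ((\<lambda>\<beta>. a \<beta> * of_real (\<Prod>i\<in>UNIV. (x $ i - y $ i) ^ \<beta> i)) has_sum iter_partial is f x) UNIV"
    by (intro exI[of _ r] conjI exI[of _ b] ballI)
qed

lemma iter_partial_append: "iter_partial (is @ js) f = iter_partial is (iter_partial js f)"
  by (induction "is") simp_all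

lemma lists_of_length_Suc: "{js :: 'n list. length js = Suc m} = (\<lambda>(i, js). i # js) ` (UNIV \<times> {js. length js = m})"
  by (auto simp: length_Suc_conv image_iff)

section \<open>Taylor expansion along lines\<close>

lemma card_lists_of_length: "card {js :: 'n::finite list. length js = m} = CARD('n) ^ m"
  and finite_lists_of_length_le: "finite {js :: 'n::finite list. length js \<le> m}"
  using card_lists_length_eq[of "UNIV :: 'n set" m] finite_lists_length_le[of "UNIV :: 'n set" m] by simp_all

text \<open>The m-th derivative in the direction \<open>v\<close>. Summing over words
  \<open>js\<close> instead of multi-indices avoids multinomial coefficients.\<close>

definition dir_deriv :: "real ^ 'n \<Rightarrow> nat \<Rightarrow> (real ^ 'n \<Rightarrow> complex) \<Rightarrow> real ^ 'n \<Rightarrow> complex" where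
  "dir_deriv v m f y = (\<Sum>js | length js = m. of_real (prod_list (map (($) v) js)) * iter_partial js f y)"

lemma dir_deriv_0: "dir_deriv v 0 f y = f y"
proof -
  have "{js :: 'a list. length js = 0} = {[]}" by auto
  then show ?thesis by (simp add: dir_deriv_def)
qed

text \<open>A word of length m + 1 is a letter followed by a word of length m, so differentiating
  once more along the line only lengthens the words.\<close>

lemma dir_deriv_has_vector_derivative:
  fixes f :: "real ^ 'n \<Rightarrow> complex"
  assumes f: "real_analytic_fun_on U f" and y: "u + t *\<^sub>R v \<in> U"
  shows "((\<lambda>t. dir_deriv v m f (u + t *\<^sub>R v)) has_vector_derivative dir_deriv v (Suc m) f (u + t *\<^sub>R v)) (at t)"
proof -
  have d: "((\<lambda>t. iter_partial js f (u + t *\<^sub>R v)) has_vector_derivative (\<Sum>i\<in>UNIV. of_real (v $ i) * iter_partial (i # js) f (u + t *\<^sub>R v))) (at t)" for js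
  proof -
    have 1: "((\<lambda>t. u + t *\<^sub>R v) has_derivative (\<lambda>h. h *\<^sub>R v)) (at t)"
      by (auto intro!: derivative_eq_intros)
    have "complex_of_real (h * c) * z = h *\<^sub>R (of_real c * z)" for h c z by (simp add: scaleR_conv_of_real)
    with has_derivative_compose[OF 1 real_analytic_iter_partial(3)[OF f y, of js]]
    show ?thesis unfolding has_vector_derivative_def
      by (simp add: scaleR_sum_right del: iter_partial.simps of_real_mult)
  qed
  have "((\<lambda>t. dir_deriv v m f (u + t *\<^sub>R v)) has_vector_derivative
    (\<Sum>js | length js = m. of_real (prod_list (map (($) v) js)) * (\<Sum>i\<in>UNIV. of_real (v $ i) * iter_partial (i # js) f (u + t *\<^sub>R v)))) (at t)"
    unfolding dir_deriv_def by (intro has_vector_derivative_sum has_vector_derivative_mult_right d)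
  also have "(\<Sum>js | length js = m. of_real (prod_list (map (($) v) js)) * (\<Sum>i\<in>UNIV. of_real (v $ i) * iter_partial (i # js) f (u + t *\<^sub>R v)))
    = dir_deriv v (Suc m) f (u + t *\<^sub>R v)"
  proof -
    have inj: "inj_on (\<lambda>(i, js). i # js) (UNIV \<times> {js :: 'n list. length js = m})" by (auto simp: inj_on_def)
    have "dir_deriv v (Suc m) f (u + t *\<^sub>R v) =
      (\<Sum>i\<in>UNIV. \<Sum>js | length js = m. of_real (v $ i * prod_list (map (($) v) js)) * iter_partial (i # js) f (u + t *\<^sub>R v))"
      unfolding dir_deriv_def lists_of_length_Suc
      by (subst sum.reindex[OF inj]) (simp add: sum.cartesian_product case_prod_beta del: iter_partial.simps)
    also have "\<dots> = (\<Sum>js | length js = m. \<Sum>i\<in>UNIV. of_real (v $ i * prod_list (map (($) v) js)) * iter_partial (i # js) f (u + t *\<^sub>R v))"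
      by (rule sum.swap)
    finally show ?thesis by (simp add: sum_distrib_left mult_ac del: iter_partial.simps)
  qed
  finally show ?thesis .
qed

lemma norm_dir_deriv_le:
  fixes v :: "real ^ 'n"
  assumes v: "\<And>i. \<bar>v $ i\<bar> \<le> R" and b: "\<And>js. length js = m \<Longrightarrow> norm (iter_partial js f y) \<le> b"
  shows "norm (dir_deriv v m f y) \<le> (real CARD('n) * R) ^ m * b"
proof -
  have R: "0 \<le> R" using v by (meson abs_ge_zero order.trans)
  have pl: "\<bar>prod_list (map (($) v) js)\<bar> \<le> R ^ length js" for js
    by (induction js) (auto simp: abs_mult intro!: mult_mono v R)
  have "norm (dir_deriv v m f y) \<le> (\<Sum>js :: 'n list | length js = m. R ^ m * b)"
    unfolding dir_deriv_def
  proof (rule sum_norm_le)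
    fix js :: "'n list" assume "js \<in> {js. length js = m}"
    then show "norm (of_real (prod_list (map (($) v) js)) * iter_partial js f y) \<le> R ^ m * b"
      using pl[of js] b[of js] R unfolding norm_mult norm_of_real by (intro mult_mono) auto
  qed
  also have "\<dots> = (real CARD('n) * R) ^ m * b"
    by (simp add: card_lists_of_length power_mult_distrib)
  finally show ?thesis .
qed

lemma real_taylor_bound:
  fixes h :: "nat \<Rightarrow> real \<Rightarrow> real"
  assumes N: "N > 0" and d: "\<And>m t. \<bar>t\<bar> \<le> \<bar>\<tau>\<bar> \<Longrightarrow> (h m has_real_derivative h (Suc m) t) (at t)"
    and b: "\<And>t. \<bar>t\<bar> \<le> \<bar>\<tau>\<bar> \<Longrightarrow> \<bar>h N t\<bar> \<le> b"
  shows "\<bar>h 0 \<tau> - (\<Sum>m<N. h m 0 / fact m * \<tau> ^ m)\<bar> \<le> b / fact N * \<bar>\<tau>\<bar> ^ N"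
proof (cases "\<tau> = 0")
  case True
  \<comment> \<open>\<open>Taylor\<close> needs \<tau> to differ from the point of expansion; here
    both sides vanish, since N > 0.\<close>
  obtain N' where "N = Suc N'" using N gr0_conv_Suc by blast
  then show ?thesis using True by (simp add: sum.lessThan_Suc_shift)
next
  case False
  obtain t where t: "\<bar>t\<bar> \<le> \<bar>\<tau>\<bar>" "h 0 \<tau> = (\<Sum>m<N. h m 0 / fact m * (\<tau> - 0) ^ m) + h N t / fact N * (\<tau> - 0) ^ N"
  proof -
    have D: "\<forall>m t. m < N \<and> - \<bar>\<tau>\<bar> \<le> t \<and> t \<le> \<bar>\<tau>\<bar> \<longrightarrow> (h m has_real_derivative h (Suc m) t) (at t)"
      using d by (auto intro: abs_leI)
    have "\<exists>t. (if \<tau> < 0 then \<tau> < t \<and> t < 0 else 0 < t \<and> t < \<tau>) \<and>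
        h 0 \<tau> = (\<Sum>m<N. h m 0 / fact m * (\<tau> - 0) ^ m) + h N t / fact N * (\<tau> - 0) ^ N"
      by (rule Taylor[OF N refl D]) (use False in auto)
    then obtain t where t: "if \<tau> < 0 then \<tau> < t \<and> t < 0 else 0 < t \<and> t < \<tau>"
        "h 0 \<tau> = (\<Sum>m<N. h m 0 / fact m * (\<tau> - 0) ^ m) + h N t / fact N * (\<tau> - 0) ^ N" by blast
    have "\<bar>t\<bar> \<le> \<bar>\<tau>\<bar>" using t(1) by (auto split: if_splits)
    then show ?thesis using that t(2) by blast
  qed
  have "\<bar>h 0 \<tau> - (\<Sum>m<N. h m 0 / fact m * \<tau> ^ m)\<bar> = \<bar>h N t\<bar> / fact N * \<bar>\<tau>\<bar> ^ N"
    using t(2) by (simp add: abs_mult power_abs)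
  also have "\<dots> \<le> b / fact N * \<bar>\<tau>\<bar> ^ N"
    by (intro mult_right_mono divide_right_mono b t) auto
  finally show ?thesis .
qed

text \<open>The N-th derivative may grow like (N/\<delta>)^N; division by N! leaves N^N/N! \<le> exp
  N, which is the factor \<open>exp 1\<close> in the geometric ratio. The 2 arises because the
  Lagrange remainder is applied to the real and the imaginary part separately.\<close>

lemma dir_deriv_taylor:
  fixes f :: "real ^ 'n \<Rightarrow> complex"
  assumes f: "real_analytic_fun_on U f" and KU: "K \<subseteq> U"
    and path: "\<And>t. \<bar>t\<bar> \<le> \<bar>\<tau>\<bar> \<Longrightarrow> u + t *\<^sub>R v \<in> K"
    and v: "\<And>i. \<bar>v $ i\<bar> \<le> R" and \<delta>: "\<delta> > 0" and B: "B \<ge> 0"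
    and b: "\<And>js y. y \<in> K \<Longrightarrow> norm (iter_partial js f y) \<le> B * (real (length js) / \<delta>) ^ length js"
    and N: "N > 0"
  shows "norm (f (u + \<tau> *\<^sub>R v) - (\<Sum>m<N. of_real (\<tau> ^ m / fact m) * dir_deriv v m f u))
    \<le> 2 * B * (real CARD('n) * R * exp 1 * \<bar>\<tau>\<bar> / \<delta>) ^ N"
proof -
  define h where "h m t = dir_deriv v m f (u + t *\<^sub>R v)" for m t
  define b where "b = (real CARD('n) * R) ^ N * (B * (real N / \<delta>) ^ N)"
  have R: "0 \<le> R" using v by (meson abs_ge_zero order.trans)
  have der: "(h m has_vector_derivative h (Suc m) t) (at t)" if "\<bar>t\<bar> \<le> \<bar>\<tau>\<bar>" for m t
    unfolding h_def by (rule dir_deriv_has_vector_derivative[OF f]) (use path[OF that] KU in blast)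
  have hb: "norm (h N t) \<le> b" if "\<bar>t\<bar> \<le> \<bar>\<tau>\<bar>" for t
    unfolding h_def b_def by (rule norm_dir_deriv_le[OF v]) (use assms(7)[OF path[OF that]] in auto)
  have re: "((\<lambda>t. Re (h m t)) has_real_derivative Re (h (Suc m) t)) (at t)" if "\<bar>t\<bar> \<le> \<bar>\<tau>\<bar>" for m t
    using bounded_linear.has_vector_derivative[OF bounded_linear_Re der[OF that]]
    by (simp add: has_real_derivative_iff_has_vector_derivative)
  have im: "((\<lambda>t. Im (h m t)) has_real_derivative Im (h (Suc m) t)) (at t)" if "\<bar>t\<bar> \<le> \<bar>\<tau>\<bar>" for m t
    using bounded_linear.has_vector_derivative[OF bounded_linear_Im der[OF that]]
    by (simp add: has_real_derivative_iff_has_vector_derivative)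
  define r where "r = h 0 \<tau> - (\<Sum>m<N. of_real (\<tau> ^ m / fact m) * h m 0)"
  have Rr: "Re r = Re (h 0 \<tau>) - (\<Sum>m<N. Re (h m 0) / fact m * \<tau> ^ m)"
    and Ir: "Im r = Im (h 0 \<tau>) - (\<Sum>m<N. Im (h m 0) / fact m * \<tau> ^ m)"
    unfolding r_def scaleR_conv_of_real[symmetric] by (simp_all add: mult.commute)
  have "\<bar>Re r\<bar> \<le> b / fact N * \<bar>\<tau>\<bar> ^ N"
    using real_taylor_bound[of N \<tau> "\<lambda>m t. Re (h m t)" b, OF N re] order.trans[OF abs_Re_le_cmod hb]
    by (simp add: Rr)
  moreover have "\<bar>Im r\<bar> \<le> b / fact N * \<bar>\<tau>\<bar> ^ N"
    using real_taylor_bound[of N \<tau> "\<lambda>m t. Im (h m t)" b, OF N im] order.trans[OF abs_Im_le_cmod hb]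
    by (simp add: Ir)
  ultimately have "norm r \<le> 2 * (b / fact N * \<bar>\<tau>\<bar> ^ N)"
    using cmod_le[of r] by linarith
  also have "\<dots> = 2 * B * (real CARD('n) * R * \<bar>\<tau>\<bar> / \<delta>) ^ N * (real N ^ N / fact N)"
    by (simp add: b_def power_mult_distrib power_divide)
  also have "\<dots> \<le> 2 * B * (real CARD('n) * R * \<bar>\<tau>\<bar> / \<delta>) ^ N * exp (real N)"
    using B R \<delta> by (intro mult_left_mono power_div_fact_le_exp mult_nonneg_nonneg zero_le_power divide_nonneg_nonneg) auto
  also have "exp (real N) = exp 1 ^ N" by (simp add: exp_of_nat_mult[symmetric])
  also have "2 * B * (real CARD('n) * R * \<bar>\<tau>\<bar> / \<delta>) ^ N * exp 1 ^ N = 2 * B * (real CARD('n) * R * exp 1 * \<bar>\<tau>\<bar> / \<delta>) ^ N"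
    by (simp add: power_mult_distrib[symmetric] mult_ac)
  finally show ?thesis by (simp add: r_def h_def dir_deriv_0)
qed

section \<open>Norms of the function spaces\<close>

lemma holder_on_imp_continuous_on:
  fixes f :: "'a::metric_space \<Rightarrow> 'b::real_normed_vector"
  assumes "holder_on \<alpha> S f" "\<alpha> > 0"
  shows "continuous_on S f"
proof -
  obtain C where C: "\<And>x y. x \<in> S \<Longrightarrow> y \<in> S \<Longrightarrow> norm (f x - f y) \<le> C * dist x y powr \<alpha>"
    using assms(1) unfolding holder_on_def by blast
  show ?thesis
    unfolding continuous_on_iff
  proof (intro ballI allI impI)
    fix x e assume x: "x \<in> S" and e: "(e::real) > 0"
    define d where "d = (e / (\<bar>C\<bar> + 1)) powr (1 / \<alpha>)"
    have q: "e / (\<bar>C\<bar> + 1) > 0" using e by (simp add: add_nonneg_pos)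
    have "dist (f y) (f x) < e" if "y \<in> S" "dist y x < d" for y
    proof -
      have "dist y x powr \<alpha> \<le> d powr \<alpha>" using that assms(2) by (intro powr_mono2) auto
      also have "\<dots> = e / (\<bar>C\<bar> + 1)" using less_imp_neq[OF q] q e assms(2) by (simp add: d_def powr_powr)
      finally have le: "dist y x powr \<alpha> \<le> e / (\<bar>C\<bar> + 1)" .
      have "dist (f y) (f x) \<le> C * dist y x powr \<alpha>" using C[OF that(1) x] by (simp add: dist_norm)
      also have "\<dots> \<le> \<bar>C\<bar> * dist y x powr \<alpha>" by (intro mult_right_mono) auto
      also have "\<dots> \<le> \<bar>C\<bar> * (e / (\<bar>C\<bar> + 1))" by (intro mult_left_mono le) auto
      also have "\<dots> < e" using e by (simp add: pos_divide_less_eq add_nonneg_pos algebra_simps)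
      finally show ?thesis .
    qed
    moreover have "d > 0" unfolding d_def powr_gt_zero by (rule not_sym[OF less_imp_neq[OF q]])
    ultimately show "\<exists>d>0. \<forall>y\<in>S. dist y x < d \<longrightarrow> dist (f y) (f x) < e" by blast
  qed
qed

lemma sup_norm_nonneg_le:
  assumes "\<And>x. x \<in> S \<Longrightarrow> norm (f x) \<le> c" "c \<ge> 0"
  shows "0 \<le> sup_norm S f" and "sup_norm S f \<le> c" and "x \<in> S \<Longrightarrow> norm (f x) \<le> sup_norm S f"
proof -
  have bdd: "bdd_above (insert 0 ((\<lambda>x. norm (f x)) ` S))" using assms by (auto intro!: bdd_aboveI[of _ c])
  show "0 \<le> sup_norm S f" unfolding sup_norm_def by (rule cSup_upper[OF _ bdd]) simp
  show "sup_norm S f \<le> c" unfolding sup_norm_def by (rule cSup_least) (use assms in auto)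
  show "x \<in> S \<Longrightarrow> norm (f x) \<le> sup_norm S f" unfolding sup_norm_def by (rule cSup_upper[OF _ bdd]) simp
qed

text \<open>The two parts of the norm are suprema of sets of reals, which are upper bounds only once
  the sets are known to be bounded: the first by compactness, the second by the Hoelder
  constant.\<close>

lemma holder_space_norm:
  assumes \<theta>: "\<theta> \<in> fns (holder_space \<alpha> K)" and \<alpha>: "\<alpha> > 0" and K: "compact K" and s: "s \<in> K"
  shows "norm (\<theta> s) \<le> nrm (holder_space \<alpha> K) \<theta>"
proof -
  have h: "holder_on \<alpha> K \<theta>" using \<theta> by (simp add: holder_space_def)
  then have c: "continuous_on K \<theta>" using \<alpha> by (rule holder_on_imp_continuous_on)
  have "bounded (\<theta> ` K)" by (intro compact_imp_bounded compact_continuous_image c K)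
  then obtain b where b: "b > 0" "\<And>x. x \<in> K \<Longrightarrow> norm (\<theta> x) \<le> b" unfolding bounded_pos by auto
  obtain C where C: "\<And>x y. x \<in> K \<Longrightarrow> y \<in> K \<Longrightarrow> norm (\<theta> x - \<theta> y) \<le> C * dist x y powr \<alpha>"
    using h unfolding holder_on_def by blast
  have "bdd_above (insert 0 {norm (\<theta> x - \<theta> y) / dist x y powr \<alpha> | x y. x \<in> K \<and> y \<in> K \<and> x \<noteq> y})"
  proof (rule bdd_aboveI[of _ "\<bar>C\<bar>"])
    fix r assume "r \<in> insert 0 {norm (\<theta> x - \<theta> y) / dist x y powr \<alpha> | x y. x \<in> K \<and> y \<in> K \<and> x \<noteq> y}"
    then consider "r = 0" | x y where "x \<in> K" "y \<in> K" "x \<noteq> y" "r = norm (\<theta> x - \<theta> y) / dist x y powr \<alpha>" by blast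
    then show "r \<le> \<bar>C\<bar>"
    proof cases
      case 2
      then have "r \<le> C" using C[of x y] by (simp add: pos_divide_le_eq)
      then show ?thesis by simp
    qed simp
  qed
  then have "0 \<le> holder_seminorm \<alpha> K \<theta>" unfolding holder_seminorm_def by (intro cSup_upper) auto
  moreover have "norm (\<theta> s) \<le> sup_norm K \<theta>" using b s by (intro sup_norm_nonneg_le(3)) auto
  ultimately show ?thesis by (simp add: holder_space_def)
qed

lemma holder_space_zero: "(\<lambda>_. 0) \<in> fns (holder_space \<alpha> K)" "nrm (holder_space \<alpha> K) (\<lambda>_. 0) = 0"
proof -
  show "(\<lambda>_. 0) \<in> fns (holder_space \<alpha> K)" by (auto simp: holder_space_def holder_on_def intro!: exI[of _ 0])
  have 1: "insert 0 ((\<lambda>x. norm (0::complex)) ` K) = {0}" by auto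
  have 2: "insert 0 {norm (0 - 0 :: complex) / dist x y powr \<alpha> | x y. x \<in> K \<and> y \<in> K \<and> x \<noteq> y} = {0}" by auto
  have "sup_norm K (\<lambda>_. 0) = 0" unfolding sup_norm_def 1 by simp
  moreover have "holder_seminorm \<alpha> K (\<lambda>_. 0) = 0" unfolding holder_seminorm_def 2 by simp
  ultimately show "nrm (holder_space \<alpha> K) (\<lambda>_. 0) = 0" by (simp add: holder_space_def)
qed

section \<open>Integral operators with analytic kernels\<close>

text \<open>Separates the operator estimates from the geometry: the surface measure enters them
  through its finite mass on the compact set \<open>\<Gamma>\<close>.\<close>

locale boundary =
  fixes M :: "(real ^ 'n) measure" and \<Gamma> V :: "(real ^ 'n) set"
  assumes sets_M: "sets M = sets borel" and compact_\<Gamma>: "compact \<Gamma>" and finite_\<Gamma>: "emeasure M \<Gamma> < \<infinity>"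
    and open_V: "open V" and bounded_V: "bounded V"
begin

lemma compact_closure_V: "compact (closure V)"
  using bounded_V by (simp add: compact_closure)

lemma \<Gamma>_sets: "\<Gamma> \<in> sets M"
  using compact_\<Gamma> by (simp add: sets_M borel_compact)

lemma set_integrable_continuous:
  fixes f :: "real ^ 'n \<Rightarrow> complex"
  assumes f: "continuous_on \<Gamma> f"
  shows "set_integrable M \<Gamma> f"
proof -
  have "bounded (f ` \<Gamma>)" by (intro compact_imp_bounded compact_continuous_image f compact_\<Gamma>)
  then obtain b where b: "b > 0" "\<And>x. x \<in> \<Gamma> \<Longrightarrow> norm (f x) \<le> b" unfolding bounded_pos by auto
  have "(\<lambda>x. indicator \<Gamma> x *\<^sub>R f x) \<in> borel_measurable borel"
    using f compact_\<Gamma> by (intro borel_measurable_continuous_on_indicator) (auto simp: borel_compact)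
  then have m: "(\<lambda>x. indicator \<Gamma> x *\<^sub>R f x) \<in> borel_measurable M"
    using measurable_cong_sets[OF sets_M refl] by blast
  show ?thesis
    unfolding set_integrable_def
    by (rule integrableI_bounded_set[where A = \<Gamma> and B = b])
      (use m b \<Gamma>_sets finite_\<Gamma> in \<open>auto simp: indicator_def\<close>)
qed

lemma norm_set_integral_le:
  fixes f :: "real ^ 'n \<Rightarrow> complex"
  assumes f: "continuous_on \<Gamma> f" and le: "\<And>s. s \<in> \<Gamma> \<Longrightarrow> norm (f s) \<le> c"
  shows "norm (LINT s:\<Gamma>|M. f s) \<le> c * measure M \<Gamma>"
proof -
  have "norm (LINT s:\<Gamma>|M. f s) \<le> (\<integral>s. indicator \<Gamma> s * c \<partial>M)"
    unfolding set_lebesgue_integral_def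
  proof (rule Bochner_Integration.integral_norm_bound_integral)
    show "integrable M (\<lambda>s. indicat_real \<Gamma> s * c)"
      using \<Gamma>_sets finite_\<Gamma> by (intro integrable_mult_left integrable_real_indicator) auto
    show "norm (indicat_real \<Gamma> x *\<^sub>R f x) \<le> indicat_real \<Gamma> x * c" for x
      using le[of x] by (simp add: indicator_def)
  qed (use set_integrable_continuous[OF f] in \<open>simp add: set_integrable_def\<close>)
  also have "\<dots> = c * measure M \<Gamma>" using \<Gamma>_sets by (simp add: mult.commute sets.Int_space_eq2)
  finally show ?thesis .
qed

lemma continuous_on_section:
  assumes "continuous_on (X \<times> \<Gamma>) (\<lambda>(x, s). k x s)" "x \<in> X"
  shows "continuous_on \<Gamma> (k x)"
proof -
  have "continuous_on \<Gamma> (\<lambda>s. (\<lambda>(x, s). k x s) (x, s))"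
    by (rule continuous_on_compose2[OF assms(1)]) (use assms(2) in \<open>auto intro!: continuous_intros\<close>)
  then show ?thesis by simp
qed

text \<open>Uniformity in \<open>s\<close> comes from the compactness of the product.\<close>

lemma uniform_section:
  fixes k :: "real ^ 'n \<Rightarrow> real ^ 'n \<Rightarrow> complex"
  assumes X: "compact X" and k: "continuous_on (X \<times> \<Gamma>) (\<lambda>(x, s). k x s)" and e: "e > 0"
  obtains d where "d > 0" "\<And>x y s. x \<in> X \<Longrightarrow> y \<in> X \<Longrightarrow> s \<in> \<Gamma> \<Longrightarrow> dist y x < d \<Longrightarrow> norm (k y s - k x s) \<le> e"
proof -
  have "uniformly_continuous_on (X \<times> \<Gamma>) (\<lambda>(x, s). k x s)"
    by (intro compact_uniformly_continuous k compact_Times X compact_\<Gamma>)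
  then obtain d where d: "d > 0" "\<And>p p'. p \<in> X \<times> \<Gamma> \<Longrightarrow> p' \<in> X \<times> \<Gamma> \<Longrightarrow> dist p' p < d \<Longrightarrow> dist (case p' of (x, s) \<Rightarrow> k x s) (case p of (x, s) \<Rightarrow> k x s) < e"
    using e unfolding uniformly_continuous_on_def by meson
  have "norm (k y s - k x s) \<le> e" if "x \<in> X" "y \<in> X" "s \<in> \<Gamma>" "dist y x < d" for x y s
    using d(2)[of "(x, s)" "(y, s)"] that by (simp add: dist_Pair_Pair dist_norm)
  with d(1) that show ?thesis by blast
qed

lemma continuous_on_set_integral:
  fixes k :: "real ^ 'n \<Rightarrow> real ^ 'n \<Rightarrow> complex"
  assumes X: "compact X" and k: "continuous_on (X \<times> \<Gamma>) (\<lambda>(x, s). k x s)"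
  shows "continuous_on X (\<lambda>x. LINT s:\<Gamma>|M. k x s)"
  unfolding continuous_on_iff
proof (intro ballI allI impI)
  fix x e assume x: "x \<in> X" and e: "(e::real) > 0"
  define e' where "e' = e / (measure M \<Gamma> + 1)"
  have mu: "0 < measure M \<Gamma> + 1" by (simp add: add_nonneg_pos)
  have e': "e' > 0" using e mu by (simp add: e'_def)
  obtain d where d: "d > 0" "\<And>x y s. x \<in> X \<Longrightarrow> y \<in> X \<Longrightarrow> s \<in> \<Gamma> \<Longrightarrow> dist y x < d \<Longrightarrow> norm (k y s - k x s) \<le> e'"
    using uniform_section[OF X k e'] by blast
  have "dist (LINT s:\<Gamma>|M. k y s) (LINT s:\<Gamma>|M. k x s) < e" if y: "y \<in> X" "dist y x < d" for y
  proof -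
    note cy = continuous_on_section[OF k y(1)] and cx = continuous_on_section[OF k x]
    have "(LINT s:\<Gamma>|M. k y s) - (LINT s:\<Gamma>|M. k x s) = (LINT s:\<Gamma>|M. k y s - k x s)"
      by (intro set_integral_diff(2)[symmetric] set_integrable_continuous cx cy)
    moreover have "norm (LINT s:\<Gamma>|M. k y s - k x s) \<le> e' * measure M \<Gamma>"
      by (intro norm_set_integral_le continuous_on_diff cx cy d(2)[OF x y(1) _ y(2)])
    moreover have "e' * measure M \<Gamma> < e' * (measure M \<Gamma> + 1)" using e' by simp
    moreover have "e' * (measure M \<Gamma> + 1) = e" using mu by (simp add: e'_def)
    ultimately show ?thesis by (simp add: dist_norm)
  qed
  then show "\<exists>d>0. \<forall>y\<in>X. dist y x < d \<longrightarrow> dist (LINT s:\<Gamma>|M. k y s) (LINT s:\<Gamma>|M. k x s) < e"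
    using d(1) by blast
qed

lemma set_integral_sum:
  assumes "finite I" "\<And>i. i \<in> I \<Longrightarrow> set_integrable M \<Gamma> (f i)"
  shows "(LINT s:\<Gamma>|M. (\<Sum>i\<in>I. f i s)) = (\<Sum>i\<in>I. LINT s:\<Gamma>|M. f i s :: complex)"
  using assms(2) unfolding set_lebesgue_integral_def set_integrable_def scaleR_sum_right
  by (rule Bochner_Integration.integral_sum)

text \<open>Differentiation under the integral sign. Uniform continuity of the partial derivatives
  on a compact set makes the linearisation error uniform in \<open>s\<close>, and the finite mass of
  \<Gamma> allows it to be integrated.\<close>

lemma has_derivative_set_integral:
  fixes k :: "real ^ 'n \<Rightarrow> real ^ 'n \<Rightarrow> complex"
  assumes k: "continuous_on (closure V \<times> \<Gamma>) (\<lambda>(x, s). k x s)"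
    and kd: "\<And>i. continuous_on (closure V \<times> \<Gamma>) (\<lambda>(x, s). kd i x s)"
    and der: "\<And>x s. x \<in> V \<Longrightarrow> s \<in> \<Gamma> \<Longrightarrow> ((\<lambda>x. k x s) has_derivative (\<lambda>h. \<Sum>i\<in>UNIV. of_real (h $ i) * kd i x s)) (at x)"
    and x: "x \<in> V"
  shows "((\<lambda>x. LINT s:\<Gamma>|M. k x s) has_derivative (\<lambda>h. \<Sum>i\<in>UNIV. of_real (h $ i) * (LINT s:\<Gamma>|M. kd i x s))) (at x)"
  unfolding has_derivative_at_alt
proof (intro conjI allI impI)
  show "bounded_linear (\<lambda>h. \<Sum>i\<in>UNIV. of_real (h $ i) * (LINT s:\<Gamma>|M. kd i x s))"
    by (intro bounded_linear_sum bounded_linear_mult_const bounded_linear_compose[OF bounded_linear_of_real] bounded_linear_vec_nth)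
  fix e :: real assume e: "e > 0"
  have VX: "y \<in> closure V" if "y \<in> V" for y using that closure_subset by blast
  \<comment> \<open>One factor for the mass, raised by 1 to be positive, and one for the number of
    coordinates.\<close>
  define c where "c = (measure M \<Gamma> + 1) * real CARD('n)"
  have c: "c > 0" by (simp add: c_def add_nonneg_pos)
  define e' where "e' = e / c"
  have e': "e' > 0" using e c by (simp add: e'_def)
  have "\<exists>d. \<forall>i. d i > 0 \<and> (\<forall>x y s. x \<in> closure V \<longrightarrow> y \<in> closure V \<longrightarrow> s \<in> \<Gamma> \<longrightarrow> dist y x < d i \<longrightarrow> norm (kd i y s - kd i x s) \<le> e')"
  proof (rule choice, rule allI)
    fix i
    obtain d where "d > 0" "\<And>x y s. x \<in> closure V \<Longrightarrow> y \<in> closure V \<Longrightarrow> s \<in> \<Gamma> \<Longrightarrow> dist y x < d \<Longrightarrow> norm (kd i y s - kd i x s) \<le> e'"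
      using uniform_section[OF compact_closure_V kd e'] by blast
    then show "\<exists>d. d > 0 \<and> (\<forall>x y s. x \<in> closure V \<longrightarrow> y \<in> closure V \<longrightarrow> s \<in> \<Gamma> \<longrightarrow> dist y x < d \<longrightarrow> norm (kd i y s - kd i x s) \<le> e')"
      by (intro exI[of _ d]) blast
  qed
  then obtain d where d: "\<And>i. d i > 0" "\<And>i x y s. x \<in> closure V \<Longrightarrow> y \<in> closure V \<Longrightarrow> s \<in> \<Gamma> \<Longrightarrow> dist y x < d i \<Longrightarrow> norm (kd i y s - kd i x s) \<le> e'"
    by blast
  obtain r where r: "r > 0" "ball x r \<subseteq> V" using open_V x open_contains_ball by blast
  define \<delta> where "\<delta> = min r (Min (range d))"
  have \<delta>: "\<delta> > 0" unfolding \<delta>_def using r d by (simp add: Min_gr_iff)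
  have \<delta>d: "\<delta> \<le> d i" for i unfolding \<delta>_def by (intro min.coboundedI2 Min_le) auto
  have bV: "ball x \<delta> \<subseteq> V" using r(2) unfolding \<delta>_def by auto
  have main: "norm (k y s - k x s - (\<Sum>i\<in>UNIV. of_real ((y - x) $ i) * kd i x s)) \<le> norm (y - x) * (real CARD('n) * e')"
    if y: "norm (y - x) < \<delta>" and s: "s \<in> \<Gamma>" for y s
  proof (rule differentiable_bound_linearization[where S = "ball x \<delta>" and f = "\<lambda>x. k x s" and f' = "\<lambda>x h. \<Sum>i\<in>UNIV. of_real (h $ i) * kd i x s"])
    fix t :: real assume t: "t \<in> {0..1}"
    have "norm (t *\<^sub>R (y - x)) \<le> 1 * norm (y - x)" unfolding norm_scaleR using t by (intro mult_right_mono) auto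
    then show "x + t *\<^sub>R (y - x) \<in> ball x \<delta>" using y by (simp add: dist_norm)
  next
    fix z assume z: "z \<in> ball x \<delta>"
    then have zV: "z \<in> V" using bV by blast
    show "((\<lambda>x. k x s) has_derivative (\<lambda>h. \<Sum>i\<in>UNIV. of_real (h $ i) * kd i z s)) (at z within ball x \<delta>)"
      by (rule has_derivative_at_withinI[OF der[OF zV s]])
    show "onorm ((\<lambda>h. \<Sum>i\<in>UNIV. of_real (h $ i) * kd i z s) - (\<lambda>h. \<Sum>i\<in>UNIV. of_real (h $ i) * kd i x s)) \<le> real CARD('n) * e'"
    proof (rule onorm_le)
      fix h :: "real ^ 'n"
      have "norm (((\<lambda>h. \<Sum>i\<in>UNIV. of_real (h $ i) * kd i z s) - (\<lambda>h. \<Sum>i\<in>UNIV. of_real (h $ i) * kd i x s)) h)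
          = norm (\<Sum>i\<in>UNIV. of_real (h $ i) * (kd i z s - kd i x s))"
        by (simp add: sum_subtractf[symmetric] right_diff_distrib)
      also have "\<dots> \<le> (\<Sum>i\<in>(UNIV::'n set). norm h * e')"
      proof (rule sum_norm_le)
        fix i
        have "dist z x < d i" using z \<delta>d[of i] by (simp add: dist_commute)
        then have "norm (kd i z s - kd i x s) \<le> e'" using d(2)[of x z s i] VX x z bV s by blast
        then show "norm (of_real (h $ i) * (kd i z s - kd i x s)) \<le> norm h * e'"
          unfolding norm_mult norm_of_real using component_le_norm_cart[of h i] by (intro mult_mono) auto
      qed
      finally show "norm (((\<lambda>h. \<Sum>i\<in>UNIV. of_real (h $ i) * kd i z s) - (\<lambda>h. \<Sum>i\<in>UNIV. of_real (h $ i) * kd i x s)) h) \<le> real CARD('n) * e' * norm h"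
        by (simp add: mult_ac)
    qed
  qed (use \<delta> in auto)
  show "\<exists>\<delta>>0. \<forall>y. norm (y - x) < \<delta> \<longrightarrow>
    norm ((LINT s:\<Gamma>|M. k y s) - (LINT s:\<Gamma>|M. k x s) - (\<Sum>i\<in>UNIV. of_real ((y - x) $ i) * (LINT s:\<Gamma>|M. kd i x s))) \<le> e * norm (y - x)"
  proof (intro exI[of _ \<delta>] conjI allI impI \<delta>)
    fix y assume y: "norm (y - x) < \<delta>"
    then have yV: "y \<in> V" using bV by (auto simp: dist_norm norm_minus_commute)
    note cy = continuous_on_section[OF k VX[OF yV]] and cx = continuous_on_section[OF k VX[OF x]]
      and cd = continuous_on_section[OF kd VX[OF x]]
    have cs: "continuous_on \<Gamma> (\<lambda>s. \<Sum>i\<in>UNIV. of_real ((y - x) $ i) * kd i x s)"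
      by (intro continuous_intros cd)
    have "(LINT s:\<Gamma>|M. (\<Sum>i\<in>UNIV. of_real ((y - x) $ i) * kd i x s)) = (\<Sum>i\<in>UNIV. of_real ((y - x) $ i) * (LINT s:\<Gamma>|M. kd i x s))"
      by (subst set_integral_sum) (auto intro!: set_integrable_continuous continuous_intros cd)
    then have "(LINT s:\<Gamma>|M. k y s) - (LINT s:\<Gamma>|M. k x s) - (\<Sum>i\<in>UNIV. of_real ((y - x) $ i) * (LINT s:\<Gamma>|M. kd i x s))
      = (LINT s:\<Gamma>|M. k y s - k x s - (\<Sum>i\<in>UNIV. of_real ((y - x) $ i) * kd i x s))"
      using set_integral_diff(2)[OF set_integral_diff(1)[OF set_integrable_continuous[OF cy] set_integrable_continuous[OF cx]] set_integrable_continuous[OF cs]]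
        set_integral_diff(2)[OF set_integrable_continuous[OF cy] set_integrable_continuous[OF cx]] by simp
    also have "norm \<dots> \<le> (norm (y - x) * (real CARD('n) * e')) * measure M \<Gamma>"
      by (intro norm_set_integral_le continuous_on_diff cx cy cs main y)
    also have "\<dots> \<le> (norm (y - x) * (real CARD('n) * e')) * (measure M \<Gamma> + 1)"
      using e' by (intro mult_left_mono) auto
    also have "\<dots> = e * norm (y - x)" using c by (simp add: e'_def c_def field_simps)
    finally show "norm ((LINT s:\<Gamma>|M. k y s) - (LINT s:\<Gamma>|M. k x s) - (\<Sum>i\<in>UNIV. of_real ((y - x) $ i) * (LINT s:\<Gamma>|M. kd i x s))) \<le> e * norm (y - x)" .
  qed
qed

end

section \<open>Kernels, their potentials and operator bounds\<close>

context boundary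
begin

text \<open>\<open>\<kappa> is x s\<close> plays the role of the iterated partial derivative in \<open>x\<close> of the kernel \<open>\<kappa> [] x s\<close>.\<close>

definition kern :: "('n list \<Rightarrow> real ^ 'n \<Rightarrow> real ^ 'n \<Rightarrow> complex) \<Rightarrow> bool" where
  "kern \<kappa> \<longleftrightarrow> (\<forall>is. continuous_on (closure V \<times> \<Gamma>) (\<lambda>(x, s). \<kappa> is x s)) \<and>
    (\<forall>is. \<forall>x\<in>V. \<forall>s\<in>\<Gamma>. ((\<lambda>x. \<kappa> is x s) has_derivative (\<lambda>h. \<Sum>i\<in>UNIV. of_real (h $ i) * \<kappa> (i # is) x s)) (at x))"

lemma kern_diff:
  assumes "kern \<kappa>" "kern \<kappa>'" shows "kern (\<lambda>is x s. \<kappa> is x s - \<kappa>' is x s)"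
  unfolding kern_def
proof (intro conjI allI ballI)
  fix "is"
  show "continuous_on (closure V \<times> \<Gamma>) (\<lambda>(x, s). \<kappa> is x s - \<kappa>' is x s)"
    using assms unfolding kern_def case_prod_beta by (intro continuous_on_diff) auto
  fix x s assume "x \<in> V" "s \<in> \<Gamma>"
  with assms have "((\<lambda>x. \<kappa> is x s - \<kappa>' is x s) has_derivative (\<lambda>h. (\<Sum>i\<in>UNIV. of_real (h $ i) * \<kappa> (i # is) x s) - (\<Sum>i\<in>UNIV. of_real (h $ i) * \<kappa>' (i # is) x s))) (at x)"
    unfolding kern_def by (intro has_derivative_diff) auto
  then show "((\<lambda>x. \<kappa> is x s - \<kappa>' is x s) has_derivative (\<lambda>h. \<Sum>i\<in>UNIV. of_real (h $ i) * (\<kappa> (i # is) x s - \<kappa>' (i # is) x s))) (at x)"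
    by (simp add: sum_subtractf[symmetric] right_diff_distrib)
qed

lemma kern_mult:
  assumes "kern \<kappa>" "continuous_on \<Gamma> w" shows "kern (\<lambda>is x s. w s * \<kappa> is x s)"
  unfolding kern_def
proof (intro conjI allI ballI)
  fix "is"
  have "continuous_on (closure V \<times> \<Gamma>) (\<lambda>p. w (snd p))"
    by (intro continuous_on_compose2[OF assms(2)] continuous_intros) auto
  then show "continuous_on (closure V \<times> \<Gamma>) (\<lambda>(x, s). w s * \<kappa> is x s)"
    using assms unfolding kern_def case_prod_beta by (intro continuous_on_mult) auto
  fix x s assume "x \<in> V" "s \<in> \<Gamma>"
  with assms have "((\<lambda>x. w s * \<kappa> is x s) has_derivative (\<lambda>h. w s * (\<Sum>i\<in>UNIV. of_real (h $ i) * \<kappa> (i # is) x s))) (at x)"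
    unfolding kern_def by (intro has_derivative_mult_right) auto
  then show "((\<lambda>x. w s * \<kappa> is x s) has_derivative (\<lambda>h. \<Sum>i\<in>UNIV. of_real (h $ i) * (w s * \<kappa> (i # is) x s))) (at x)"
    by (simp add: sum_distrib_left mult_ac)
qed

lemma kern_sum:
  assumes "\<And>j. j \<in> J \<Longrightarrow> kern (\<kappa> j)" shows "kern (\<lambda>is x s. \<Sum>j\<in>J. \<kappa> j is x s)"
  unfolding kern_def
proof (intro conjI allI ballI)
  fix "is"
  show "continuous_on (closure V \<times> \<Gamma>) (\<lambda>(x, s). \<Sum>j\<in>J. \<kappa> j is x s)"
    using assms unfolding kern_def case_prod_beta by (intro continuous_on_sum) auto
  fix x s assume "x \<in> V" "s \<in> \<Gamma>"
  with assms have "((\<lambda>x. \<Sum>j\<in>J. \<kappa> j is x s) has_derivative (\<lambda>h. \<Sum>j\<in>J. \<Sum>i\<in>UNIV. of_real (h $ i) * \<kappa> j (i # is) x s)) (at x)"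
    unfolding kern_def by (intro has_derivative_sum) auto
  also have "(\<lambda>h. \<Sum>j\<in>J. \<Sum>i\<in>UNIV. of_real (h $ i) * \<kappa> j (i # is) x s) = (\<lambda>h. \<Sum>i\<in>UNIV. of_real (h $ i) * (\<Sum>j\<in>J. \<kappa> j (i # is) x s))"
    by (subst sum.swap) (simp add: sum_distrib_left)
  finally show "((\<lambda>x. \<Sum>j\<in>J. \<kappa> j is x s) has_derivative (\<lambda>h. \<Sum>i\<in>UNIV. of_real (h $ i) * (\<Sum>j\<in>J. \<kappa> j (i # is) x s))) (at x)" .
qed

text \<open>The word \<open>js\<close> is applied before \<open>is\<close>: it will hold the
  derivatives along \<open>s\<close> that come from the expansion in \<epsilon>, while
  \<open>is\<close> holds those in \<open>x\<close>.\<close>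

lemma kern_analytic:
  fixes f :: "real ^ 'n \<Rightarrow> complex"
  assumes f: "real_analytic_fun_on U f" and U: "\<And>x s. x \<in> closure V \<Longrightarrow> s \<in> \<Gamma> \<Longrightarrow> x - p - t *\<^sub>R s \<in> U"
  shows "kern (\<lambda>is x s. iter_partial (is @ js) f (x - p - t *\<^sub>R s))"
  unfolding kern_def
proof (intro conjI allI ballI)
  fix "is"
  have "continuous_on U (iter_partial (is @ js) f)"
    using real_analytic_iter_partial(1)[OF f] by (intro continuous_at_imp_continuous_on ballI differentiable_imp_continuous_within)
  then have "continuous_on (closure V \<times> \<Gamma>) (\<lambda>q. iter_partial (is @ js) f (fst q - p - t *\<^sub>R snd q))"
    by (rule continuous_on_compose2) (auto intro!: continuous_intros U)
  then show "continuous_on (closure V \<times> \<Gamma>) (\<lambda>(x, s). iter_partial (is @ js) f (x - p - t *\<^sub>R s))"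
    unfolding case_prod_beta .
  fix x s assume x: "x \<in> V" and s: "s \<in> \<Gamma>"
  have 1: "((\<lambda>x. x - p - t *\<^sub>R s) has_derivative (\<lambda>h. h)) (at x)" by (rule derivative_eq_intros refl | simp)+
  have "x - p - t *\<^sub>R s \<in> U" using U x s closure_subset by blast
  from has_derivative_compose[OF 1 real_analytic_iter_partial(3)[OF f this, of "is @ js"]]
  show "((\<lambda>x. iter_partial (is @ js) f (x - p - t *\<^sub>R s)) has_derivative (\<lambda>h. \<Sum>i\<in>UNIV. of_real (h $ i) * iter_partial ((i # is) @ js) f (x - p - t *\<^sub>R s))) (at x)"
    by (simp only: append_Cons)
qed

text \<open>Keeping the word as an argument turns differentiation of the potential in
  \<open>x\<close> into lengthening of the word.\<close>

definition layer_op :: "('n list \<Rightarrow> real ^ 'n \<Rightarrow> real ^ 'n \<Rightarrow> complex) \<Rightarrow> 'n list \<Rightarrow> (real ^ 'n \<Rightarrow> complex) \<Rightarrow> real ^ 'n \<Rightarrow> complex" where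
  "layer_op \<kappa> is \<theta> x = (LINT s:\<Gamma>|M. \<kappa> is x s * \<theta> s)"

lemma kern_times:
  assumes "kern \<kappa>" "continuous_on \<Gamma> \<theta>" shows "kern (\<lambda>is x s. \<kappa> is x s * \<theta> s)"
  using kern_mult[OF assms] by (simp add: mult.commute)

lemma layer_op_continuous:
  assumes "kern \<kappa>" "continuous_on \<Gamma> \<theta>" shows "continuous_on (closure V) (layer_op \<kappa> is \<theta>)"
  unfolding layer_op_def using kern_times[OF assms] unfolding kern_def
  by (intro continuous_on_set_integral compact_closure_V) auto

lemma layer_op_has_derivative:
  assumes "kern \<kappa>" "continuous_on \<Gamma> \<theta>" "x \<in> V"
  shows "(layer_op \<kappa> is \<theta> has_derivative (\<lambda>h. \<Sum>i\<in>UNIV. of_real (h $ i) * layer_op \<kappa> (i # is) \<theta> x)) (at x)"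
  unfolding layer_op_def[abs_def] using kern_times[OF assms(1,2)] assms(3) unfolding kern_def
  by (intro has_derivative_set_integral) auto

lemma layer_op_norm_bound:
  assumes k: "kern \<kappa>" and \<theta>: "continuous_on \<Gamma> \<theta>" "\<And>s. s \<in> \<Gamma> \<Longrightarrow> norm (\<theta> s) \<le> b" and x: "x \<in> V"
    and c: "\<And>s. s \<in> \<Gamma> \<Longrightarrow> norm (\<kappa> is x s) \<le> c"
  shows "norm (layer_op \<kappa> is \<theta> x) \<le> c * b * measure M \<Gamma>"
  unfolding layer_op_def
proof (rule norm_set_integral_le)
  have x': "x \<in> closure V" using x closure_subset by blast
  show "continuous_on \<Gamma> (\<lambda>s. \<kappa> is x s * \<theta> s)"
    by (rule continuous_on_section[OF _ x']) (use kern_times[OF k \<theta>(1)] in \<open>simp add: kern_def\<close>)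
  show "norm (\<kappa> is x s * \<theta> s) \<le> c * b" if "s \<in> \<Gamma>" for s
    unfolding norm_mult using c[OF that] \<theta>(2)[OF that] by (intro mult_mono) (auto intro: order.trans[OF norm_ge_zero])
qed

text \<open>\<open>F\<close> is fixed on the closure of \<open>V\<close> only, as elements of the
  function spaces are; since \<open>V\<close> is open, this determines all its derivatives there, by
  induction on the word.\<close>

lemma iter_partial_layer_op:
  assumes k: "kern \<kappa>" and \<theta>: "continuous_on \<Gamma> \<theta>" and F: "\<And>x. x \<in> closure V \<Longrightarrow> F x = layer_op \<kappa> [] \<theta> x"
    and x: "x \<in> V"
  shows "iter_partial is F x = layer_op \<kappa> is \<theta> x" and "iter_partial is F differentiable (at x)"
proof -
  have 1: "(iter_partial is F has_derivative (\<lambda>h. \<Sum>i\<in>UNIV. of_real (h $ i) * layer_op \<kappa> (i # is) \<theta> x)) (at x)"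
    if eq: "\<forall>y\<in>V. iter_partial is F y = layer_op \<kappa> is \<theta> y" and x: "x \<in> V" for "is" x
    by (rule has_derivative_transform_within_open[OF layer_op_has_derivative[OF k \<theta> x] open_V x]) (use eq in auto)
  have 2: "\<forall>y\<in>V. iter_partial is F y = layer_op \<kappa> is \<theta> y" for "is"
  proof (induction "is")
    case Nil
    then show ?case using F closure_subset[of V] by auto
  next
    case (Cons i "is")
    show ?case
    proof
      fix y assume y: "y \<in> V"
      have "iter_partial (i # is) F y = (\<Sum>j\<in>UNIV. of_real (axis i 1 $ j) * layer_op \<kappa> (j # is) \<theta> y)"
        using fun_cong[OF frechet_derivative_at[OF 1[OF Cons y]], of "axis i 1"] by simp
      also have "\<dots> = (\<Sum>j\<in>UNIV. if j = i then layer_op \<kappa> (i # is) \<theta> y else 0)"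
        by (intro sum.cong) (auto simp: axis_def)
      finally show "iter_partial (i # is) F y = layer_op \<kappa> (i # is) \<theta> y" by simp
    qed
  qed
  show "iter_partial is F x = layer_op \<kappa> is \<theta> x" using 2 x by blast
  show "iter_partial is F differentiable (at x)" using 1[OF 2 x] by (auto simp: differentiable_def)
qed

lemma layer_op_in_C_closure_space:
  assumes k: "kern \<kappa>" and \<theta>: "continuous_on \<Gamma> \<theta>" and F: "\<And>x. x \<in> closure V \<Longrightarrow> F x = layer_op \<kappa> [] \<theta> x"
  shows "F \<in> fns (C_closure_space m V)"
proof -
  note I = iter_partial_layer_op[OF k \<theta> F]
  have cont: "continuous_on V (iter_partial is F)" for "is"
    using layer_op_continuous[OF k \<theta>, of "is"] I(1)[of _ "is"] closure_subset
    by (subst continuous_on_cong[OF refl, of V _ "layer_op \<kappa> is \<theta>"]) (auto intro: continuous_on_subset)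
  have "continuous_on (closure V) F"
    using layer_op_continuous[OF k \<theta>, of "[]"] by (subst continuous_on_cong[OF refl F]) auto
  moreover have "\<exists>g. continuous_on (closure V) g \<and> (\<forall>x\<in>V. g x = iter_partial is F x)" for "is"
    using layer_op_continuous[OF k \<theta>, of "is"] I(1)[of _ "is"] by (intro exI[of _ "layer_op \<kappa> is \<theta>"]) auto
  ultimately show ?thesis using I(2) cont by (simp add: C_closure_space_def C_k_on_def)
qed

lemma layer_op_C_closure_norm:
  assumes k: "kern \<kappa>" and \<theta>: "continuous_on \<Gamma> \<theta>" "\<And>s. s \<in> \<Gamma> \<Longrightarrow> norm (\<theta> s) \<le> b" "b \<ge> 0"
    and F: "\<And>x. x \<in> closure V \<Longrightarrow> F x = layer_op \<kappa> [] \<theta> x"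
    and c: "\<And>is x s. length is \<le> m \<Longrightarrow> x \<in> V \<Longrightarrow> s \<in> \<Gamma> \<Longrightarrow> norm (\<kappa> is x s) \<le> c" "c \<ge> 0"
  shows "0 \<le> nrm (C_closure_space m V) F"
    and "nrm (C_closure_space m V) F \<le> real (card {is :: 'n list. length is \<le> m}) * (c * b * measure M \<Gamma>)"
proof -
  have b: "norm (iter_partial is F x) \<le> c * b * measure M \<Gamma>" if "length is \<le> m" "x \<in> V" for "is" x
  proof -
    have eq: "iter_partial is F x = layer_op \<kappa> is \<theta> x" by (rule iter_partial_layer_op(1)[OF k \<theta>(1) F that(2)])
    show ?thesis unfolding eq by (rule layer_op_norm_bound[OF k \<theta>(1,2) that(2) c(1)[OF that]])
  qed
  have nn: "0 \<le> c * b * measure M \<Gamma>" using c \<theta> by simp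
  show "0 \<le> nrm (C_closure_space m V) F"
    using sup_norm_nonneg_le(1)[OF b nn] by (auto simp: C_closure_space_def intro!: sum_nonneg)
  have "nrm (C_closure_space m V) F \<le> (\<Sum>is :: 'n list | length is \<le> m. c * b * measure M \<Gamma>)"
    unfolding C_closure_space_def fspace.simps by (intro sum_mono sup_norm_nonneg_le(2)[OF b nn]) auto
  then show "nrm (C_closure_space m V) F \<le> real (card {is :: 'n list. length is \<le> m}) * (c * b * measure M \<Gamma>)"
    by simp
qed

lemma kern_bounded:
  assumes k: "kern \<kappa>"
  obtains c where "c \<ge> 0" "\<And>is x s. length is \<le> m \<Longrightarrow> x \<in> V \<Longrightarrow> s \<in> \<Gamma> \<Longrightarrow> norm (\<kappa> is x s) \<le> c"
proof -
  have "\<exists>c. \<forall>x\<in>V. \<forall>s\<in>\<Gamma>. norm (\<kappa> is x s) \<le> c" for "is"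
  proof -
    have "bounded ((\<lambda>(x, s). \<kappa> is x s) ` (closure V \<times> \<Gamma>))"
      using k unfolding kern_def by (intro compact_imp_bounded compact_continuous_image compact_Times compact_closure_V compact_\<Gamma>) auto
    then obtain c where "\<forall>p\<in>(\<lambda>(x, s). \<kappa> is x s) ` (closure V \<times> \<Gamma>). norm p \<le> c" unfolding bounded_iff by blast
    then show ?thesis using closure_subset[of V] by (intro exI[of _ c]) force
  qed
  then obtain c where c: "\<And>is x s. x \<in> V \<Longrightarrow> s \<in> \<Gamma> \<Longrightarrow> norm (\<kappa> is x s) \<le> c is" by metis
  define C where "C = (\<Sum>is :: 'n list | length is \<le> m. \<bar>c is\<bar>)"
  have "norm (\<kappa> is x s) \<le> C" if "length is \<le> m" "x \<in> V" "s \<in> \<Gamma>" for "is" x s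
  proof -
    have "norm (\<kappa> is x s) \<le> \<bar>c is\<bar>" using c[OF that(2,3), of "is"] by linarith
    also have "\<dots> \<le> C" unfolding C_def using that finite_lists_of_length_le by (intro member_le_sum) auto
    finally show ?thesis .
  qed
  moreover have "C \<ge> 0" unfolding C_def by (intro sum_nonneg) auto
  ultimately show ?thesis using that by blast
qed

text \<open>The maximum with 0 is a nonnegative bound also for empty \<Gamma>, where no point is
  available to compare the norm with.\<close>

lemma holder_fns:
  assumes "\<theta> \<in> fns (holder_space \<alpha> \<Gamma>)" "\<alpha> > 0"
  shows "continuous_on \<Gamma> \<theta>" and "\<And>s. s \<in> \<Gamma> \<Longrightarrow> norm (\<theta> s) \<le> max 0 (nrm (holder_space \<alpha> \<Gamma>) \<theta>)"
    and "\<Gamma> \<noteq> {} \<Longrightarrow> 0 \<le> nrm (holder_space \<alpha> \<Gamma>) \<theta>"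
proof -
  show "continuous_on \<Gamma> \<theta>" using assms by (intro holder_on_imp_continuous_on) (auto simp: holder_space_def)
  show "norm (\<theta> s) \<le> max 0 (nrm (holder_space \<alpha> \<Gamma>) \<theta>)" if "s \<in> \<Gamma>" for s
    using holder_space_norm[OF assms compact_\<Gamma> that] by simp
  show "0 \<le> nrm (holder_space \<alpha> \<Gamma>) \<theta>" if "\<Gamma> \<noteq> {}"
  proof -
    from that obtain s where "s \<in> \<Gamma>" by auto
    from order.trans[OF norm_ge_zero holder_space_norm[OF assms compact_\<Gamma> this]] show ?thesis .
  qed
qed

lemma layer_op_bounded_ops:
  assumes k: "kern \<kappa>" and \<alpha>: "\<alpha> > 0"
    and T: "\<And>\<theta> x. \<theta> \<in> fns (holder_space \<alpha> \<Gamma>) \<Longrightarrow> x \<in> closure V \<Longrightarrow> T \<theta> x = layer_op \<kappa> [] \<theta> x"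
  shows "T \<in> bounded_ops (holder_space \<alpha> \<Gamma>) (C_closure_space m V)"
proof -
  let ?X = "holder_space \<alpha> \<Gamma>" and ?Y = "C_closure_space m V"
  have sec: "continuous_on \<Gamma> (\<lambda>s. \<kappa> [] x s * \<theta> s)" if "\<theta> \<in> fns ?X" "x \<in> closure V" for \<theta> x
    by (rule continuous_on_section[OF _ that(2)]) (use kern_times[OF k holder_fns(1)[OF that(1) \<alpha>]] in \<open>simp add: kern_def\<close>)
  have add: "(\<lambda>s. f s + g s) \<in> fns ?X" if "f \<in> fns ?X" "g \<in> fns ?X" for f g
  proof -
    have h: "holder_on \<alpha> \<Gamma> f" "holder_on \<alpha> \<Gamma> g" using that by (auto simp: holder_space_def)
    from h(1) obtain C where C: "\<And>x y. x \<in> \<Gamma> \<Longrightarrow> y \<in> \<Gamma> \<Longrightarrow> norm (f x - f y) \<le> C * dist x y powr \<alpha>"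
      unfolding holder_on_def by blast
    from h(2) obtain D where D: "\<And>x y. x \<in> \<Gamma> \<Longrightarrow> y \<in> \<Gamma> \<Longrightarrow> norm (g x - g y) \<le> D * dist x y powr \<alpha>"
      unfolding holder_on_def by blast
    have "norm (f x + g x - (f y + g y)) \<le> (C + D) * dist x y powr \<alpha>" if "x \<in> \<Gamma>" "y \<in> \<Gamma>" for x y
      using norm_triangle_ineq[of "f x - f y" "g x - g y"] C[OF that] D[OF that] by (simp add: algebra_simps)
    then show ?thesis by (auto simp: holder_space_def holder_on_def)
  qed
  have scal: "(\<lambda>s. c * f s) \<in> fns ?X" if "f \<in> fns ?X" for f c
  proof -
    have "holder_on \<alpha> \<Gamma> f" using that by (simp add: holder_space_def)
    then obtain C where C: "\<And>x y. x \<in> \<Gamma> \<Longrightarrow> y \<in> \<Gamma> \<Longrightarrow> norm (f x - f y) \<le> C * dist x y powr \<alpha>"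
      unfolding holder_on_def by blast
    have "norm (c * f x - c * f y) \<le> (norm c * C) * dist x y powr \<alpha>" if "x \<in> \<Gamma>" "y \<in> \<Gamma>" for x y
      using mult_left_mono[OF C[OF that] norm_ge_zero[of c]] by (simp add: norm_mult[symmetric] right_diff_distrib mult.assoc)
    then show ?thesis by (auto simp: holder_space_def holder_on_def)
  qed
  obtain c where c: "c \<ge> 0" "\<And>is x s. length is \<le> m \<Longrightarrow> x \<in> V \<Longrightarrow> s \<in> \<Gamma> \<Longrightarrow> norm (\<kappa> is x s) \<le> c"
    using kern_bounded[OF k] by blast
  show ?thesis
    unfolding bounded_ops_def
  proof (intro CollectI conjI ballI allI)
    show "T f \<in> fns ?Y" if "f \<in> fns ?X" for f
      by (rule layer_op_in_C_closure_space[OF k holder_fns(1)[OF that \<alpha>] T[OF that]])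
    show "T (\<lambda>s. f s + g s) x = T f x + T g x" if f: "f \<in> fns ?X" and g: "g \<in> fns ?X" and x: "x \<in> pts ?Y" for f g x
    proof -
      have x': "x \<in> closure V" using x by (simp add: C_closure_space_def)
      show ?thesis unfolding T[OF add[OF f g] x'] T[OF f x'] T[OF g x'] layer_op_def distrib_left
        by (intro set_integral_add set_integrable_continuous sec f g x')
    qed
    show "T (\<lambda>s. c * f s) x = c * T f x" if f: "f \<in> fns ?X" and x: "x \<in> pts ?Y" for f c x
    proof -
      have x': "x \<in> closure V" using x by (simp add: C_closure_space_def)
      have eq: "\<kappa> [] x s * (c * f s) = c * (\<kappa> [] x s * f s)" for s by (simp add: mult_ac)
      show ?thesis unfolding T[OF scal[OF f] x'] T[OF f x'] layer_op_def eq by (rule set_integral_mult_right)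
    qed
    show "\<exists>C. \<forall>f\<in>fns ?X. nrm ?Y (T f) \<le> C * nrm ?X f"
    \<comment> \<open>Nonnegativity of the Hoelder norm was derived from a point of \<Gamma>;
      without one all integrals vanish.\<close>
    proof (cases "\<Gamma> = {}")
      case True
      have "nrm ?Y (T f) \<le> 0 * nrm ?X f" if "f \<in> fns ?X" for f
        using layer_op_C_closure_norm(2)[OF k holder_fns(1,2)[OF that \<alpha>] _ T[OF that] c(2,1), of m] True by simp
      then show ?thesis by blast
    next
      case False
      show ?thesis
      proof (intro exI[of _ "real (card {is :: 'n list. length is \<le> m}) * c * measure M \<Gamma>"] ballI)
        fix f assume f: "f \<in> fns ?X"
        show "nrm ?Y (T f) \<le> (real (card {is :: 'n list. length is \<le> m}) * c * measure M \<Gamma>) * nrm ?X f"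
          using layer_op_C_closure_norm(2)[OF k holder_fns(1,2)[OF f \<alpha>] _ T[OF f] c(2,1), of m] holder_fns(3)[OF f \<alpha> False]
          by (simp add: max_absorb2 mult_ac)
      qed
    qed
  qed
qed

text \<open>\<open>op_norm\<close> is a supremum of reals: the zero density shows that its set is
  nonempty, the kernel bound that it is bounded above. Together they control the absolute
  value.\<close>

lemma layer_op_norm_le:
  assumes k: "kern \<kappa>" and \<alpha>: "\<alpha> > 0"
    and T: "\<And>\<theta> x. \<theta> \<in> fns (holder_space \<alpha> \<Gamma>) \<Longrightarrow> x \<in> closure V \<Longrightarrow> T \<theta> x = layer_op \<kappa> [] \<theta> x"
    and c: "\<And>is x s. length is \<le> m \<Longrightarrow> x \<in> V \<Longrightarrow> s \<in> \<Gamma> \<Longrightarrow> norm (\<kappa> is x s) \<le> c" "c \<ge> 0"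
  shows "\<bar>op_norm (holder_space \<alpha> \<Gamma>) (C_closure_space m V) T\<bar> \<le> real (card {is :: 'n list. length is \<le> m}) * (c * measure M \<Gamma>)"
proof -
  let ?X = "holder_space \<alpha> \<Gamma>" and ?Y = "C_closure_space m V"
  let ?S = "{nrm ?Y (T f) | f. f \<in> fns ?X \<and> nrm ?X f \<le> 1}"
  let ?c = "real (card {is :: 'n list. length is \<le> m}) * (c * measure M \<Gamma>)"
  have b: "0 \<le> r \<and> r \<le> ?c" if "r \<in> ?S" for r
  proof -
    from that obtain f where f: "f \<in> fns ?X" "nrm ?X f \<le> 1" "r = nrm ?Y (T f)" by blast
    have f1: "norm (f s) \<le> 1" if "s \<in> \<Gamma>" for s using holder_fns(2)[OF f(1) \<alpha> that] f(2) by simp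
    show ?thesis
      using layer_op_C_closure_norm[OF k holder_fns(1)[OF f(1) \<alpha>] f1 zero_le_one T[OF f(1)] c] by (simp add: f(3))
  qed
  have mem: "nrm ?Y (T (\<lambda>_. 0)) \<in> ?S" using holder_space_zero[of \<alpha> \<Gamma>] by force
  have bdd: "bdd_above ?S" by (rule bdd_aboveI[of _ ?c]) (use b in blast)
  have "op_norm ?X ?Y T \<le> ?c" unfolding op_norm_def by (rule cSup_least) (use mem b in blast)+
  moreover have "nrm ?Y (T (\<lambda>_. 0)) \<le> op_norm ?X ?Y T" unfolding op_norm_def by (rule cSup_upper[OF mem bdd])
  ultimately show ?thesis using b[OF mem] by linarith
qed

text \<open>The remainder of the expansion at \<open>t0\<close> is itself the operator of a kernel,
  so the pointwise bound of \<open>dir_deriv_taylor\<close> passes to the operator norm through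
  \<open>layer_op_norm_le\<close>.\<close>

theorem potential_real_analytic:
  fixes g :: "real ^ 'n \<Rightarrow> complex" and I :: "real set"
  assumes g: "real_analytic_fun_on U g" and I: "open I" and \<alpha>: "\<alpha> > 0"
    and U: "\<And>x s t. x \<in> closure V \<Longrightarrow> s \<in> \<Gamma> \<Longrightarrow> t \<in> I \<Longrightarrow> x - p - t *\<^sub>R s \<in> U"
    and A: "\<And>t \<theta> x. t \<in> I \<Longrightarrow> \<theta> \<in> fns (holder_space \<alpha> \<Gamma>) \<Longrightarrow> x \<in> closure V \<Longrightarrow>
      A t \<theta> x = (LINT s:\<Gamma>|M. g (x - p - t *\<^sub>R s) * \<theta> s)"
  shows "real_analytic_op_map I (holder_space \<alpha> \<Gamma>) (C_closure_space m V) A"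
proof -
  let ?X = "holder_space \<alpha> \<Gamma>" and ?Y = "C_closure_space m V"
  have kt: "kern (\<lambda>is x s. iter_partial is g (x - p - t *\<^sub>R s))" if "t \<in> I" for t
    using kern_analytic[OF g U[OF _ _ that], of "[]"] by simp
  have At: "A t \<theta> x = layer_op (\<lambda>is x s. iter_partial is g (x - p - t *\<^sub>R s)) [] \<theta> x"
    if "t \<in> I" "\<theta> \<in> fns ?X" "x \<in> closure V" for t \<theta> x
    using A[OF that] by (simp add: layer_op_def)
  have "\<exists>r>0. \<exists>B. (\<forall>j::nat. B j \<in> bounded_ops ?X ?Y) \<and>
     (\<forall>t\<in>I. \<bar>t - t0\<bar> < r \<longrightarrow> (\<lambda>N. op_norm ?X ?Y (\<lambda>f x. A t f x - (\<Sum>j<N. of_real ((t - t0) ^ j) * B j f x))) \<longlonglongrightarrow> 0)"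
    if t0: "t0 \<in> I" for t0
  proof -
    \<comment> \<open>Coefficient of (t - t0)^j of the kernel: the j-th derivative along -s, divided
      by j!. The words \<open>js\<close> stand last so that \<open>kern_analytic\<close>
      applies.\<close>
    define \<kappa> where "\<kappa> j is x s = (\<Sum>js | length js = j. (of_real (prod_list (map (($) (- s)) js)) / fact j) *
      iter_partial (is @ js) g (x - p - t0 *\<^sub>R s))" for j "is" x s
    have w: "continuous_on \<Gamma> (\<lambda>s. complex_of_real (prod_list (map (($) (- s)) js)) / fact j)" for js and j :: nat
    proof -
      have "continuous_on \<Gamma> (\<lambda>s::real ^ 'n. prod_list (map (($) (- s)) js))"
        by (induction js) (auto intro!: continuous_intros)
      then show ?thesis by (intro continuous_intros) auto
    qed
    have k\<kappa>: "kern (\<kappa> j)" for j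
      unfolding \<kappa>_def by (intro kern_sum kern_mult w kern_analytic[OF g U[OF _ _ t0]])
    obtain \<rho> where \<rho>: "\<rho> > 0" "cball t0 \<rho> \<subseteq> I" using I t0 open_contains_cball by blast
    \<comment> \<open>Contains every segment on which the Taylor formula is used, for
      \<open>t\<close> within \<rho> of \<open>t0\<close>.\<close>
    define K where "K = (\<lambda>(x, s, t). x - p - t *\<^sub>R s) ` (closure V \<times> \<Gamma> \<times> cball t0 \<rho>)"
    have K: "compact K" unfolding K_def case_prod_beta
      by (intro compact_continuous_image compact_Times compact_closure_V compact_\<Gamma> compact_cball continuous_intros)
    have KU: "K \<subseteq> U" unfolding K_def using U \<rho>(2) by auto
    have "\<exists>B \<delta>. B \<ge> 0 \<and> \<delta> > 0 \<and> (\<forall>js. \<forall>y\<in>K. norm (iter_partial js (iter_partial is g) y) \<le> B * (real (length js) / \<delta>) ^ length js)" for "is"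
    proof -
      obtain B \<delta> where "B \<ge> 0" "\<delta> > 0" "\<And>js y. y \<in> K \<Longrightarrow> norm (iter_partial js (iter_partial is g) y) \<le> B * (real (length js) / \<delta>) ^ length js"
        using real_analytic_compact_bound[OF real_analytic_iter_partial_analytic[OF g, of "is"] K KU] by blast
      then show ?thesis by blast
    qed
    then obtain B \<delta> where B: "\<And>is. B is \<ge> 0" and \<delta>: "\<And>is. \<delta> is > 0"
      and bd: "\<And>is js y. y \<in> K \<Longrightarrow> norm (iter_partial js (iter_partial is g) y) \<le> B is * (real (length js) / \<delta> is) ^ length js"
      by metis
    obtain R where R: "R > 0" "\<And>s i. s \<in> \<Gamma> \<Longrightarrow> \<bar>(- s) $ i\<bar> \<le> R"
    proof -
      obtain R where "R > 0" "\<And>s. s \<in> \<Gamma> \<Longrightarrow> norm s \<le> R" using compact_imp_bounded[OF compact_\<Gamma>] unfolding bounded_pos by auto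
      then show ?thesis using that component_le_norm_cart by (metis norm_minus_cancel order.trans)
    qed
    let ?L = "{is :: 'n list. length is \<le> m}"
    \<comment> \<open>The derivative bounds differ from word to word; \<open>D\<close> and
      \<open>C\<close> serve all words of length at most \<open>m\<close>.\<close>
    define D where "D = Min (insert 1 (\<delta> ` ?L))"
    have D: "D > 0" unfolding D_def using finite_lists_of_length_le \<delta> by (subst Min_gr_iff) auto
    have D\<delta>: "D \<le> \<delta> is" if "length is \<le> m" for "is"
      unfolding D_def using that finite_lists_of_length_le by (intro Min_le) auto
    define C where "C = (\<Sum>is\<in>?L. B is)"
    have C: "C \<ge> 0" unfolding C_def using B by (intro sum_nonneg)
    have BC: "B is \<le> C" if "length is \<le> m" for "is"
      unfolding C_def using that finite_lists_of_length_le B by (intro member_le_sum) auto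
    define E where "E = real CARD('n) * R * exp 1"
    have E: "E > 0" using R by (simp add: E_def)
    \<comment> \<open>Within \<rho> the segments stay in \<open>K\<close>; the second term makes the
      geometric ratio at most 1/2.\<close>
    define r where "r = min \<rho> (D / (2 * E))"
    have r: "r > 0" using \<rho> D E by (simp add: r_def)
    have lim: "(\<lambda>N. op_norm ?X ?Y (\<lambda>f x. A t f x - (\<Sum>j<N. of_real ((t - t0) ^ j) * layer_op (\<kappa> j) [] f x))) \<longlonglongrightarrow> 0"
      if t: "t \<in> I" "\<bar>t - t0\<bar> < r" for t
    proof -
      define \<tau> where "\<tau> = t - t0"
      define \<Delta> where "\<Delta> N is x s = iter_partial is g (x - p - t *\<^sub>R s) - (\<Sum>j<N. of_real (\<tau> ^ j) * \<kappa> j is x s)" for N "is" x s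
      have k\<Delta>: "kern (\<Delta> N)" for N
        unfolding \<Delta>_def by (intro kern_diff kt t kern_sum kern_mult k\<kappa> continuous_intros)
      have Teq: "A t f x - (\<Sum>j<N. of_real ((t - t0) ^ j) * layer_op (\<kappa> j) [] f x) = layer_op (\<Delta> N) [] f x"
        if f: "f \<in> fns ?X" and x: "x \<in> closure V" for f x N
      proof -
        have c: "continuous_on \<Gamma> (\<lambda>s. \<kappa>' [] x s * f s)" if "kern \<kappa>'" for \<kappa>'
          by (rule continuous_on_section[OF _ x]) (use kern_times[OF that holder_fns(1)[OF f \<alpha>]] in \<open>simp add: kern_def\<close>)
        have "layer_op (\<Delta> N) [] f x = (LINT s:\<Gamma>|M. g (x - p - t *\<^sub>R s) * f s - (\<Sum>j<N. of_real (\<tau> ^ j) * (\<kappa> j [] x s * f s)))"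
          unfolding layer_op_def \<Delta>_def by (simp add: left_diff_distrib sum_distrib_right mult.assoc)
        also have "\<dots> = (LINT s:\<Gamma>|M. g (x - p - t *\<^sub>R s) * f s) - (LINT s:\<Gamma>|M. (\<Sum>j<N. of_real (\<tau> ^ j) * (\<kappa> j [] x s * f s)))"
        proof (intro set_integral_diff set_integrable_continuous continuous_on_sum continuous_on_mult_left)
          show "continuous_on \<Gamma> (\<lambda>s. g (x - p - t *\<^sub>R s) * f s)" using c[OF kt[OF t(1)]] by simp
        qed (rule c[OF k\<kappa>])
        also have "(LINT s:\<Gamma>|M. (\<Sum>j<N. of_real (\<tau> ^ j) * (\<kappa> j [] x s * f s))) = (\<Sum>j<N. of_real (\<tau> ^ j) * layer_op (\<kappa> j) [] f x)"
          unfolding layer_op_def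
          by (subst set_integral_sum) (auto intro!: set_integrable_continuous continuous_on_mult_left c k\<kappa>)
        finally show ?thesis using A[OF t(1) f x] by (simp add: \<tau>_def)
      qed
      have bound: "norm (\<Delta> N is x s) \<le> 2 * C * (1 / 2) ^ N"
        if N: "N > 0" and "is": "length is \<le> m" and x: "x \<in> V" and s: "s \<in> \<Gamma>" for N "is" x s
      proof -
        define u where "u = x - p - t0 *\<^sub>R s"
        define f where "f = iter_partial is g"
        have x': "x \<in> closure V" using x closure_subset by blast
        have uK: "u + \<tau>' *\<^sub>R (- s) \<in> K" if "\<bar>\<tau>'\<bar> \<le> \<rho>" for \<tau>'
          unfolding K_def using x' s that
          by (intro image_eqI[of _ _ "(x, s, t0 + \<tau>')"]) (auto simp: u_def algebra_simps dist_norm)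
        have uU: "u \<in> U" using uK[of 0] \<rho> KU by auto
        \<comment> \<open>Exchanging the derivatives in \<open>x\<close> with those along
          \<open>s\<close> makes this a directional derivative of \<open>f\<close>.\<close>
        have "\<kappa> j is x s = (1 / fact j) * dir_deriv (- s) j f u" for j
        proof -
          have "iter_partial (is @ js) g u = iter_partial js f u" for js
            unfolding f_def iter_partial_append[symmetric] by (rule real_analytic_iter_partial(2)[OF g uU])
          then show ?thesis unfolding \<kappa>_def u_def[symmetric] dir_deriv_def
            by (simp add: sum_distrib_left mult_ac)
        qed
        then have eq: "\<Delta> N is x s = f (u + \<tau> *\<^sub>R (- s)) - (\<Sum>j<N. of_real (\<tau> ^ j / fact j) * dir_deriv (- s) j f u)"
          unfolding \<Delta>_def f_def by (simp add: u_def \<tau>_def algebra_simps)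
        have "norm (\<Delta> N is x s) \<le> 2 * B is * (real CARD('n) * R * exp 1 * \<bar>\<tau>\<bar> / \<delta> is) ^ N"
          unfolding eq f_def
        proof (rule dir_deriv_taylor[OF real_analytic_iter_partial_analytic[OF g] KU _ _ \<delta> B bd N])
          show "u + t' *\<^sub>R - s \<in> K" if "\<bar>t'\<bar> \<le> \<bar>\<tau>\<bar>" for t'
            using uK[of t'] that t(2) by (simp add: \<tau>_def r_def)
          show "\<bar>(- s) $ i\<bar> \<le> R" for i by (rule R(2)[OF s])
        qed
        also have "\<dots> \<le> 2 * C * (1 / 2) ^ N"
        proof (intro mult_mono power_mono)
          have "E * \<bar>\<tau>\<bar> \<le> E * (D / (2 * E))" using t(2) E by (intro mult_left_mono) (auto simp: \<tau>_def r_def)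
          also have "\<dots> = D / 2" using E by simp
          also have "\<dots> \<le> \<delta> is / 2" using D\<delta>[OF "is"] by simp
          finally show "real CARD('n) * R * exp 1 * \<bar>\<tau>\<bar> / \<delta> is \<le> 1 / 2"
            using \<delta>[of "is"] by (simp add: E_def pos_divide_le_eq)
        qed (use BC[OF "is"] C B[of "is"] \<delta>[of "is"] R in auto)
        finally show ?thesis .
      qed
      define L where "L = real (card ?L) * measure M \<Gamma> * (2 * C)"
      have "\<bar>op_norm ?X ?Y (\<lambda>f x. A t f x - (\<Sum>j<N. of_real ((t - t0) ^ j) * layer_op (\<kappa> j) [] f x))\<bar> \<le> L * (1 / 2) ^ N" if "N > 0" for N
        using layer_op_norm_le[OF k\<Delta>[of N] \<alpha> Teq bound[OF that]] C by (simp add: L_def mult_ac)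
      \<comment> \<open>The Taylor bound is stated for N > 0; for the limit it suffices
        eventually.\<close>
      then have "\<forall>\<^sub>F N in sequentially. norm (op_norm ?X ?Y (\<lambda>f x. A t f x - (\<Sum>j<N. of_real ((t - t0) ^ j) * layer_op (\<kappa> j) [] f x))) \<le> L * (1 / 2) ^ N"
        by (intro eventually_mono[OF eventually_gt_at_top[of 0]]) auto
      moreover have "(\<lambda>N. L * (1 / 2 :: real) ^ N) \<longlonglongrightarrow> 0"
        using tendsto_mult_right_zero[OF LIMSEQ_power_zero[of "1 / 2 :: real"]] by simp
      ultimately show ?thesis by (rule Lim_null_comparison)
    qed
    have "layer_op (\<kappa> j) [] \<in> bounded_ops ?X ?Y" for j by (rule layer_op_bounded_ops[OF k\<kappa> \<alpha> refl])
    with lim r show ?thesis by (intro exI[of _ r] conjI exI[of _ "\<lambda>j. layer_op (\<kappa> j) []"]) auto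
  qed
  moreover have "A t \<in> bounded_ops ?X ?Y" if "t \<in> I" for t by (rule layer_op_bounded_ops[OF kt[OF that] \<alpha> At[OF that]])
  ultimately show ?thesis unfolding real_analytic_op_map_def by blast
qed

end

section \<open>The surface measure\<close>

abbreviation ball_size :: "nat \<Rightarrow> 'a::metric_space set \<Rightarrow> ennreal" where
  "ball_size s C \<equiv> ennreal (unit_ball_vol (real s) * (diameter C / 2) ^ s)"

text \<open>The premeasure at scale \<delta>, named so that estimates can be made before the
  supremum over \<delta> is taken.\<close>

definition hausdorff_delta :: "nat \<Rightarrow> 'a::metric_space set \<Rightarrow> real \<Rightarrow> ennreal" where
  "hausdorff_delta s A \<delta> = (INF C\<in>{C :: nat \<Rightarrow> 'a set. A \<subseteq> (\<Union>j. C j) \<and> (\<forall>j. bounded (C j) \<and> diameter (C j) \<le> \<delta>)}.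
        (\<Sum>j. ball_size s (C j)))"

lemma hausdorff_outer_eq: "hausdorff_outer s A = (SUP \<delta>\<in>{0<..}. hausdorff_delta s A \<delta>)"
  unfolding hausdorff_outer_def hausdorff_delta_def ..

lemma hausdorff_delta_le:
  assumes "A \<subseteq> (\<Union>j. C j)" "\<And>j. bounded (C j)" "\<And>j. diameter (C j) \<le> \<delta>"
  shows "hausdorff_delta s A \<delta> \<le> (\<Sum>j::nat. ball_size s (C j))"
  unfolding hausdorff_delta_def by (rule INF_lower) (use assms in auto)

lemma hausdorff_outer_mono: "A \<subseteq> B \<Longrightarrow> hausdorff_outer s A \<le> hausdorff_outer s B"
  unfolding hausdorff_outer_eq hausdorff_delta_def by (intro SUP_mono' INF_superset_mono) auto

text \<open>A covering of \<open>A\<close> at scale \<delta>/L is carried to one of the image at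
  scale \<delta>, the size of each piece growing at most by the factor L^s.\<close>

lemma hausdorff_outer_lipschitz:
  fixes f :: "'a::metric_space \<Rightarrow> 'b::real_normed_vector"
  assumes L: "L > 0" and f: "\<And>x y. x \<in> A \<Longrightarrow> y \<in> A \<Longrightarrow> dist (f x) (f y) \<le> L * dist x y"
  shows "hausdorff_outer s (f ` A) \<le> ennreal (L ^ s) * hausdorff_outer s A"
  unfolding hausdorff_outer_eq[of s "f ` A"]
proof (rule SUP_least)
  fix \<delta> :: real assume "\<delta> \<in> {0<..}"
  then have \<delta>: "\<delta> > 0" by simp
  let ?h = "hausdorff_delta s (f ` A) \<delta>"
  \<comment> \<open>The inequality is divided by L^s first, so that \<open>INF_greatest\<close> can
    be applied to the right side.\<close>
  have "ennreal (1 / L ^ s) * ?h \<le> hausdorff_delta s A (\<delta> / L)"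
    unfolding hausdorff_delta_def[of s A]
  proof (rule INF_greatest)
    fix C :: "nat \<Rightarrow> 'a set"
    assume "C \<in> {C. A \<subseteq> (\<Union>j. C j) \<and> (\<forall>j. bounded (C j) \<and> diameter (C j) \<le> \<delta> / L)}"
    then have C: "A \<subseteq> (\<Union>j. C j)" "bounded (C j)" "diameter (C j) \<le> \<delta> / L" for j by auto
    \<comment> \<open>\<open>f\<close> is Lipschitz on \<open>A\<close> only, so the pieces are cut
      down to \<open>A\<close> first.\<close>
    define D where "D j = f ` (C j \<inter> A)" for j
    have d: "norm (u - v) \<le> L * diameter (C j)" if uv: "u \<in> D j" "v \<in> D j" for u v j
    proof -
      from uv obtain x y where xy: "x \<in> C j" "x \<in> A" "u = f x" "y \<in> C j" "y \<in> A" "v = f y" unfolding D_def by blast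
      have "norm (u - v) \<le> L * dist x y" using f[OF xy(2,5)] xy by (simp add: dist_norm)
      also have "\<dots> \<le> L * diameter (C j)" using diameter_bounded_bound[OF C(2) xy(1,4)] L by (intro mult_left_mono) auto
      finally show ?thesis .
    qed
    have dia: "diameter (D j) \<le> L * diameter (C j)" for j
      by (rule diameter_le) (use d diameter_ge_0[OF C(2)] L in auto)
    have "bounded (D j)" for j
    proof (cases "D j = {}")
      case False
      then obtain u where "u \<in> D j" by blast
      then have "D j \<subseteq> cball u (L * diameter (C j))" using d by (auto simp: dist_norm)
      then show ?thesis using bounded_cball bounded_subset by blast
    qed simp
    moreover have "diameter (D j) \<le> \<delta>" for j
    proof -
      have "L * diameter (C j) \<le> L * (\<delta> / L)" using C(3) L by (intro mult_left_mono) auto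
      then show ?thesis using dia[of j] L by simp
    qed
    moreover have "f ` A \<subseteq> (\<Union>j. D j)" using C(1) by (force simp: D_def)
    ultimately have "?h \<le> (\<Sum>j. ball_size s (D j))" by (intro hausdorff_delta_le) auto
    also have "\<dots> \<le> (\<Sum>j. ennreal (L ^ s) * ball_size s (C j))"
    proof (intro suminf_le summableI)
      fix j
      have Dj: "bounded (D j)" by fact
      have "unit_ball_vol (real s) * (diameter (D j) / 2) ^ s \<le> unit_ball_vol (real s) * (L * diameter (C j) / 2) ^ s"
        using dia[of j] diameter_ge_0[OF Dj] by (intro mult_left_mono power_mono divide_right_mono) auto
      also have "\<dots> = L ^ s * (unit_ball_vol (real s) * (diameter (C j) / 2) ^ s)"
        by (simp add: power_mult_distrib power_divide)
      finally have "ball_size s (D j) \<le> ennreal (L ^ s * (unit_ball_vol (real s) * (diameter (C j) / 2) ^ s))"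
        by (rule ennreal_leI)
      then show "ball_size s (D j) \<le> ennreal (L ^ s) * ball_size s (C j)"
        using L by (simp add: ennreal_mult')
    qed
    also have "\<dots> = ennreal (L ^ s) * (\<Sum>j. ball_size s (C j))" by simp
    finally have "ennreal (1 / L ^ s) * ?h \<le> ennreal (1 / L ^ s) * (ennreal (L ^ s) * (\<Sum>j. ball_size s (C j)))"
      by (rule mult_left_mono) simp
    also have "\<dots> = (\<Sum>j. ball_size s (C j))"
      using L by (simp add: mult.assoc[symmetric] ennreal_mult[symmetric])
    finally show "ennreal (1 / L ^ s) * ?h \<le> (\<Sum>j. ball_size s (C j))" .
  qed
  also have "\<dots> \<le> hausdorff_outer s A" unfolding hausdorff_outer_eq by (rule SUP_upper) (use \<delta> L in simp)
  finally have "ennreal (L ^ s) * (ennreal (1 / L ^ s) * ?h) \<le> ennreal (L ^ s) * hausdorff_outer s A"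
    by (rule mult_left_mono) simp
  moreover have "ennreal (L ^ s) * (ennreal (1 / L ^ s) * ?h) = ?h"
    using L by (simp add: mult.assoc[symmetric] ennreal_mult[symmetric])
  ultimately show "?h \<le> ennreal (L ^ s) * hausdorff_outer s A" by simp
qed

text \<open>A grid of mesh c = 2R/N covers the flat cube by (N + 1)^s cells of diameter at most n c.
  Their total size is at most \<open>b\<close> for every N, since (N + 1) c \<le> 4R; so refining
  the grid as \<delta> shrinks does no harm.\<close>

lemma hausdorff_hyperplane_finite:
  assumes n: "CARD('n) \<ge> 2" and R: "R > 0"
  shows "hausdorff_outer (CARD('n) - 1) {y :: real ^ 'n. y $ i = 0 \<and> (\<forall>j. \<bar>y $ j\<bar> \<le> R)} < \<infinity>"
proof -
  define s where "s = CARD('n) - 1"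
  have s: "s \<ge> 1" using n by (simp add: s_def)
  let ?A = "{y :: real ^ 'n. y $ i = 0 \<and> (\<forall>j. \<bar>y $ j\<bar> \<le> R)}"
  define b where "b = unit_ball_vol (real s) * (2 * real CARD('n) * R) ^ s"
  have "hausdorff_delta s ?A \<delta> \<le> ennreal b" if \<delta>: "\<delta> > 0" for \<delta>
  proof -
    obtain N :: nat where N: "real CARD('n) * (2 * R) / \<delta> < real N" using reals_Archimedean2 by blast
    have "0 < real CARD('n) * (2 * R) / \<delta>" using R \<delta> by simp
    then have N0: "real N > 0" using N by linarith
    define c where "c = 2 * R / real N"
    have c: "c > 0" using R N0 by (simp add: c_def)
    \<comment> \<open>The index \<open>i\<close> is left out, as that coordinate is 0. The value
      \<open>N\<close> is attained at the far faces, hence N + 1 cells per direction.\<close>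
    define P where "P = PiE (UNIV - {i}) (\<lambda>_. {..N})"
    define cell' where "cell' f = {y \<in> ?A. \<forall>j. j \<noteq> i \<longrightarrow> real (f j) * c \<le> y $ j + R \<and> y $ j + R \<le> (real (f j) + 1) * c}" for f :: "'n \<Rightarrow> nat"
    have P: "finite P" "card P = (N + 1) ^ s"
      unfolding P_def by (auto intro!: finite_PiE simp: card_PiE s_def card_Diff_subset)
    have cov: "?A \<subseteq> (\<Union>f\<in>P. cell' f)"
    proof
      fix y assume y: "y \<in> ?A"
      define f where "f = restrict (\<lambda>j. nat \<lfloor>(y $ j + R) / c\<rfloor>) (UNIV - {i})"
      have nn: "0 \<le> (y $ j + R) / c" for j
      proof (rule divide_nonneg_pos[OF _ c])
        have "\<bar>y $ j\<bar> \<le> R" using y by blast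
        then show "0 \<le> y $ j + R" by linarith
      qed
      have "f \<in> P"
        unfolding P_def f_def
      proof (intro restrict_PiE_iff[THEN iffD2] ballI)
        fix j assume "j \<in> UNIV - {i}"
        have "y $ j \<le> R" using y by (auto simp: abs_le_iff)
        then have "(y $ j + R) / c \<le> 2 * R / c" using c by (intro divide_right_mono) auto
        also have "\<dots> = real N" using R N0 by (simp add: c_def)
        finally have "\<lfloor>(y $ j + R) / c\<rfloor> \<le> int N" by linarith
        then show "nat \<lfloor>(y $ j + R) / c\<rfloor> \<in> {..N}" by simp
      qed
      moreover have "real (f j) * c \<le> y $ j + R \<and> y $ j + R \<le> (real (f j) + 1) * c" if j: "j \<noteq> i" for j
      proof -
        have fj: "real (f j) = of_int \<lfloor>(y $ j + R) / c\<rfloor>" using j nn[of j] by (simp add: f_def)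
        have "real (f j) \<le> (y $ j + R) / c" "(y $ j + R) / c \<le> real (f j) + 1" unfolding fj by linarith+
        then show ?thesis using c by (simp add: pos_le_divide_eq pos_divide_le_eq)
      qed
      then have "y \<in> cell' f" using y by (simp add: cell'_def)
      ultimately show "y \<in> (\<Union>f\<in>P. cell' f)" by blast
    qed
    have d: "norm (u - v) \<le> real CARD('n) * c" if uv: "u \<in> cell' f" "v \<in> cell' f" for u v f
    proof -
      have "\<bar>(u - v) $ j\<bar> \<le> c" for j
      proof (cases "j = i")
        case False
        then have "real (f j) * c \<le> u $ j + R" "u $ j + R \<le> (real (f j) + 1) * c" "real (f j) * c \<le> v $ j + R" "v $ j + R \<le> (real (f j) + 1) * c"
          using uv by (auto simp: cell'_def)
        then show ?thesis by (simp add: abs_le_iff algebra_simps)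
      qed (use uv c in \<open>auto simp: cell'_def\<close>)
      then have "(\<Sum>j\<in>UNIV. \<bar>(u - v) $ j\<bar>) \<le> (\<Sum>j\<in>(UNIV::'n set). c)" by (intro sum_mono)
      then show ?thesis using norm_le_l1_cart[of "u - v"] by simp
    qed
    obtain e where e: "bij_betw e {..<card P} P" using ex_bij_betw_nat_finite[OF P(1)] by (auto simp: atLeast0LessThan)
    define C where "C j = (if j < card P then cell' (e j) else {})" for j
    have bC: "bounded (C j)" for j
    proof (rule boundedI)
      fix y assume "y \<in> C j"
      then have "\<bar>y $ l\<bar> \<le> R" for l by (auto simp: C_def cell'_def split: if_splits)
      then have "(\<Sum>l\<in>UNIV. \<bar>y $ l\<bar>) \<le> (\<Sum>l\<in>(UNIV::'n set). R)" by (intro sum_mono)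
      then show "norm y \<le> real CARD('n) * R" using norm_le_l1_cart[of y] by simp
    qed
    have dia: "diameter (C j) \<le> real CARD('n) * c" for j
      by (rule diameter_le) (use d c in \<open>auto simp: C_def split: if_splits\<close>)
    have "hausdorff_delta s ?A \<delta> \<le> (\<Sum>j. ball_size s (C j))"
    proof (rule hausdorff_delta_le)
      show "?A \<subseteq> (\<Union>j. C j)"
      proof
        fix y assume "y \<in> ?A"
        with cov have "y \<in> (\<Union>f\<in>P. cell' f)" by (rule subsetD)
        then obtain f where f: "f \<in> P" "y \<in> cell' f" by (rule UN_E)
        then have "f \<in> e ` {..<card P}" using bij_betw_imp_surj_on[OF e] by simp
        then obtain j where "j < card P" "f = e j" by auto
        then have "y \<in> C j" using f(2) by (simp add: C_def)
        then show "y \<in> (\<Union>j. C j)" by (rule UN_I[OF UNIV_I])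
      qed
      show "diameter (C j) \<le> \<delta>" for j
      proof -
        have "real CARD('n) * c = real CARD('n) * (2 * R) / real N" by (simp add: c_def)
        also have "\<dots> \<le> \<delta>" using N N0 \<delta> by (simp add: field_simps)
        finally show ?thesis using dia[of j] by linarith
      qed
    qed (rule bC)
    \<comment> \<open>s \<ge> 1 makes the empty sets of the sequence contribute 0.\<close>
    also have "(\<Sum>j. ball_size s (C j)) = (\<Sum>j<card P. ball_size s (C j))"
      by (rule suminf_finite) (use s in \<open>auto simp: C_def\<close>)
    also have "\<dots> \<le> (\<Sum>j<card P. ennreal (unit_ball_vol (real s) * (real CARD('n) * c / 2) ^ s))"
      using dia diameter_ge_0[OF bC]
      by (intro sum_mono ennreal_leI mult_left_mono power_mono divide_right_mono) auto
    also have "\<dots> = ennreal (real (card P) * (unit_ball_vol (real s) * (real CARD('n) * c / 2) ^ s))"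
      by (simp add: ennreal_mult' ennreal_of_nat_eq_real_of_nat)
    also have "\<dots> \<le> ennreal b"
    proof (rule ennreal_leI)
      have "real (card P) * (unit_ball_vol (real s) * (real CARD('n) * c / 2) ^ s) = unit_ball_vol (real s) * ((real N + 1) * (real CARD('n) * c / 2)) ^ s"
        unfolding P(2) power_mult_distrib[of "real N + 1"] by (simp add: add.commute)
      also have "\<dots> \<le> b"
        unfolding b_def
      proof (intro mult_left_mono power_mono)
        have "1 \<le> real N" using N0 by simp
        then have "(real N + 1) * (real CARD('n) * c / 2) \<le> (2 * real N) * (real CARD('n) * c / 2)"
          using c by (intro mult_right_mono) auto
        also have "\<dots> = 2 * real CARD('n) * R" using N0 by (simp add: c_def)
        finally show "(real N + 1) * (real CARD('n) * c / 2) \<le> 2 * real CARD('n) * R" .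
      qed (use c in auto)
      finally show "real (card P) * (unit_ball_vol (real s) * (real CARD('n) * c / 2) ^ s) \<le> b" .
    qed
    finally show ?thesis .
  qed
  then have "hausdorff_outer s ?A \<le> ennreal b" unfolding hausdorff_outer_eq by (intro SUP_least) auto
  then show ?thesis unfolding s_def[symmetric] by (rule le_less_trans) simp
qed

lemma sets_surface_measure: "sets (surface_measure :: (real ^ 'n) measure) = sets borel"
  unfolding surface_measure_def using sets.sigma_sets_eq[of "borel :: (real ^ 'n) measure"] by simp

lemma space_surface_measure: "space (surface_measure :: (real ^ 'n) measure) = UNIV"
  unfolding surface_measure_def by simp

text \<open>\<^const>\<open>measure_of\<close> returns the null measure if the set function is not countably additive. Both
  alternatives serve our purposes, so Caratheodory's criterion is not needed.\<close>

lemma emeasure_surface_measure: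
  obtains "\<And>B :: (real ^ 'n) set. B \<in> sets borel \<Longrightarrow> emeasure surface_measure B = hausdorff_outer (CARD('n) - 1) B"
  | "\<And>B :: (real ^ 'n) set. emeasure surface_measure B = 0"
proof (cases "measure_space UNIV (sigma_sets UNIV (sets borel)) (hausdorff_outer (CARD('n) - 1) :: (real ^ 'n) set \<Rightarrow> _)")
  case True
  have "emeasure surface_measure B = hausdorff_outer (CARD('n) - 1) B" if "B \<in> sets borel" for B :: "(real ^ 'n) set"
    using that True sets.sigma_sets_eq[of "borel :: (real ^ 'n) measure"]
    by (simp add: surface_measure_def emeasure_measure_of_conv)
  then show ?thesis using that by blast
next
  case False
  have "emeasure surface_measure B = 0" for B :: "(real ^ 'n) set"
    using False by (simp add: surface_measure_def emeasure_measure_of_conv)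
  then show ?thesis using that by blast
qed

lemma emeasure_surface_measure_le:
  fixes B :: "(real ^ 'n) set"
  assumes "B \<in> sets borel" shows "emeasure surface_measure B \<le> hausdorff_outer (CARD('n) - 1) B"
  by (rule emeasure_surface_measure[where 'n = 'n]) (use assms in auto)

text \<open>The inverse of a straightening map is continuously differentiable, hence Lipschitz on a
  small closed ball, so locally the boundary lies in a Lipschitz image of a bounded piece of a
  hyperplane. Compactness leaves finitely many pieces.\<close>

lemma frontier_surface_measure_finite:
  fixes D :: "(real ^ 'n) set"
  assumes n: "CARD('n) \<ge> 2" and bd: "bounded D" and cls: "of_class_C_k_alpha 1 \<alpha> D"
  shows "emeasure surface_measure (frontier D) < \<infinity>"
proof -
  let ?s = "CARD('n) - 1"
  have comp: "compact (frontier D)" using bd by (rule compact_frontier_bounded)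
  have local: "\<exists>W. open W \<and> x0 \<in> W \<and> hausdorff_outer ?s (frontier D \<inter> W) < \<infinity>" if x0: "x0 \<in> frontier D" for x0
  proof -
    obtain r and \<psi> :: "real ^ 'n \<Rightarrow> real ^ 'n" and i where r: "r > 0" and inj: "inj_on \<psi> (ball x0 r)" and op: "open (\<psi> ` ball x0 r)"
      and fr: "\<psi> ` (ball x0 r \<inter> frontier D) \<subseteq> {y. y $ i = 0}"
      and c1: "C_k_alpha_on 1 \<alpha> (ball x0 r) \<psi>" and c2: "C_k_alpha_on 1 \<alpha> (\<psi> ` ball x0 r) (inv_into (ball x0 r) \<psi>)"
      using bspec[OF cls[unfolded of_class_C_k_alpha_def] x0] by blast
    define g where "g = inv_into (ball x0 r) \<psi>"
    let ?U = "\<psi> ` ball x0 r"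
    have cont: "continuous_on (ball x0 r) \<psi>"
    proof -
      have "length ([]::'n list) \<le> 1 \<longrightarrow> continuous_on (ball x0 r) (iter_partial [] \<psi>)"
        using c1 unfolding C_k_alpha_on_def C_k_on_def by blast
      then show ?thesis by simp
    qed
    have gd: "g differentiable (at y)" if "y \<in> ?U" for y
    proof -
      have "length ([]::'n list) < 1 \<longrightarrow> iter_partial [] g differentiable (at y)"
        using c2 that unfolding C_k_alpha_on_def C_k_on_def g_def by blast
      then show ?thesis by simp
    qed
    have gp: "continuous_on ?U (\<lambda>y. frechet_derivative g (at y) (axis j 1))" for j
    proof -
      have "length [j] \<le> 1 \<longrightarrow> continuous_on ?U (iter_partial [j] g)"
        using c2 unfolding C_k_alpha_on_def C_k_on_def g_def by blast
      then show ?thesis by simp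
    qed
    have "\<psi> x0 \<in> ?U" using r by simp
    then obtain \<rho> where \<rho>: "\<rho> > 0" "cball (\<psi> x0) \<rho> \<subseteq> ?U" using op open_contains_cball by blast
    have "\<exists>B. \<forall>y\<in>cball (\<psi> x0) \<rho>. norm (frechet_derivative g (at y) (axis j 1)) \<le> B" for j
    proof -
      have "bounded ((\<lambda>y. frechet_derivative g (at y) (axis j 1)) ` cball (\<psi> x0) \<rho>)"
        by (intro compact_imp_bounded compact_continuous_image continuous_on_subset[OF gp \<rho>(2)]) auto
      then show ?thesis unfolding bounded_iff by auto
    qed
    then obtain B where B: "\<And>j y. y \<in> cball (\<psi> x0) \<rho> \<Longrightarrow> norm (frechet_derivative g (at y) (axis j 1)) \<le> B j" by metis
    \<comment> \<open>The sum bounds the derivative through its values on the axes; the 1 makes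
      \<open>L\<close> positive.\<close>
    define L where "L = (\<Sum>j\<in>UNIV. \<bar>B j\<bar>) + 1"
    have L: "L > 0" unfolding L_def by (intro add_nonneg_pos sum_nonneg) auto
    have gl: "dist (g x) (g y) \<le> L * dist x y" if "x \<in> cball (\<psi> x0) \<rho>" "y \<in> cball (\<psi> x0) \<rho>" for x y
    proof -
      have "norm (g x - g y) \<le> L * norm (x - y)"
      proof (rule differentiable_bound[OF convex_cball _ _ that])
        fix z assume z: "z \<in> cball (\<psi> x0) \<rho>"
        let ?D = "frechet_derivative g (at z)"
        have D: "(g has_derivative ?D) (at z)" using gd \<rho>(2) z by (simp add: subset_iff frechet_derivative_works)
        then show "(g has_derivative ?D) (at z within cball (\<psi> x0) \<rho>)" by (rule has_derivative_at_withinI)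
        show "onorm ?D \<le> L"
        proof (rule onorm_le)
          fix h :: "real ^ 'n"
          have "?D h = (\<Sum>j\<in>UNIV. (h $ j) *\<^sub>R ?D (axis j 1))"
            by (rule linear_axis_expansion[OF has_derivative_linear[OF D]])
          also have "norm \<dots> \<le> (\<Sum>j\<in>UNIV. norm h * \<bar>B j\<bar>)"
          proof (rule sum_norm_le)
            fix j
            have "norm (?D (axis j 1)) \<le> \<bar>B j\<bar>" using B[OF z, of j] by linarith
            then show "norm ((h $ j) *\<^sub>R ?D (axis j 1)) \<le> norm h * \<bar>B j\<bar>"
              unfolding norm_scaleR using component_le_norm_cart[of h j] by (intro mult_mono) auto
          qed
          also have "\<dots> \<le> L * norm h"
            unfolding L_def by (simp add: sum_distrib_left[symmetric] mult.commute distrib_left)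
          finally show "norm (?D h) \<le> L * norm h" .
        qed
      qed
      then show ?thesis by (simp add: dist_norm)
    qed
    \<comment> \<open>Points whose image stays in the ball where \<open>g\<close> is
      Lipschitz.\<close>
    define W where "W = ball x0 r \<inter> \<psi> -` ball (\<psi> x0) \<rho>"
    have W: "open W" unfolding W_def using cont by (intro continuous_open_preimage) auto
    define P where "P = {y. y $ i = 0} \<inter> cball (\<psi> x0) \<rho>"
    have sub: "frontier D \<inter> W \<subseteq> g ` P"
    proof
      fix x assume x: "x \<in> frontier D \<inter> W"
      then have "g (\<psi> x) = x" unfolding g_def W_def using inj by (intro inv_into_f_f) auto
      moreover have "\<psi> x \<in> \<psi> ` (ball x0 r \<inter> frontier D)" using x by (intro imageI) (auto simp: W_def)
      with fr have "\<psi> x \<in> {y. y $ i = 0}" by (rule subsetD)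
      then have "\<psi> x \<in> P" using x by (auto simp: P_def W_def less_imp_le)
      ultimately show "x \<in> g ` P" by (metis imageI)
    qed
    define R where "R = norm (\<psi> x0) + \<rho>"
    have R: "R > 0" using \<rho> unfolding R_def by (simp add: add_nonneg_pos)
    have "P \<subseteq> {y. y $ i = 0 \<and> (\<forall>j. \<bar>y $ j\<bar> \<le> R)}"
    proof (intro subsetI CollectI conjI allI)
      fix y j assume y: "y \<in> P"
      then show "y $ i = 0" by (simp add: P_def)
      have "norm y \<le> norm (\<psi> x0) + norm (y - \<psi> x0)" by (rule norm_triangle_sub)
      then show "\<bar>y $ j\<bar> \<le> R"
        using component_le_norm_cart[of y j] y by (simp add: P_def R_def dist_norm norm_minus_commute)
    qed
    from hausdorff_outer_mono[OF this, of ?s] have P: "hausdorff_outer ?s P < \<infinity>"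
      using hausdorff_hyperplane_finite[OF n R, of i] by (rule le_less_trans)
    have "hausdorff_outer ?s (frontier D \<inter> W) \<le> hausdorff_outer ?s (g ` P)" by (rule hausdorff_outer_mono[OF sub])
    also have "\<dots> \<le> ennreal (L ^ ?s) * hausdorff_outer ?s P"
      by (rule hausdorff_outer_lipschitz[OF L]) (use gl in \<open>auto simp: P_def\<close>)
    also have "\<dots> < \<infinity>" using P by (simp add: ennreal_mult_less_top)
    finally show ?thesis using W r \<rho> by (intro exI[of _ W]) (auto simp: W_def)
  qed
  then obtain W where W: "\<And>x. x \<in> frontier D \<Longrightarrow> open (W x) \<and> x \<in> W x \<and> hausdorff_outer ?s (frontier D \<inter> W x) < \<infinity>"
    by metis
  obtain F where F: "F \<subseteq> frontier D" "finite F" "frontier D \<subseteq> (\<Union>x\<in>F. W x)"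
    using compactE_image[OF comp, of "frontier D" W] W by blast
  have m: "frontier D \<inter> W x \<in> sets borel" if "x \<in> F" for x
    using W[of x] F that by (intro sets.Int borel_open borel_closed) auto
  have "emeasure surface_measure (frontier D) = emeasure surface_measure (\<Union>x\<in>F. frontier D \<inter> W x)"
    using F(3) by (intro arg_cong[of _ _ "emeasure _"]) blast
  also have "\<dots> \<le> (\<Sum>x\<in>F. emeasure surface_measure (frontier D \<inter> W x))"
    using F m by (intro emeasure_subadditive_finite) (auto simp: sets_surface_measure)
  also have "\<dots> < \<infinity>"
  proof -
    have "emeasure surface_measure (frontier D \<inter> W x) < \<infinity>" if "x \<in> F" for x
      using emeasure_surface_measure_le[OF m[OF that]] W[of x] F that by (auto intro: le_less_trans)
    then show ?thesis using F(2) by simp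
  qed
  finally show ?thesis .
qed

section \<open>Scaling and translation of the boundary and its measure\<close>

lemma frontier_scaled_set:
  fixes \<Omega> :: "(real ^ 'n) set"
  assumes "\<epsilon> \<noteq> 0"
  shows "frontier (scaled_set p \<epsilon> \<Omega>) = (\<lambda>x. p + \<epsilon> *\<^sub>R x) ` frontier \<Omega>"
proof -
  let ?f = "\<lambda>x :: real ^ 'n. \<epsilon> *\<^sub>R x"
  have l: "linear ?f" "inj ?f" using assms by (auto intro!: linear_scaleR injI)
  have "frontier (?f ` \<Omega>) = ?f ` frontier \<Omega>"
    unfolding frontier_def interior_injective_linear_image[OF l] closure_injective_linear_image[OF l, symmetric]
    by (rule image_set_diff[OF l(2), symmetric])
  then show ?thesis unfolding scaled_set_def using frontier_translation[of p "?f ` \<Omega>"] by (simp add: image_image)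
qed

text \<open>The Lipschitz estimate for the similarity and for its inverse gives both inequalities
  for the outer measure; for the null measure both sides are 0.\<close>

lemma emeasure_surface_measure_scaled:
  fixes A :: "(real ^ 'n) set"
  assumes \<epsilon>: "\<epsilon> > 0" and A: "A \<in> sets borel"
  shows "emeasure surface_measure ((\<lambda>x. p + \<epsilon> *\<^sub>R x) ` A) = ennreal (\<epsilon> ^ (CARD('n) - 1)) * emeasure surface_measure A"
proof -
  let ?s = "CARD('n) - 1" and ?f = "\<lambda>x. p + \<epsilon> *\<^sub>R x" and ?g = "\<lambda>y. (1 / \<epsilon>) *\<^sub>R (y - p)"
  have gf: "?g (?f x) = x" and fg: "?f (?g y) = y" for x y using \<epsilon> by auto
  have "?f ` A = ?g -` A" using gf fg by (force simp: image_iff)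
  moreover have "?g \<in> borel_measurable borel" by measurable
  ultimately have m: "?f ` A \<in> sets borel" using A by (metis (no_types, lifting) measurable_sets_borel)
  have 1: "hausdorff_outer ?s (?f ` A) \<le> ennreal (\<epsilon> ^ ?s) * hausdorff_outer ?s A"
    by (rule hausdorff_outer_lipschitz[OF \<epsilon>]) (use \<epsilon> in \<open>simp add: dist_norm scaleR_diff_right[symmetric]\<close>)
  have "hausdorff_outer ?s (?g ` ?f ` A) \<le> ennreal ((1 / \<epsilon>) ^ ?s) * hausdorff_outer ?s (?f ` A)"
    by (rule hausdorff_outer_lipschitz) (use \<epsilon> in \<open>simp_all add: dist_norm scaleR_diff_right[symmetric]\<close>)
  moreover have "?g ` ?f ` A = A" unfolding image_image gf by simp
  ultimately have "hausdorff_outer ?s A \<le> ennreal ((1 / \<epsilon>) ^ ?s) * hausdorff_outer ?s (?f ` A)" by simp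
  from mult_left_mono[OF this, of "ennreal (\<epsilon> ^ ?s)"]
  have "ennreal (\<epsilon> ^ ?s) * hausdorff_outer ?s A \<le> ennreal (\<epsilon> ^ ?s) * (ennreal ((1 / \<epsilon>) ^ ?s) * hausdorff_outer ?s (?f ` A))" by simp
  also have "\<dots> = hausdorff_outer ?s (?f ` A)"
    using \<epsilon> by (simp add: mult.assoc[symmetric] ennreal_mult[symmetric] power_mult_distrib[symmetric])
  finally have 2: "hausdorff_outer ?s (?f ` A) = ennreal (\<epsilon> ^ ?s) * hausdorff_outer ?s A" using 1 by (intro antisym)
  show ?thesis
    by (rule emeasure_surface_measure[where 'n = 'n]) (use m A 2 in auto)
qed

text \<open>Surface measure is \<epsilon>^(n-1) times its own image under the similarity, as is
  checked on Borel sets; the formula is then a change of variables.\<close>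

lemma integral_surface_measure_scaled:
  fixes F :: "real ^ 'n \<Rightarrow> complex"
  assumes \<epsilon>: "\<epsilon> > 0" and F: "F \<in> borel_measurable borel"
  shows "integral\<^sup>L surface_measure F = of_real (\<epsilon> ^ (CARD('n) - 1)) * (\<integral>x. F (p + \<epsilon> *\<^sub>R x) \<partial>surface_measure)"
proof -
  let ?S = "surface_measure :: (real ^ 'n) measure" and ?f = "\<lambda>x. p + \<epsilon> *\<^sub>R x"
  let ?D = "distr ?S borel ?f" and ?c = "\<epsilon> ^ (CARD('n) - 1)"
  have fm: "?f \<in> measurable ?S borel"
    unfolding measurable_cong_sets[OF sets_surface_measure refl] by measurable
  have Fm: "F \<in> borel_measurable ?D" using F by simp
  have "?S = density ?D (\<lambda>_. ennreal ?c)"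
  proof (rule measure_eqI)
    show "sets ?S = sets (density ?D (\<lambda>_. ennreal ?c))" by (simp add: sets_surface_measure)
    fix B assume "B \<in> sets ?S"
    then have B: "B \<in> sets borel" by (simp add: sets_surface_measure)
    have pre: "?f -` B \<in> sets borel" using measurable_sets_borel[OF _ B, of ?f] by simp
    have "?f ` (?f -` B) = B"
    proof -
      have "surj ?f" by (rule surjI[of _ "\<lambda>y. (1 / \<epsilon>) *\<^sub>R (y - p)"]) (use \<epsilon> in simp)
      then show ?thesis by (rule surj_image_vimage_eq)
    qed
    then have "emeasure ?S B = ennreal ?c * emeasure ?S (?f -` B)"
      using emeasure_surface_measure_scaled[OF \<epsilon> pre, of p] by simp
    also have "\<dots> = emeasure (density ?D (\<lambda>_. ennreal ?c)) B"
      using B fm by (simp add: emeasure_density_const emeasure_distr space_surface_measure)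
    finally show "emeasure ?S B = emeasure (density ?D (\<lambda>_. ennreal ?c)) B" .
  qed
  then have "integral\<^sup>L ?S F = integral\<^sup>L (density ?D (\<lambda>_. ennreal ?c)) F" by simp
  also have "\<dots> = (\<integral>x. ?c *\<^sub>R F x \<partial>?D)" using \<epsilon> by (intro integral_density Fm) auto
  also have "\<dots> = ?c *\<^sub>R integral\<^sup>L ?D F" by simp
  also have "integral\<^sup>L ?D F = (\<integral>x. F (?f x) \<partial>?S)" by (rule integral_distr[OF fm F])
  finally show ?thesis by (simp add: scaleR_conv_of_real)
qed

section \<open>The single layer potential\<close>

text \<open>Otherwise \<open>x\<close> would lie in the closure of the periodic set, because the
  affine map carries the closure of \<Omega> into it. The argument covers \<open>t = 0\<close> and
  negative \<open>t\<close>, which the expansion around \<epsilon> = 0 requires.\<close>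

lemma lattice_avoidance:
  assumes x: "x \<in> S_per_minus q (scaled_set p t \<Omega>)" and s: "s \<in> closure \<Omega>"
  shows "x - p - t *\<^sub>R s \<notin> periodic_lattice q"
proof
  assume "x - p - t *\<^sub>R s \<in> periodic_lattice q"
  then obtain z where z: "x - p - t *\<^sub>R s = q *v int_vec z" unfolding periodic_lattice_def by blast
  let ?f = "\<lambda>s. q *v int_vec z + (p + t *\<^sub>R s)"
  have "?f ` closure \<Omega> \<subseteq> closure (S_per q (scaled_set p t \<Omega>))"
  proof (rule image_closure_subset)
    show "continuous_on (closure \<Omega>) ?f" by (intro continuous_intros)
    have "?f ` \<Omega> \<subseteq> S_per q (scaled_set p t \<Omega>)" unfolding S_per_def scaled_set_def by blast
    then show "?f ` \<Omega> \<subseteq> closure (S_per q (scaled_set p t \<Omega>))" using closure_subset by blast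
  qed simp
  moreover have "x = ?f s" using z by (simp add: algebra_simps)
  ultimately have "x \<in> closure (S_per q (scaled_set p t \<Omega>))" using s by blast
  with x show False by (simp add: S_per_minus_def)
qed

theorem proposition5p5:
  fixes \<alpha> :: real and q :: "real ^ 'n ^ 'n" and \<eta> p :: "real ^ 'n" and k :: complex
    and \<Omega> V :: "(real ^ 'n) set" and \<epsilon>0 \<epsilon>V :: real
    and M :: "real \<Rightarrow> (real ^ 'n \<Rightarrow> complex) \<Rightarrow> real ^ 'n \<Rightarrow> complex"
  assumes "CARD('n) \<ge> 2"
    and "0 < \<alpha>" and "\<alpha> < 1"
    and "q \<in> pos_diag"
    and "bounded \<Omega>" and "open \<Omega>" and "connected \<Omega>"
    and "of_class_C_k_alpha 1 \<alpha> \<Omega>"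
    and "connected (UNIV - closure \<Omega>)"
    and "p \<in> cell q"
    and "0 < \<epsilon>0"
    and "\<And>\<epsilon>. \<epsilon> \<in> {-\<epsilon>0<..<\<epsilon>0} \<Longrightarrow> scaled_set p \<epsilon> (closure \<Omega>) \<subseteq> cell q"
    and "bounded V" and "open V"
    and "closure V \<inter> (\<lambda>x. p + x) ` periodic_lattice q = {}"
    and "\<epsilon>V \<in> {0<..<\<epsilon>0}"
    and "\<And>\<epsilon>. \<epsilon> \<in> {-\<epsilon>V<..<\<epsilon>V} \<Longrightarrow> closure V \<subseteq> S_per_minus q (scaled_set p \<epsilon> \<Omega>)"
    and M_def: "\<And>\<epsilon> \<theta> x. \<epsilon> \<in> {-\<epsilon>V<..<\<epsilon>V} \<Longrightarrow> \<theta> \<in> fns (holder_space \<alpha> (frontier \<Omega>)) \<Longrightarrow> x \<in> closure V \<Longrightarrow>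
           M \<epsilon> \<theta> x =
             (LINT s:frontier \<Omega>|surface_measure. green_function q \<eta> k (x - p - \<epsilon> *\<^sub>R s) * \<theta> s)"
  shows "real_analytic_op_map {-\<epsilon>V<..<\<epsilon>V} (holder_space \<alpha> (frontier \<Omega>)) (C_closure_space 2 V) M \<and>
    (\<forall>\<theta>\<in>fns (holder_space \<alpha> (frontier \<Omega>)). \<forall>\<epsilon>\<in>{0<..<\<epsilon>V}. \<forall>x\<in>closure V.
       single_layer_minus q \<eta> k (scaled_set p \<epsilon> \<Omega>) (\<lambda>y. \<theta> ((1 / \<epsilon>) *\<^sub>R (y - p))) x
         = of_real (\<epsilon> ^ (CARD('n) - 1)) * M \<epsilon> \<theta> x)"
proof
  let ?\<Gamma> = "frontier \<Omega>" and ?I = "{-\<epsilon>V<..<\<epsilon>V}" and ?U = "UNIV - periodic_lattice q" and ?s = "CARD('n) - 1"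
  define g where "g = green_function q \<eta> k"
  \<comment> \<open>Existence passes to the chosen function.\<close>
  have "is_green_function q \<eta> k g"
    unfolding g_def green_function_def by (rule someI_ex[OF is_green_function_exists[OF \<open>q \<in> pos_diag\<close>]])
  then have g: "real_analytic_fun_on ?U g" unfolding is_green_function_def by blast
  have cg: "continuous_on ?U g"
    using real_analytic_iter_partial(1)[OF g, of _ "[]"]
    by (intro continuous_at_imp_continuous_on ballI differentiable_imp_continuous_within) simp
  have "emeasure surface_measure ?\<Gamma> < \<infinity>"
    by (rule frontier_surface_measure_finite) fact+
  then interpret boundary surface_measure ?\<Gamma> V
    using \<open>bounded \<Omega>\<close> \<open>open V\<close> \<open>bounded V\<close>
    by unfold_locales (auto simp: sets_surface_measure compact_frontier_bounded)
  have Vx: "x \<in> S_per_minus q (scaled_set p t \<Omega>)" if "x \<in> closure V" "t \<in> ?I" for x t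
    using assms(17)[OF that(2)] that(1) by blast
  have U: "x - p - t *\<^sub>R s \<in> ?U" if "x \<in> closure V" "s \<in> ?\<Gamma>" "t \<in> ?I" for x s t
    using lattice_avoidance[OF Vx[OF that(1,3)]] that(2) by (auto simp: frontier_def)
  show "real_analytic_op_map ?I (holder_space \<alpha> ?\<Gamma>) (C_closure_space 2 V) M"
    by (rule potential_real_analytic[OF g open_greaterThanLessThan \<open>0 < \<alpha>\<close> U]) (simp_all add: M_def g_def)
  show "\<forall>\<theta>\<in>fns (holder_space \<alpha> ?\<Gamma>). \<forall>\<epsilon>\<in>{0<..<\<epsilon>V}. \<forall>x\<in>closure V.
       single_layer_minus q \<eta> k (scaled_set p \<epsilon> \<Omega>) (\<lambda>y. \<theta> ((1 / \<epsilon>) *\<^sub>R (y - p))) x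
         = of_real (\<epsilon> ^ ?s) * M \<epsilon> \<theta> x"
  proof (intro ballI)
    fix \<theta> \<epsilon> x
    assume \<theta>: "\<theta> \<in> fns (holder_space \<alpha> ?\<Gamma>)" and "\<epsilon> \<in> {0<..<\<epsilon>V}" and x: "x \<in> closure V"
    then have \<epsilon>: "\<epsilon> > 0" "\<epsilon> \<in> ?I" by auto
    let ?D = "scaled_set p \<epsilon> \<Omega>"
    have fr: "frontier ?D = (\<lambda>s. p + \<epsilon> *\<^sub>R s) ` ?\<Gamma>" by (rule frontier_scaled_set) (use \<epsilon>(1) in simp)
    \<comment> \<open>The indicator is kept inside the integrand because the scaling formula is for
      integrals over the whole space; after scaling it becomes the indicator of the frontier of
      \<Omega>.\<close>
    define F where "F y = indicator (frontier ?D) y *\<^sub>R (g (x - y) * \<theta> ((1 / \<epsilon>) *\<^sub>R (y - p)))" for y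
    have "continuous_on (frontier ?D) (\<lambda>y. g (x - y) * \<theta> ((1 / \<epsilon>) *\<^sub>R (y - p)))"
    proof (intro continuous_on_mult continuous_on_compose2[OF cg] continuous_on_compose2[OF holder_fns(1)[OF \<theta> \<open>0 < \<alpha>\<close>]] continuous_intros)
      show "(\<lambda>y. x - y) ` frontier ?D \<subseteq> ?U" unfolding fr using U[OF x _ \<epsilon>(2)] by (auto simp: diff_diff_eq)
      show "(\<lambda>y. (1 / \<epsilon>) *\<^sub>R (y - p)) ` frontier ?D \<subseteq> ?\<Gamma>" unfolding fr using \<epsilon>(1) by auto
    qed
    then have Fm: "F \<in> borel_measurable borel"
      unfolding F_def[abs_def] by (intro borel_measurable_continuous_on_indicator) auto
    \<comment> \<open>\<open>restrict\<close> agrees with the potential on this closure.\<close>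
    have "x \<in> closure (S_per_minus q ?D)" using Vx[OF x \<epsilon>(2)] closure_subset by blast
    then have "single_layer_minus q \<eta> k ?D (\<lambda>y. \<theta> ((1 / \<epsilon>) *\<^sub>R (y - p))) x = integral\<^sup>L surface_measure F"
      by (simp add: single_layer_minus_def single_layer_def set_lebesgue_integral_def F_def[abs_def] g_def)
    also have "\<dots> = of_real (\<epsilon> ^ ?s) * (\<integral>s. F (p + \<epsilon> *\<^sub>R s) \<partial>surface_measure)"
      by (rule integral_surface_measure_scaled[OF \<epsilon>(1) Fm])
    also have "(\<integral>s. F (p + \<epsilon> *\<^sub>R s) \<partial>surface_measure) = M \<epsilon> \<theta> x"
      unfolding M_def[OF \<epsilon>(2) \<theta> x] set_lebesgue_integral_def
    proof (rule Bochner_Integration.integral_cong[OF refl])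
      fix s
      have "p + \<epsilon> *\<^sub>R s \<in> frontier ?D \<longleftrightarrow> s \<in> ?\<Gamma>" unfolding fr using \<epsilon>(1) by (auto simp: image_iff)
      then show "F (p + \<epsilon> *\<^sub>R s) = indicator ?\<Gamma> s *\<^sub>R (green_function q \<eta> k (x - p - \<epsilon> *\<^sub>R s) * \<theta> s)"
        using \<epsilon>(1) by (simp add: F_def g_def indicator_def diff_diff_eq)
    qed
    finally show "single_layer_minus q \<eta> k ?D (\<lambda>y. \<theta> ((1 / \<epsilon>) *\<^sub>R (y - p))) x = of_real (\<epsilon> ^ ?s) * M \<epsilon> \<theta> x" .
  qed
qed

end
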